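(* Suppose that $0<\rho<\lambda_0$, and let $\{\psi_\alpha\}_{\alpha\in\mathbb N_0^n}$ be the normalized holomorphic Hermite functions defined in the context. Then $\{\psi_\alpha\}_{\alpha\in\mathbb N_0^n}$ is a complete orthonormal system of $\mathscr H_\Phi(\mathbb C^n)$.
   Context: Let $n\ge 1$. For column vectors $z,\zeta\in\mathbb C^n$ write $\langle z,\zeta\rangle=\sum_{j}z_j\zeta_j$ (bilinear, no conjugation). For a matrix $M$, ${}^tM$ is the transpose, $\overline M$ the entrywise conjugate, $M^*={}^t\overline M$. Fix complex $n\times n$ matrices $A,B,C$ with ${}^tA=A$, $\det B\ne0$, ${}^tC=C$ and $C_I=\frac{C-\overline C}{2\sqrt{-1}}$ positive definite. Set $$\Phi''_{z\bar z}=\tfrac14 BC_I^{-1}B^*,\qquad \Phi''_{zz}=-\tfrac14BC_I^{-1}\,{}^tB-\tfrac{A}{2\sqrt{-1}},\qquad \Phi(z)=\langle z,\Phi''_{z\bar z}\bar z\rangle+\operatorname{Re}\langle z,\Phi''_{zz}z\rangle .$$ $\Phi''_{z\bar z}$ is positive definite Hermitian, $\Phi''_{zz}$ is complex symmetric. $\mathscr H_\Phi(\mathbb C^n)$ is the Hilbert space of entire functions $F$ on $\mathbb C^n$ with $\int|F|^2e^{-2\Phi}L(dz)<\infty$ ($L$ Lebesgue measure), with inner product $(F,G)=\int_{\mathbb C^n}F\overline Ge^{-2\Phi}L(dz)$ and corresponding norm $\|\cdot\|_{\mathscr H_\Phi(\mathbb C^n)}$. The eigenvalues of $\Phi''_{z\bar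 z}$ (with multiplicity) are $\lambda_1^2,\dots,\lambda_n^2$ with $\lambda_i>0$; $\lambda_0=\min_i\lambda_i$; $U$ is a fixed unitary matrix with $U^*\Phi''_{z\bar z}U=\operatorname{diag}(\lambda_1^2,\dots,\lambda_n^2)$. Fix $\rho\in(0,\lambda_0)$ and put $\mu_i=\sqrt{\lambda_i^2-\rho^2}>0$. Fix an arbitrary $n\times n$ unitary matrix $X$ with ${}^tX\operatorname{diag}(\mu_1/\lambda_1,\dots,\mu_n/\lambda_n)=\operatorname{diag}(\mu_1/\lambda_1,\dots,\mu_n/\lambda_n)X$, and define the (complex symmetric) matrix $$Q=[q_{ij}]=-\Phi''_{zz}+U\operatorname{diag}(\mu_1,\dots,\mu_n)X\operatorname{diag}(\lambda_1,\dots,\lambda_n)\,{}^tU .$$ Put $\tilde\psi_0(z)=\exp(-\langle z,Qz\rangle)$ and $\Lambda_i=\frac{\partial}{\partial z_i}+2\sum_j q_{ij}z_j$, acting on entire functions. $\Lambda_i^*$ denotes the adjoint of $\Lambda_i$ in $\mathscr H_\Phi(\mathbb C^n)$, understood as the differential operator: the unique operator of the form $\sum_k a_k\frac{\partial}{\partial z_k}+\sum_k b_kz_k+c$ with complex constants $a_k,b_k,c$ such that $(\Lambda_iF,G)=(F,\Lambda_i^*G)$ for all $F,G\in\mathscr H_\Phi(\mathbb C^n)$ with $z_kF,\ \partial F/\partial z_k,\ z_kG,\ \partial G/\partial z_k\in\mathscr H_\Phi(\mathbb C^n)$ for all $k$. (The $\Lambda_i^*$ commute with each other.) For $\alpha\in\mathbb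 N_0^n$, $|\alpha|=\sum\alpha_i$, $\alpha!=\prod\alpha_i!$, $\tilde\psi_\alpha=(\Lambda_1^* )^{\alpha_1}\cdots(\Lambda_n^* )^{\alpha_n}\tilde\psi_0\in\mathscr H_\Phi(\mathbb C^n)$ and $$\psi_\alpha=\frac{\tilde\psi_\alpha}{\sqrt{(2\rho^2)^{|\alpha|}\alpha!}\,\|\tilde\psi_0\|_{\mathscr H_\Phi(\mathbb C^n)}} .$$ *)

theory Defs
  imports "HOL-Analysis.Analysis"
begin

definition bilin :: "complex^'n::finite \<Rightarrow> complex^'n \<Rightarrow> complex" where
  "bilin z w = (\<Sum>j\<in>UNIV. z $ j * w $ j)"

definition cnj_vec :: "complex^'n::finite \<Rightarrow> complex^'n" where
  "cnj_vec z = (\<chi> j. cnj (z $ j))"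

definition cnj_mat :: "complex^'n::finite^'n \<Rightarrow> complex^'n^'n" where
  "cnj_mat M = (\<chi> i j. cnj (M $ i $ j))"

definition adj_mat :: "complex^'n::finite^'n \<Rightarrow> complex^'n^'n" where
  "adj_mat M = transpose (cnj_mat M)"

definition unitary_mat :: "complex^'n::finite^'n \<Rightarrow> bool" where
  "unitary_mat M \<longleftrightarrow> adj_mat M ** M = mat 1 \<and> M ** adj_mat M = mat 1"

definition pos_def_mat :: "complex^'n::finite^'n \<Rightarrow> bool" where
  "pos_def_mat M \<longleftrightarrow> adj_mat M = M \<and> (\<forall>z. z \<noteq> 0 \<longrightarrow> 0 < Re (bilin (cnj_vec z) (M *v z)))"

definition diag_mat :: "('n::finite \<Rightarrow> real) \<Rightarrow> complex^'n^'n" where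
  "diag_mat d = (\<chi> i j. if i = j then complex_of_real (d i) else 0)"

definition imag_mat :: "complex^'n::finite^'n \<Rightarrow> complex^'n^'n" where
  "imag_mat C = (\<chi> i j. (C $ i $ j - cnj (C $ i $ j)) / (2 * \<i>))"

definition Phi_zzbar :: "complex^'n::finite^'n \<Rightarrow> complex^'n^'n \<Rightarrow> complex^'n^'n" where
  "Phi_zzbar B C = (1/4) *\<^sub>R (B ** matrix_inv (imag_mat C) ** adj_mat B)"

definition Phi_zz ::
    "complex^'n::finite^'n \<Rightarrow> complex^'n^'n \<Rightarrow> complex^'n^'n \<Rightarrow> complex^'n^'n" where
  "Phi_zz A B C = - ((1/4) *\<^sub>R (B ** matrix_inv (imag_mat C) ** transpose B))
                  - (\<chi> i j. A $ i $ j / (2 * \<i>))"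

text \<open>The first summand is already real when \<open>Phi_zzbar B C\<close> is Hermitian
  (\<open>Phi_first_summand_real\<close> below); the outer real part there only makes the weight real-valued.\<close>

definition Phi :: "complex^'n::finite^'n \<Rightarrow> complex^'n^'n \<Rightarrow> complex^'n^'n \<Rightarrow> complex^'n \<Rightarrow> real" where
  "Phi A B C z = Re (bilin z (Phi_zzbar B C *v cnj_vec z)) + Re (bilin z (Phi_zz A B C *v z))"

lemma bilin_hermitian_real:
  assumes "adj_mat M = M"
  shows "bilin z (M *v cnj_vec z) \<in> \<real>"
proof -
  have M: "cnj (M $ i $ j) = M $ j $ i" for i j
    using arg_cong[OF assms, of "\<lambda>N. N $ j $ i"]
    by (simp add: adj_mat_def cnj_mat_def transpose_def)
  have "cnj (bilin z (M *v cnj_vec z)) = (\<Sum>i\<in>UNIV. \<Sum>j\<in>UNIV. cnj (z $ i) * (M $ j $ i * z $ j))"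
    by (simp add: bilin_def matrix_vector_mult_def cnj_vec_def sum_distrib_left M)
  also have "\<dots> = (\<Sum>j\<in>UNIV. \<Sum>i\<in>UNIV. cnj (z $ i) * (M $ j $ i * z $ j))"
    by (rule sum.swap)
  also have "\<dots> = bilin z (M *v cnj_vec z)"
    by (simp add: bilin_def matrix_vector_mult_def cnj_vec_def sum_distrib_left mult_ac)
  finally show ?thesis
    by (simp add: Reals_cnj_iff)
qed

lemma adj_mat_mult: "adj_mat (M ** N) = adj_mat N ** adj_mat M"
  by (simp add: adj_mat_def cnj_mat_def transpose_def matrix_matrix_mult_def vec_eq_iff mult_ac)

lemma adj_mat_adj_mat: "adj_mat (adj_mat M) = M"
  by (simp add: adj_mat_def cnj_mat_def transpose_def vec_eq_iff)

lemma pos_def_invertible: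
  assumes "pos_def_mat M"
  shows "invertible M"
proof -
  have "z = 0" if "M *v z = 0" for z
    using assms that by (force simp: pos_def_mat_def bilin_def)
  then show ?thesis
    by (simp add: invertible_left_inverse matrix_left_invertible_ker)
qed

lemma adj_mat_matrix_inv:
  assumes "invertible M" "adj_mat M = M"
  shows "adj_mat (matrix_inv M) = matrix_inv M"
proof -
  have inv: "M ** matrix_inv M = mat 1" "matrix_inv M ** M = mat 1"
    using someI_ex[OF assms(1)[unfolded invertible_def]] by (auto simp: matrix_inv_def)
  have one: "adj_mat (mat 1 :: complex^'a^'a) = mat 1"
    by (simp add: adj_mat_def cnj_mat_def transpose_def mat_def vec_eq_iff)
  have "adj_mat (matrix_inv M) ** M = mat 1"
    using arg_cong[OF inv(1), of adj_mat] by (simp add: adj_mat_mult assms(2) one)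
  then have "adj_mat (matrix_inv M) ** M ** matrix_inv M = matrix_inv M"
    by simp
  then show ?thesis
    by (simp add: matrix_mul_assoc[symmetric] inv(1))
qed

lemma Phi_zzbar_hermitian:
  assumes "pos_def_mat (imag_mat C)"
  shows "adj_mat (Phi_zzbar B C) = Phi_zzbar B C"
proof -
  let ?N = "B ** matrix_inv (imag_mat C) ** adj_mat B"
  have "adj_mat ?N = ?N"
    using adj_mat_matrix_inv[OF pos_def_invertible[OF assms]] assms
    by (simp add: adj_mat_mult adj_mat_adj_mat pos_def_mat_def matrix_mul_assoc)
  moreover have "adj_mat ((1/4) *\<^sub>R ?N) = (1/4) *\<^sub>R adj_mat ?N"
    by (simp add: adj_mat_def cnj_mat_def transpose_def vec_eq_iff)
  ultimately show ?thesis
    by (simp add: Phi_zzbar_def)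
qed

lemma Phi_first_summand_real:
  "pos_def_mat (imag_mat C) \<Longrightarrow> bilin z (Phi_zzbar B C *v cnj_vec z) \<in> \<real>"
  by (rule bilin_hermitian_real[OF Phi_zzbar_hermitian])

definition entire :: "(complex^'n::finite \<Rightarrow> complex) \<Rightarrow> bool" where
  "entire F \<longleftrightarrow> (\<forall>z. \<exists>D. (F has_derivative D) (at z) \<and> (\<forall>c v. D (c *s v) = c * D v))"

definition pderiv_at :: "'n::finite \<Rightarrow> (complex^'n \<Rightarrow> complex) \<Rightarrow> complex^'n \<Rightarrow> complex" where
  "pderiv_at k F z = deriv (\<lambda>w. F (z + axis k w)) 0"

definition HPhi :: "(complex^'n::finite \<Rightarrow> real) \<Rightarrow> (complex^'n \<Rightarrow> complex) set" where
  "HPhi \<phi> = {F. entire F \<and> integrable lborel (\<lambda>z. (cmod (F z))\<^sup>2 * exp (- 2 * \<phi> z))}"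

definition hprod ::
    "(complex^'n::finite \<Rightarrow> real) \<Rightarrow> (complex^'n \<Rightarrow> complex) \<Rightarrow> (complex^'n \<Rightarrow> complex) \<Rightarrow> complex" where
  "hprod \<phi> F G =
     integral\<^sup>L lborel (\<lambda>z. F z * cnj (G z) * complex_of_real (exp (- 2 * \<phi> z)))"

definition hnorm :: "(complex^'n::finite \<Rightarrow> real) \<Rightarrow> (complex^'n \<Rightarrow> complex) \<Rightarrow> real" where
  "hnorm \<phi> F = sqrt (Re (hprod \<phi> F F))"

text \<open>Completeness is density of the linear span in the norm of \<open>HPhi \<phi>\<close>.\<close>

definition complete_orthonormal_system ::
    "(complex^'n::finite \<Rightarrow> real) \<Rightarrow> ('i \<Rightarrow> complex^'n \<Rightarrow> complex) \<Rightarrow> bool" where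
  "complete_orthonormal_system \<phi> e \<longleftrightarrow>
     (\<forall>a. e a \<in> HPhi \<phi>) \<and>
     (\<forall>a b. hprod \<phi> (e a) (e b) = (if a = b then 1 else 0)) \<and>
     (\<forall>F\<in>HPhi \<phi>. \<forall>\<epsilon>>0. \<exists>S c. finite S \<and> hnorm \<phi> (\<lambda>z. F z - (\<Sum>a\<in>S. c a * e a z)) < \<epsilon>)"

definition first_order_op ::
    "complex^'n::finite \<Rightarrow> complex^'n \<Rightarrow> complex \<Rightarrow>
     (complex^'n \<Rightarrow> complex) \<Rightarrow> complex^'n \<Rightarrow> complex" where
  "first_order_op a b c F z =
     (\<Sum>k\<in>UNIV. a $ k * pderiv_at k F z) + (\<Sum>k\<in>UNIV. b $ k * z $ k * F z) + c * F z"

definition adj_dom :: "(complex^'n::finite \<Rightarrow> real) \<Rightarrow> (complex^'n \<Rightarrow> complex) set" where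
  "adj_dom \<phi> = {F \<in> HPhi \<phi>. \<forall>k. (\<lambda>z. z $ k * F z) \<in> HPhi \<phi> \<and> pderiv_at k F \<in> HPhi \<phi>}"

definition adjoint_op ::
    "(complex^'n::finite \<Rightarrow> real) \<Rightarrow>
     ((complex^'n \<Rightarrow> complex) \<Rightarrow> complex^'n \<Rightarrow> complex) \<Rightarrow>
     (complex^'n \<Rightarrow> complex) \<Rightarrow> complex^'n \<Rightarrow> complex" where
  "adjoint_op \<phi> T =
     (THE S. (\<exists>a b c. S = first_order_op a b c) \<and>
        (\<forall>F\<in>adj_dom \<phi>. \<forall>G\<in>adj_dom \<phi>. hprod \<phi> (T F) G = hprod \<phi> F (S G)))"

definition mu :: "('n::finite \<Rightarrow> real) \<Rightarrow> real \<Rightarrow> 'n \<Rightarrow> real" where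
  "mu lam rho i = sqrt ((lam i)\<^sup>2 - rho\<^sup>2)"

definition Qmat ::
    "complex^'n::finite^'n \<Rightarrow> complex^'n^'n \<Rightarrow> complex^'n^'n \<Rightarrow> complex^'n^'n \<Rightarrow> complex^'n^'n \<Rightarrow>
     ('n \<Rightarrow> real) \<Rightarrow> real \<Rightarrow> complex^'n^'n" where
  "Qmat A B C U X lam rho =
     - Phi_zz A B C + U ** diag_mat (mu lam rho) ** X ** diag_mat lam ** transpose U"

definition psi0 :: "complex^'n::finite^'n \<Rightarrow> complex^'n \<Rightarrow> complex" where
  "psi0 Q z = exp (- bilin z (Q *v z))"

definition Lam ::
    "complex^'n::finite^'n \<Rightarrow> 'n \<Rightarrow> (complex^'n \<Rightarrow> complex) \<Rightarrow> complex^'n \<Rightarrow> complex" where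
  "Lam Q i F z = pderiv_at i F z + 2 * (\<Sum>j\<in>UNIV. Q $ i $ j * z $ j) * F z"

text \<open>The linear order on the index type plays the role of the order of \<open>1, \<dots>, n\<close>: the fold applies
  the power belonging to the largest index first, so that the power belonging to the smallest index
  stands leftmost in the operator product.\<close>

definition psi_tilde ::
    "(complex^'n::{finite,linorder} \<Rightarrow> real) \<Rightarrow>
     complex^'n::{finite,linorder}^'n::{finite,linorder} \<Rightarrow>
     ('n \<Rightarrow> nat) \<Rightarrow> complex^'n::{finite,linorder} \<Rightarrow> complex" where
  "psi_tilde \<phi> Q \<alpha> =
     foldr (\<lambda>i F. (adjoint_op \<phi> (Lam Q i) ^^ \<alpha> i) F) (sorted_list_of_set UNIV) (psi0 Q)"

definition psi ::
    "(complex^'n::{finite,linorder} \<Rightarrow> real) \<Rightarrow>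
     complex^'n::{finite,linorder}^'n::{finite,linorder} \<Rightarrow> real \<Rightarrow>
     ('n \<Rightarrow> nat) \<Rightarrow> complex^'n::{finite,linorder} \<Rightarrow> complex" where
  "psi \<phi> Q rho \<alpha> z =
     psi_tilde \<phi> Q \<alpha> z /
     complex_of_real
       (sqrt ((2 * rho\<^sup>2) ^ (\<Sum>i\<in>UNIV. \<alpha> i) * (\<Prod>i\<in>UNIV. fact (\<alpha> i))) * hnorm \<phi> (psi0 Q))"

end

theory Submission
  imports Defs "HOL-Probability.Distributions" "HOL-Complex_Analysis.Cauchy_Integral_Formula"
begin

text \<open>
  Write \<open>P = Phi_zzbar B C\<close>, \<open>S = Phi_zz A B C\<close> and \<open>W = Q + S\<close>. Integration by parts shows that
  multiplication by \<open>2 * cnj P z\<close> is the adjoint of \<open>\<partial> - 2 S z\<close>, so the adjoint of \<open>\<Lambda>\<close> is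
  \<open>2 * cnj P z + M (\<partial> - 2 S z)\<close> with \<open>M = cnj W * inverse P\<close>. The matrix identity \<open>M W = cnj P - \<rho>\<^sup>2\<close> turns
  this, on functions \<open>p * \<psi>\<^sub>0\<close> with a polynomial \<open>p\<close>, into \<open>p \<mapsto> 2 \<rho>\<^sup>2 z p + M \<partial> p\<close>, while \<open>\<Lambda>\<close> acts as \<open>\<partial>\<close>.
  Orthogonality follows as for Hermite polynomials, and the \<open>\<psi>\<^sub>\<alpha>\<close> span all \<open>p * \<psi>\<^sub>0\<close>.

  For completeness, the function \<open>exp (<z, S z> + 2 <z, P cnj w>)\<close> represents evaluation at \<open>w\<close> up to a
  factor, by the mean value property for the rotation invariant weight \<open>exp (- 2 <z, P cnj z>)\<close>.
  It equals \<open>\<psi>\<^sub>0\<close> times the exponential of \<open>q(z) = <z, W z> + 2 <z, P cnj w>\<close>, and since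
  \<open>|<z, W z>| \<le> \<kappa> <z, P cnj z>\<close> with \<open>\<kappa> < 1\<close>, it can be reached from polynomial multiples of \<open>\<psi>\<^sub>0\<close> through
  \<open>exp (t q) * \<psi>\<^sub>0\<close>, \<open>0 \<le> t \<le> 1\<close>, in finitely many steps, each given by a norm convergent power series.
\<close>

section \<open>Integration on Euclidean spaces\<close>

text \<open>The condition on X acts twice: it makes W symmetric and, with unitarity, gives cnj X D X
  = D for D = diag (mu / lam); this is what collapses M W to cnj P minus a scalar. The scalar is
  rho^2 because mu_i^2 = lam_i^2 - rho^2, and the same relation gives kappa = max mu_i / lam_i < 1.
  As rho tends to 0, kappa tends to 1, so W is never small against P in a uniform sense; this is
  what forces the passage from t = 0 to t = 1 to be cut into steps. The adjoint in the definition of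
  the Hermite functions is a definite description. Its uniqueness among first-order operators has to
  be settled before anything can be computed, and polynomial multiples of the Gaussian serve as the
  test functions for it. A Bochner integral of a non-integrable function is 0, so a small norm says
  something only for members of \<open>HPhi\<close>; membership is therefore carried along in every
  statement.\<close>

lemma integrable_gaussian:
  assumes "0 < e"
  shows "integrable lborel (\<lambda>x::'a::euclidean_space. exp (- e * (norm x)\<^sup>2))"
proof (rule integrableI_bounded)
  have e1: "integrable lborel (\<lambda>x::real. exp (- e * x\<^sup>2))"
  proof -
    \<comment> \<open>With this deviation 1 / (2 s^2) = e, so the normal density is a constant
      multiple of the integrand.\<close>
    define s where "s = 1 / sqrt (2 * e)"
    have s: "0 < s" "s\<^sup>2 = 1 / (2 * e)"
      using assms by (auto simp: s_def power_divide)
    have "integrable lborel (\<lambda>x. sqrt (2 * pi * s\<^sup>2) * normal_density 0 s x)"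
      using s by (intro integrable_mult_right integrable_normal_density) auto
    also have "(\<lambda>x. sqrt (2 * pi * s\<^sup>2) * normal_density 0 s x) = (\<lambda>x. exp (- e * x\<^sup>2))"
      using assms s by (auto simp: normal_density_def fun_eq_iff field_simps)
    finally show ?thesis .
  qed
  have "exp (- e * (norm x)\<^sup>2) = (\<Prod>b\<in>Basis. exp (- e * (x \<bullet> b)\<^sup>2))" for x :: 'a
    unfolding power2_norm_eq_inner euclidean_inner[of x x]
    by (simp add: exp_sum sum_distrib_left power2_eq_square flip: sum_negf)
  then have "(\<integral>\<^sup>+x. ennreal (norm (exp (- e * (norm (x::'a))\<^sup>2))) \<partial>lborel)
      = (\<integral>\<^sup>+x. (\<Prod>b\<in>(Basis::'a set). ennreal (exp (- e * (x \<bullet> b)\<^sup>2))) \<partial>lborel)"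
    by (intro nn_integral_cong) (simp add: prod_ennreal prod_nonneg)
  also have "\<dots> = (\<Prod>b\<in>(Basis::'a set). \<integral>\<^sup>+x. ennreal (exp (- e * x\<^sup>2)) \<partial>lborel)"
    by (rule nn_integral_lborel_prod) auto
  also have "\<dots> < \<infinity>"
    using e1 unfolding integrable_iff_bounded
    by (auto simp: ennreal_prod_eq_top power_less_top_ennreal less_top)
  finally show "(\<integral>\<^sup>+x. ennreal (norm (exp (- e * (norm (x::'a))\<^sup>2))) \<partial>lborel) < \<infinity>" .
qed simp

text \<open>Completing the square: half of the Gaussian decay absorbs the linear growth, at the
  price of the constant \<open>exp (a^2 / (2 * e))\<close>. Polynomial factors and linear exponents
  later enter through the rate \<open>a\<close>.\<close>

lemma integrable_gaussian_bound:
  fixes f :: "'a::euclidean_space \<Rightarrow> 'b::{banach, second_countable_topology}"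
  assumes "0 < e" and [measurable]: "f \<in> borel_measurable borel"
    and b: "\<And>x. norm (f x) \<le> C * exp (a * norm x - e * (norm x)\<^sup>2)"
  shows "integrable lborel f"
proof (rule Bochner_Integration.integrable_bound)
  show "integrable lborel (\<lambda>x::'a. \<bar>C\<bar> * exp (a\<^sup>2 / (2 * e)) * exp (- (e/2) * (norm x)\<^sup>2))"
    using assms(1) by (intro integrable_mult_right integrable_gaussian) auto
  have "norm (f x) \<le> norm (\<bar>C\<bar> * exp (a\<^sup>2 / (2 * e)) * exp (- (e/2) * (norm x)\<^sup>2))" for x
  proof -
    have "0 \<le> (a - e * norm x)\<^sup>2 / (2 * e)"
      using assms(1) by simp
    also have "\<dots> = a\<^sup>2 / (2 * e) - a * norm x + e / 2 * (norm x)\<^sup>2"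
      using assms(1) by (simp add: power2_diff field_simps power2_eq_square)
    finally have "a * norm x - e * (norm x)\<^sup>2 \<le> a\<^sup>2 / (2 * e) + - (e/2) * (norm x)\<^sup>2"
      by (simp add: field_simps)
    then have "exp (a * norm x - e * (norm x)\<^sup>2) \<le> exp (a\<^sup>2 / (2 * e)) * exp (- (e/2) * (norm x)\<^sup>2)"
      by (simp flip: exp_add)
    then have "C * exp (a * norm x - e * (norm x)\<^sup>2) \<le> \<bar>C\<bar> * (exp (a\<^sup>2 / (2 * e)) * exp (- (e/2) * (norm x)\<^sup>2))"
      by (intro mult_mono) auto
    then show ?thesis
      using b[of x] by (simp add: abs_mult mult.assoc)
  qed
  then show "AE x in lborel. norm (f x) \<le> norm (\<bar>C\<bar> * exp (a\<^sup>2 / (2 * e)) * exp (- (e/2) * (norm x)\<^sup>2))"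
    by simp
qed simp

lemma lborel_distr_add:
  "distr lborel borel (\<lambda>x. x + v) = (lborel :: 'a::euclidean_space measure)"
proof -
  have "(+) v = (\<lambda>x. x + v)"
    by (auto simp: add.commute)
  then show ?thesis
    using lborel_distr_plus[of v] by simp
qed

lemma nn_integral_lborel_add:
  fixes f :: "'a::euclidean_space \<Rightarrow> ennreal"
  assumes "f \<in> borel_measurable borel"
  shows "(\<integral>\<^sup>+x. f (x + v) \<partial>lborel) = (\<integral>\<^sup>+x. f x \<partial>lborel)"
  by (subst (2) lborel_distr_add[of v, symmetric]) (simp add: nn_integral_distr assms)

text \<open>Both sides are compared after multiplication by the volume of the unit ball: the shift
  \<open>y \<mapsto> y + T x\<close> moves \<open>T\<close> from \<open>f\<close> to the indicator of the ball, which is \<open>T\<close>-invariant.\<close>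

lemma nn_integral_lborel_isometry:
  fixes T :: "'a::euclidean_space \<Rightarrow> 'a" and f :: "'a \<Rightarrow> ennreal"
  assumes lin: "linear T" and inv: "\<And>x. T (T' x) = x"
    and iso: "\<And>x. norm (T x) = norm x"
    and [measurable]: "f \<in> borel_measurable borel"
  shows "(\<integral>\<^sup>+x. f (T x) \<partial>lborel) = (\<integral>\<^sup>+x. f x \<partial>lborel)"
proof -
  have [measurable]: "T \<in> borel_measurable borel"
    using linear_continuous_on[OF linear_conv_bounded_linear[THEN iffD1, OF lin]]
    by (rule borel_measurable_continuous_onI)
  define g :: "'a \<Rightarrow> ennreal" where "g x = indicator (ball 0 1) x" for x
  have [measurable]: "g \<in> borel_measurable borel"
    unfolding g_def by (intro borel_measurable_indicator) simp
  have gT: "g (T x) = g x" for x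
    by (simp add: g_def iso indicator_def)
  have gm: "g (- x) = g x" for x
    by (simp add: g_def indicator_def)
  define c where "c = (\<integral>\<^sup>+x. g x \<partial>lborel)"
  have c: "c = emeasure lborel (ball 0 1 :: 'a set)"
    by (simp add: c_def g_def)
  have c0: "c \<noteq> 0"
    using content_ball_pos[of 1 "0::'a"] by (auto simp: c measure_def)
  have cinf: "c \<noteq> \<infinity>"
    using emeasure_lborel_ball_finite[of "0::'a" 1] by (simp add: c)
  have "(\<integral>\<^sup>+x. f (T x) \<partial>lborel) * c = (\<integral>\<^sup>+y. (\<integral>\<^sup>+x. f (T x) * g y \<partial>lborel) \<partial>lborel)"
    by (simp add: nn_integral_multc nn_integral_cmult c_def)
  also have "\<dots> = (\<integral>\<^sup>+y. (\<integral>\<^sup>+x. f (T x + y) * g y \<partial>lborel) \<partial>lborel)"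
  proof (rule nn_integral_cong)
    fix y :: 'a
    have "(\<integral>\<^sup>+x. f (T (x + T' y)) * g y \<partial>lborel) = (\<integral>\<^sup>+x. f (T x) * g y \<partial>lborel)"
      by (rule nn_integral_lborel_add) measurable
    then show "(\<integral>\<^sup>+x. f (T x) * g y \<partial>lborel) = (\<integral>\<^sup>+x. f (T x + y) * g y \<partial>lborel)"
      by (simp add: linear_add[OF lin] inv)
  qed
  also have "\<dots> = (\<integral>\<^sup>+x. (\<integral>\<^sup>+y. f (T x + y) * g y \<partial>lborel) \<partial>lborel)"
    by (rule lborel_pair.Fubini') measurable
  also have "\<dots> = (\<integral>\<^sup>+x. (\<integral>\<^sup>+y. f y * g (y - T x) \<partial>lborel) \<partial>lborel)"
  proof (rule nn_integral_cong)
    fix x :: 'a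
    have "(\<integral>\<^sup>+y. f (y + T x) * g ((y + T x) - T x) \<partial>lborel) = (\<integral>\<^sup>+y. f y * g (y - T x) \<partial>lborel)"
      by (rule nn_integral_lborel_add) measurable
    then show "(\<integral>\<^sup>+y. f (T x + y) * g y \<partial>lborel) = (\<integral>\<^sup>+y. f y * g (y - T x) \<partial>lborel)"
      by (simp add: add.commute)
  qed
  also have "\<dots> = (\<integral>\<^sup>+y. (\<integral>\<^sup>+x. f y * g (y - T x) \<partial>lborel) \<partial>lborel)"
    by (rule lborel_pair.Fubini') measurable
  also have "\<dots> = (\<integral>\<^sup>+y. f y * c \<partial>lborel)"
  proof (rule nn_integral_cong)
    fix y :: 'a
    have "(\<integral>\<^sup>+x. g (y - T x) \<partial>lborel) = (\<integral>\<^sup>+x. g (x + - T' y) \<partial>lborel)"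
    proof (rule nn_integral_cong)
      fix x
      have "y - T x = T (- (x + - T' y))"
        by (simp add: linear_neg[OF lin] linear_diff[OF lin] inv)
      then show "g (y - T x) = g (x + - T' y)"
        by (simp only: gT gm)
    qed
    also have "\<dots> = c"
      unfolding c_def by (rule nn_integral_lborel_add) measurable
    finally show "(\<integral>\<^sup>+x. f y * g (y - T x) \<partial>lborel) = f y * c"
      by (simp add: nn_integral_cmult)
  qed
  also have "\<dots> = (\<integral>\<^sup>+x. f x \<partial>lborel) * c"
    by (simp add: nn_integral_multc)
  finally show ?thesis
    using c0 cinf by (simp add: mult.commute[of _ c] ennreal_mult_cancel_left)
qed

lemma lborel_distr_isometry:
  fixes T :: "'a::euclidean_space \<Rightarrow> 'a"
  assumes lin: "linear T" and inv: "\<And>x. T (T' x) = x"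
    and iso: "\<And>x. norm (T x) = norm x"
  shows "distr lborel borel T = lborel"
proof (rule measure_eqI)
  have [measurable]: "T \<in> borel_measurable borel"
    using linear_continuous_on[OF linear_conv_bounded_linear[THEN iffD1, OF lin]]
    by (rule borel_measurable_continuous_onI)
  fix A assume "A \<in> sets (distr lborel borel T)"
  then have [measurable]: "A \<in> sets borel" by simp
  have "emeasure (distr lborel borel T) A = (\<integral>\<^sup>+x. indicator A (T x) \<partial>lborel)"
    using nn_integral_distr[of T lborel borel "indicator A"] by simp
  also have "\<dots> = emeasure lborel A"
    by (subst nn_integral_lborel_isometry[OF assms]) simp_all
  finally show "emeasure (distr lborel borel T) A = emeasure lborel A" .
qed simp

text \<open>After Fubini the inner integral does not depend on t, since each \<open>T t\<close>
  preserves Lebesgue measure. Applied to translations this yields integration by parts, applied to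
  rotations the mean value property.\<close>

lemma integral_average:
  fixes T :: "real \<Rightarrow> 'a::euclidean_space \<Rightarrow> 'a" and h :: "'a \<Rightarrow> 'b::{banach, second_countable_topology}"
  assumes cont: "continuous_on UNIV (\<lambda>(t, x). T t x)"
    and inv: "\<And>t. distr lborel borel (T t) = lborel"
    and h: "integrable lborel h"
  shows "(\<integral>x. (LINT t:{0..1}|lborel. h (T t x)) \<partial>lborel) = (\<integral>x. h x \<partial>lborel)"
proof -
  have T2: "(\<lambda>p. T (fst p) (snd p)) \<in> borel_measurable (borel \<Otimes>\<^sub>M borel)"
    using borel_measurable_continuous_onI[OF cont] by (simp add: borel_prod split_def)
  have T1 [measurable]: "T t \<in> borel_measurable borel" for t
  proof -
    have "continuous_on UNIV (\<lambda>x. (\<lambda>(t, x). T t x) (t, x))"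
      by (rule continuous_on_compose2[OF cont]) (auto intro!: continuous_intros)
    then show ?thesis by (intro borel_measurable_continuous_onI) simp
  qed
  have [measurable]: "h \<in> borel_measurable borel"
    using h by auto
  have mp: "(\<lambda>p. h (T (fst p) (snd p))) \<in> borel_measurable (lborel \<Otimes>\<^sub>M lborel)"
    using measurable_compose[OF T2, of h borel] by simp
  define f where "f p = indicator {0..1} (fst p) *\<^sub>R h (T (fst p) (snd p))" for p
  have f_meas: "f \<in> borel_measurable (lborel \<Otimes>\<^sub>M lborel)"
    unfolding f_def by (intro borel_measurable_scaleR mp) measurable
  have hT: "integrable lborel (\<lambda>x. h (T t x))" for t
    using h integrable_distr_eq[of "T t" lborel borel h] by (simp add: inv)
  have ihT: "(\<integral>x. h (T t x) \<partial>lborel) = (\<integral>x. h x \<partial>lborel)" for t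
    using integral_distr[of "T t" lborel borel h] by (simp add: inv)
  have inT: "(\<integral>x. norm (h (T t x)) \<partial>lborel) = (\<integral>x. norm (h x) \<partial>lborel)" for t
    using integral_distr[of "T t" lborel borel "\<lambda>x. norm (h x)"] by (simp add: inv)
  have ind: "integrable lborel (indicator {0..1::real} :: real \<Rightarrow> real)"
    by (auto simp: integrable_indicator_iff)
  have intf: "integrable (lborel \<Otimes>\<^sub>M lborel) f"
  proof (rule lborel_pair.Fubini_integrable[OF f_meas])
    have "(\<integral>x. norm (f (t, x)) \<partial>lborel) = indicator {0..1} t * (\<integral>x. norm (h x) \<partial>lborel)" for t
      by (simp add: f_def inT)
    then show "integrable lborel (\<lambda>t. \<integral>x. norm (f (t, x)) \<partial>lborel)"
      using ind by simp
    show "AE t in lborel. integrable lborel (\<lambda>x. f (t, x))"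
      by (simp add: f_def hT)
  qed
  have "(\<integral>x. (LINT t:{0..1}|lborel. h (T t x)) \<partial>lborel) = (\<integral>x. (\<integral>t. f (t, x) \<partial>lborel) \<partial>lborel)"
    by (simp add: f_def set_lebesgue_integral_def)
  also have "\<dots> = (\<integral>t. (\<integral>x. f (t, x) \<partial>lborel) \<partial>lborel)"
    using lborel_pair.Fubini_integral[of "\<lambda>t x. f (t, x)"] intf by simp
  also have "\<dots> = (\<integral>t. indicator {0..1::real} t *\<^sub>R (\<integral>x. h x \<partial>lborel) \<partial>lborel)"
    by (simp add: f_def ihT)
  also have "\<dots> = (\<integral>x. h x \<partial>lborel)"
    using ind by (simp add: integral_scaleR_left)
  finally show ?thesis .
qed

text \<open>Averaging \<open>h'\<close> over the segment from x to x + v gives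
  \<open>h (x + v) - h x\<close> by the fundamental theorem of calculus, and translation invariance
  makes both terms integrate to the same value. Integrability of \<open>h\<close> and
  \<open>h'\<close> takes the place of a boundary term.\<close>

lemma integral_directional_derivative_eq_0:
  fixes h h' :: "'a::euclidean_space \<Rightarrow> 'b::euclidean_space"
  assumes cont: "continuous_on UNIV h'"
    and deriv: "\<And>x s. ((\<lambda>s. h (x + s *\<^sub>R v)) has_vector_derivative h' (x + s *\<^sub>R v)) (at s)"
    and h: "integrable lborel h" and h': "integrable lborel h'"
  shows "(\<integral>x. h' x \<partial>lborel) = 0"
proof -
  have inv: "distr lborel borel (\<lambda>x. x + t *\<^sub>R v) = lborel" for t
    by (rule lborel_distr_add)
  have [measurable]: "h \<in> borel_measurable borel"
    using h by auto
  have "(\<integral>x. h' x \<partial>lborel) = (\<integral>x. (LINT t:{0..1}|lborel. h' (x + t *\<^sub>R v)) \<partial>lborel)"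
    by (rule integral_average[OF _ inv h', symmetric]) (auto simp: split_def intro!: continuous_intros)
  also have "\<dots> = (\<integral>x. h (x + v) - h x \<partial>lborel)"
  proof (rule Bochner_Integration.integral_cong)
    fix x
    have "continuous_on {0..1} (\<lambda>t. h' (x + t *\<^sub>R v))"
      by (rule continuous_on_compose2[OF cont]) (auto intro!: continuous_intros)
    then show "(LINT t:{0..1}|lborel. h' (x + t *\<^sub>R v)) = h (x + v) - h x"
      using integral_FTC_Icc[of 0 1 "\<lambda>s. h (x + s *\<^sub>R v)" "\<lambda>s. h' (x + s *\<^sub>R v)"]
        has_vector_derivative_at_within[OF deriv]
      by (simp add: set_lebesgue_integral_def)
  qed simp
  also have "\<dots> = (\<integral>x. h (x + v) \<partial>lborel) - (\<integral>x. h x \<partial>lborel)"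
    using integrable_distr_eq[of "\<lambda>x. x + v" lborel borel h] h
    by (intro Bochner_Integration.integral_diff) (simp_all add: lborel_distr_add)
  also have "\<dots> = 0"
    using integral_distr[of "\<lambda>x. x + v" lborel borel h] by (simp add: lborel_distr_add)
  finally show ?thesis .
qed

section \<open>Entire functions and polynomials\<close>

lemma entireE:
  assumes "entire F"
  obtains D where "\<And>z. (F has_derivative D z) (at z)" "\<And>z c v. D z (c *s v) = c * D z v"
  using assms unfolding entire_def by metis

lemma entireI:
  assumes "\<And>z. (F has_derivative D z) (at z)" "\<And>z c v. D z (c *s v) = c * D z v"
  shows "entire F"
  using assms unfolding entire_def by metis

lemma entire_continuous:
  assumes "entire F"
  shows "continuous_on S F"
proof -
  obtain D where "\<And>z. (F has_derivative D z) (at z)"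
    using assms by (metis entireE)
  then show ?thesis
    by (auto intro!: continuous_at_imp_continuous_on has_derivative_continuous)
qed

lemma entire_measurable [measurable_dest]: "entire F \<Longrightarrow> F \<in> borel_measurable borel"
  by (intro borel_measurable_continuous_onI entire_continuous)

lemma entire_const: "entire (\<lambda>z. c)"
  by (rule entireI[where D = "\<lambda>z v. 0"]) auto

lemma entire_coord: "entire (\<lambda>z. z $ i)"
  by (rule entireI[where D = "\<lambda>z v. v $ i"])
     (auto intro: bounded_linear_imp_has_derivative[OF bounded_linear_vec_nth])

lemma entire_add:
  assumes "entire F" "entire G"
  shows "entire (\<lambda>z. F z + G z)"
proof -
  obtain D E where D: "\<And>z. (F has_derivative D z) (at z)" "\<And>z c v. D z (c *s v) = c * D z v"
    and E: "\<And>z. (G has_derivative E z) (at z)" "\<And>z c v. E z (c *s v) = c * E z v"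
    using assms by (metis entireE)
  show ?thesis
    by (rule entireI[where D = "\<lambda>z v. D z v + E z v"])
       (auto intro!: has_derivative_add D E simp: D(2) E(2) algebra_simps)
qed

lemma entire_mult:
  assumes "entire F" "entire G"
  shows "entire (\<lambda>z. F z * G z)"
proof -
  obtain D E where D: "\<And>z. (F has_derivative D z) (at z)" "\<And>z c v. D z (c *s v) = c * D z v"
    and E: "\<And>z. (G has_derivative E z) (at z)" "\<And>z c v. E z (c *s v) = c * E z v"
    using assms by (metis entireE)
  show ?thesis
    by (rule entireI[where D = "\<lambda>z v. F z * E z v + D z v * G z"])
       (rule has_derivative_mult, rule D, rule E, simp add: D(2) E(2) algebra_simps)
qed

lemma entire_cmult: "entire F \<Longrightarrow> entire (\<lambda>z. c * F z)"
  by (intro entire_mult entire_const)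

lemma entire_diff:
  assumes "entire F" "entire G"
  shows "entire (\<lambda>z. F z - G z)"
  using entire_add[OF assms(1) entire_cmult[OF assms(2), of "-1"]] by simp

lemma entire_sum: "(\<And>a. a \<in> S \<Longrightarrow> entire (F a)) \<Longrightarrow> entire (\<lambda>z. \<Sum>a\<in>S. F a z)"
  by (induction S rule: infinite_finite_induct) (auto intro: entire_const entire_add)

lemma entire_exp:
  assumes "entire F"
  shows "entire (\<lambda>z. exp (F z))"
proof -
  obtain D where D: "\<And>z. (F has_derivative D z) (at z)" "\<And>z c v. D z (c *s v) = c * D z v"
    using assms by (metis entireE)
  have "((\<lambda>z. exp (F z)) has_derivative (\<lambda>v. exp (F z) * D z v)) (at z)" for z
    using has_derivative_compose[OF D(1)[of z] DERIV_exp[of "F z", unfolded has_field_derivative_def]]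
    by simp
  then show ?thesis
    by (rule entireI) (simp add: D(2))
qed

lemma entire_shift:
  assumes "entire F"
  shows "entire (\<lambda>z. F (w + z))"
proof -
  obtain D where D: "\<And>z. (F has_derivative D z) (at z)" "\<And>z c v. D z (c *s v) = c * D z v"
    using assms by (metis entireE)
  have "((\<lambda>z. F (w + z)) has_derivative D (w + z)) (at z)" for z
  proof -
    have "((\<lambda>z. w + z) has_derivative (\<lambda>v. v)) (at z)"
      by (auto intro!: derivative_eq_intros)
    from has_derivative_compose[OF this D(1)] show ?thesis .
  qed
  then show ?thesis
    by (rule entireI) (simp add: D(2))
qed

lemma entire_line_has_field_derivative:
  fixes F :: "complex^'n::finite \<Rightarrow> complex"
  assumes "(F has_derivative D) (at (z + w *s v))" "\<And>c v. D (c *s v) = c * D v"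
  shows "((\<lambda>w. F (z + w *s v)) has_field_derivative D v) (at w)"
proof -
  have "linear (\<lambda>w. w *s v)"
    by (rule linearI) (auto simp: vec_eq_iff algebra_simps)
  then have "((\<lambda>w. w *s v) has_derivative (\<lambda>w. w *s v)) (at w)"
    by (intro linear_imp_has_derivative)
  then have "((\<lambda>w. z + w *s v) has_derivative (\<lambda>w. w *s v)) (at w)"
    by (auto intro!: derivative_eq_intros)
  from has_derivative_compose[OF this assms(1)]
  have "((\<lambda>w. F (z + w *s v)) has_derivative (\<lambda>w. D (w *s v))) (at w)" .
  moreover have "(\<lambda>w. D (w *s v)) = (*) (D v)"
    by (simp add: fun_eq_iff assms(2) mult.commute)
  ultimately show ?thesis
    by (simp add: has_field_derivative_def)
qed

text \<open>Restriction to complex lines is the bridge from several variables to one-variable Cauchy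
  theory.\<close>

lemma entire_line_holomorphic:
  assumes "entire F"
  shows "(\<lambda>w. F (z + w *s v)) holomorphic_on S"
proof -
  obtain D where D: "\<And>z. (F has_derivative D z) (at z)" "\<And>z c v. D z (c *s v) = c * D z v"
    using assms by (metis entireE)
  have "(\<lambda>w. F (z + w *s v)) field_differentiable (at w)" for w
    using entire_line_has_field_derivative[OF D] unfolding field_differentiable_def by blast
  then show ?thesis
    by (auto simp: holomorphic_on_def intro: field_differentiable_at_within)
qed

section \<open>Rules for partial derivatives\<close>

lemma axis_eq_scale: "axis k w = w *s axis k (1::complex)"
  by (simp add: vec_eq_iff axis_def)

lemma pderiv_at_eqI:
  assumes "(F has_derivative D) (at z)" "\<And>c v. D (c *s v) = c * D v"
  shows "pderiv_at k F z = D (axis k 1)"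
proof -
  have "((\<lambda>w. F (z + w *s axis k 1)) has_field_derivative D (axis k 1)) (at 0)"
    by (rule entire_line_has_field_derivative) (use assms in auto)
  then show ?thesis
    unfolding pderiv_at_def by (subst axis_eq_scale) (rule DERIV_imp_deriv)
qed

text \<open>The direction carries a free complex factor c: the choices 1 and \<i> later separate the
  derivative in z from the derivative in the conjugate of z.\<close>

lemma pderiv_at_directional:
  assumes "entire F"
  shows "((\<lambda>s. F (x + s *\<^sub>R (c *s axis k 1))) has_vector_derivative
           c * pderiv_at k F (x + s *\<^sub>R (c *s axis k 1))) (at s)"
proof -
  obtain D where D: "\<And>z. (F has_derivative D z) (at z)" "\<And>z c v. D z (c *s v) = c * D z v"
    using assms by (metis entireE)
  let ?v = "c *s axis k 1 :: complex^'a"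
  have "((\<lambda>s. x + s *\<^sub>R ?v) has_vector_derivative ?v) (at s)"
    by (auto intro!: derivative_eq_intros)
  then have "(F \<circ> (\<lambda>s. x + s *\<^sub>R ?v) has_vector_derivative D (x + s *\<^sub>R ?v) ?v) (at s)"
    by (rule vector_derivative_diff_chain_within) (rule has_derivative_at_withinI, rule D)
  then show ?thesis
    by (simp add: o_def D(2) pderiv_at_eqI[OF D])
qed

lemma pderiv_at_const: "pderiv_at k (\<lambda>z. c) z = 0"
  by (simp add: pderiv_at_def)

lemma pderiv_at_coord: "pderiv_at k (\<lambda>z. z $ i) z = (if i = k then 1 else 0)"
  by (subst pderiv_at_eqI[where D = "\<lambda>v. v $ i"])
     (auto intro: bounded_linear_imp_has_derivative[OF bounded_linear_vec_nth]
       simp: axis_def)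

lemma pderiv_at_add:
  assumes "entire F" "entire G"
  shows "pderiv_at k (\<lambda>z. F z + G z) z = pderiv_at k F z + pderiv_at k G z"
proof -
  obtain D E where D: "\<And>z. (F has_derivative D z) (at z)" "\<And>z c v. D z (c *s v) = c * D z v"
    and E: "\<And>z. (G has_derivative E z) (at z)" "\<And>z c v. E z (c *s v) = c * E z v"
    using assms by (metis entireE)
  show ?thesis
    by (subst pderiv_at_eqI[where D = "\<lambda>v. D z v + E z v"])
       (rule has_derivative_add, rule D, rule E, simp_all add: D(2) E(2) algebra_simps pderiv_at_eqI[OF D]
         pderiv_at_eqI[OF E])
qed

lemma pderiv_at_mult:
  assumes "entire F" "entire G"
  shows "pderiv_at k (\<lambda>z. F z * G z) z = F z * pderiv_at k G z + pderiv_at k F z * G z"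
proof -
  obtain D E where D: "\<And>z. (F has_derivative D z) (at z)" "\<And>z c v. D z (c *s v) = c * D z v"
    and E: "\<And>z. (G has_derivative E z) (at z)" "\<And>z c v. E z (c *s v) = c * E z v"
    using assms by (metis entireE)
  show ?thesis
    by (subst pderiv_at_eqI[where D = "\<lambda>v. F z * E z v + D z v * G z"])
       (rule has_derivative_mult, rule D, rule E, simp_all add: D(2) E(2) algebra_simps pderiv_at_eqI[OF D]
         pderiv_at_eqI[OF E])
qed

lemma pderiv_at_cmult: "entire F \<Longrightarrow> pderiv_at k (\<lambda>z. c * F z) z = c * pderiv_at k F z"
  by (simp add: pderiv_at_mult entire_const pderiv_at_const)

lemma pderiv_at_sum:
  "(\<And>a. a \<in> S \<Longrightarrow> entire (F a)) \<Longrightarrow>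
    pderiv_at k (\<lambda>z. \<Sum>a\<in>S. F a z) z = (\<Sum>a\<in>S. pderiv_at k (F a) z)"
  by (induction S rule: infinite_finite_induct)
     (auto simp: pderiv_at_const pderiv_at_add entire_sum)

lemma pderiv_at_exp:
  assumes "entire F"
  shows "pderiv_at k (\<lambda>z. exp (F z)) z = pderiv_at k F z * exp (F z)"
proof -
  obtain D where D: "\<And>z. (F has_derivative D z) (at z)" "\<And>z c v. D z (c *s v) = c * D z v"
    using assms by (metis entireE)
  have "((\<lambda>z. exp (F z)) has_derivative (\<lambda>v. exp (F z) * D z v)) (at z)"
    using has_derivative_compose[OF D(1)[of z] DERIV_exp[of "F z", unfolded has_field_derivative_def]]
    by simp
  then show ?thesis
    by (subst pderiv_at_eqI[where D = "\<lambda>v. exp (F z) * D z v"])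
       (auto simp: D(2) pderiv_at_eqI[OF D])
qed

text \<open>Polynomials are taken as functions closed under the ring operations, so that closure and
  growth statements become plain inductions.\<close>

inductive cpoly :: "(complex^'n::finite \<Rightarrow> complex) \<Rightarrow> bool" where
  const: "cpoly (\<lambda>z. c)"
| coord: "cpoly (\<lambda>z. z $ i)"
| add: "cpoly p \<Longrightarrow> cpoly q \<Longrightarrow> cpoly (\<lambda>z. p z + q z)"
| mult: "cpoly p \<Longrightarrow> cpoly q \<Longrightarrow> cpoly (\<lambda>z. p z * q z)"

lemma cpoly_cmult: "cpoly p \<Longrightarrow> cpoly (\<lambda>z. c * p z)"
  by (intro cpoly.intros)

lemma cpoly_divide: "cpoly p \<Longrightarrow> cpoly (\<lambda>z. p z / c)"
  using cpoly_cmult[of p "inverse c"] by (simp add: field_simps)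

lemma cpoly_diff: "cpoly p \<Longrightarrow> cpoly q \<Longrightarrow> cpoly (\<lambda>z. p z - q z)"
  using cpoly.add[OF _ cpoly_cmult[of q "-1"]] by simp

lemma cpoly_sum: "(\<And>a. a \<in> S \<Longrightarrow> cpoly (p a)) \<Longrightarrow> cpoly (\<lambda>z. \<Sum>a\<in>S. p a z)"
  by (induction S rule: infinite_finite_induct) (auto intro: cpoly.intros)

lemma cpoly_power: "cpoly p \<Longrightarrow> cpoly (\<lambda>z. p z ^ n)"
  by (induction n) (auto intro: cpoly.intros)

lemmas cpoly_intros = cpoly.intros cpoly_cmult cpoly_divide cpoly_diff cpoly_sum cpoly_power

lemma cpoly_entire: "cpoly p \<Longrightarrow> entire p"
  by (induction rule: cpoly.induct) (auto intro: entire_const entire_coord entire_add entire_mult)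

lemma cpoly_pderiv: "cpoly p \<Longrightarrow> cpoly (pderiv_at k p)"
proof (induction rule: cpoly.induct)
  case (const c)
  have "pderiv_at k (\<lambda>z. c) = (\<lambda>z. 0)"
    by (simp add: fun_eq_iff pderiv_at_const)
  then show ?case by (simp only: cpoly.const)
next
  case (coord i)
  have "pderiv_at k (\<lambda>z. z $ i) = (\<lambda>z. if i = k then 1 else 0)"
    by (simp add: fun_eq_iff pderiv_at_coord)
  then show ?case by (simp only: cpoly.const)
next
  case (add p q)
  have "pderiv_at k (\<lambda>z. p z + q z) = (\<lambda>z. pderiv_at k p z + pderiv_at k q z)"
    by (simp add: fun_eq_iff pderiv_at_add cpoly_entire add)
  then show ?case using add by (simp only: cpoly.add)
next
  case (mult p q)
  have "pderiv_at k (\<lambda>z. p z * q z) = (\<lambda>z. p z * pderiv_at k q z + pderiv_at k p z * q z)"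
    by (simp add: fun_eq_iff pderiv_at_mult cpoly_entire mult)
  then show ?case using mult by (simp only: cpoly.add cpoly.mult)
qed

text \<open>Serves the commutation of the raising operators, which act on polynomials.\<close>

lemma cpoly_pderiv_commute:
  "cpoly p \<Longrightarrow> pderiv_at j (pderiv_at k p) z = pderiv_at k (pderiv_at j p) z"
proof (induction arbitrary: z rule: cpoly.induct)
  case (const c)
  have "pderiv_at k (\<lambda>z. c) = (\<lambda>z. 0)" for k
    by (simp add: fun_eq_iff pderiv_at_const)
  then show ?case by (simp add: pderiv_at_const)
next
  case (coord i)
  have "pderiv_at k (\<lambda>z. z $ i) = (\<lambda>z. if i = k then 1 else 0)" for k
    by (simp add: fun_eq_iff pderiv_at_coord)
  then show ?case by (simp add: pderiv_at_const)
next
  case (add p q)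
  have "pderiv_at k (\<lambda>z. p z + q z) = (\<lambda>z. pderiv_at k p z + pderiv_at k q z)" for k
    by (simp add: fun_eq_iff pderiv_at_add cpoly_entire add)
  then show ?case using add by (simp add: pderiv_at_add cpoly_entire cpoly_pderiv)
next
  case (mult p q)
  have "pderiv_at k (\<lambda>z. p z * q z) = (\<lambda>z. p z * pderiv_at k q z + pderiv_at k p z * q z)" for k
    by (simp add: fun_eq_iff pderiv_at_mult cpoly_entire mult)
  then show ?case using mult
    by (simp add: pderiv_at_add pderiv_at_mult cpoly_entire cpoly_pderiv entire_mult)
qed

text \<open>A bound of exponential type passes through sums and products without tracking degrees,
  and a Gaussian absorbs it just as well as a polynomial bound.\<close>

lemma cpoly_bound:
  "cpoly p \<Longrightarrow> \<exists>C a. 0 \<le> C \<and> 0 \<le> a \<and> (\<forall>z. cmod (p z) \<le> C * exp (a * norm z))"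
proof (induction rule: cpoly.induct)
  case (const c)
  show ?case by (intro exI[of _ "cmod c"] exI[of _ 0]) auto
next
  case (coord i)
  have "cmod (z $ i) \<le> exp (norm z)" for z :: "complex^'a"
    using Finite_Cartesian_Product.norm_nth_le[of z i] exp_ge_add_one_self[of "norm z"] by linarith
  then show ?case by (intro exI[of _ 1]) auto
next
  case (add p q)
  then obtain C a C' a' where b: "0 \<le> C" "0 \<le> a" "0 \<le> C'" "0 \<le> a'"
    "\<And>z. cmod (p z) \<le> C * exp (a * norm z)" "\<And>z. cmod (q z) \<le> C' * exp (a' * norm z)"
    by metis
  have "cmod (p z + q z) \<le> (C + C') * exp ((a + a') * norm z)" for z
  proof -
    have "C * exp (a * norm z) \<le> C * exp ((a + a') * norm z)"
      "C' * exp (a' * norm z) \<le> C' * exp ((a + a') * norm z)"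
      using b by (auto intro!: mult_left_mono mult_right_mono)
    then show ?thesis
      using norm_triangle_ineq[of "p z" "q z"] b(5,6)[of z] by (simp add: algebra_simps)
  qed
  then show ?case using b by (intro exI[of _ "C + C'"] exI[of _ "a + a'"]) auto
next
  case (mult p q)
  then obtain C a C' a' where b: "0 \<le> C" "0 \<le> a" "0 \<le> C'" "0 \<le> a'"
    "\<And>z. cmod (p z) \<le> C * exp (a * norm z)" "\<And>z. cmod (q z) \<le> C' * exp (a' * norm z)"
    by metis
  have "cmod (p z * q z) \<le> (C * C') * exp ((a + a') * norm z)" for z
    using mult_mono[OF b(5,6)[of z]] b by (simp add: norm_mult exp_add algebra_simps)
  then show ?case using b by (intro exI[of _ "C * C'"] exI[of _ "a + a'"]) auto
qed

section \<open>Weighted spaces of entire functions\<close>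

definition hsq :: "(complex^'n::finite \<Rightarrow> real) \<Rightarrow> (complex^'n \<Rightarrow> complex) \<Rightarrow> real" where
  "hsq \<phi> F = (\<integral>z. (cmod (F z))\<^sup>2 * exp (- 2 * \<phi> z) \<partial>lborel)"

lemma hprod_self: "hprod \<phi> F F = of_real (hsq \<phi> F)"
proof -
  have "F z * cnj (F z) * complex_of_real (exp (- 2 * \<phi> z))
      = complex_of_real ((cmod (F z))\<^sup>2 * exp (- 2 * \<phi> z))" for z
    by (simp only: of_real_mult complex_norm_square)
  then show ?thesis
    by (simp only: hprod_def hsq_def integral_complex_of_real)
qed

lemma hsq_nonneg: "0 \<le> hsq \<phi> F"
  unfolding hsq_def by (rule integral_nonneg_AE) auto

lemma hnorm_eq: "hnorm \<phi> F = sqrt (hsq \<phi> F)"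
  by (simp add: hnorm_def hprod_self)

lemma hprod_cnj: "cnj (hprod \<phi> F G) = hprod \<phi> G F"
  unfolding hprod_def by (simp add: Bochner_Integration.integral_cnj[symmetric] mult_ac)

lemma HPhi_entire: "F \<in> HPhi \<phi> \<Longrightarrow> entire F"
  and HPhi_integrable: "F \<in> HPhi \<phi> \<Longrightarrow> integrable lborel (\<lambda>z. (cmod (F z))\<^sup>2 * exp (- 2 * \<phi> z))"
  by (auto simp: HPhi_def)

lemma cnj_borel_measurable [measurable]: "cnj \<in> borel_measurable borel"
  by (intro borel_measurable_continuous_onI continuous_intros)

locale weight =
  fixes \<phi> :: "complex^'n::finite \<Rightarrow> real"
  assumes continuous_weight: "continuous_on UNIV \<phi>"
begin

lemma weight_measurable [measurable]: "\<phi> \<in> borel_measurable borel"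
  by (intro borel_measurable_continuous_onI continuous_weight)

lemma integrable_product:
  assumes "F \<in> HPhi \<phi>" "G \<in> HPhi \<phi>"
  shows "integrable lborel (\<lambda>z. F z * cnj (G z) * complex_of_real (exp (- 2 * \<phi> z)))"
proof (rule Bochner_Integration.integrable_bound)
  show "integrable lborel (\<lambda>z. (cmod (F z))\<^sup>2 * exp (- 2 * \<phi> z) + (cmod (G z))\<^sup>2 * exp (- 2 * \<phi> z))"
    using assms HPhi_integrable by (intro Bochner_Integration.integrable_add) auto
  have [measurable]: "F \<in> borel_measurable borel" "G \<in> borel_measurable borel"
    using assms by (auto intro: entire_measurable HPhi_entire)
  show "(\<lambda>z. F z * cnj (G z) * complex_of_real (exp (- 2 * \<phi> z))) \<in> borel_measurable lborel"
    by measurable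
  have "cmod (F z) * cmod (G z) * exp (- 2 * \<phi> z)
      \<le> ((cmod (F z))\<^sup>2 + (cmod (G z))\<^sup>2) * exp (- 2 * \<phi> z)" for z
  proof (rule mult_right_mono)
    have "0 \<le> (cmod (F z) - cmod (G z))\<^sup>2" "0 \<le> cmod (F z) * cmod (G z)"
      by auto
    then show "cmod (F z) * cmod (G z) \<le> (cmod (F z))\<^sup>2 + (cmod (G z))\<^sup>2"
      unfolding power2_diff by linarith
  qed simp
  then show "AE z in lborel. norm (F z * cnj (G z) * complex_of_real (exp (- 2 * \<phi> z)))
      \<le> norm ((cmod (F z))\<^sup>2 * exp (- 2 * \<phi> z) + (cmod (G z))\<^sup>2 * exp (- 2 * \<phi> z))"
    by (auto simp: norm_mult algebra_simps)
qed

lemma HPhi_zero: "(\<lambda>z. 0) \<in> HPhi \<phi>"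
  by (simp add: HPhi_def entire_const)

lemma HPhi_cmult:
  assumes "F \<in> HPhi \<phi>"
  shows "(\<lambda>z. c * F z) \<in> HPhi \<phi>"
  using assms integrable_mult_right[of "(cmod c)\<^sup>2" lborel "\<lambda>z. (cmod (F z))\<^sup>2 * exp (- 2 * \<phi> z)"]
  by (auto simp: HPhi_def entire_cmult norm_mult power_mult_distrib mult.assoc)

lemma HPhi_add:
  assumes "F \<in> HPhi \<phi>" "G \<in> HPhi \<phi>"
  shows "(\<lambda>z. F z + G z) \<in> HPhi \<phi>"
proof -
  have [measurable]: "F \<in> borel_measurable borel" "G \<in> borel_measurable borel"
    using assms by (auto intro: entire_measurable HPhi_entire)
  have "integrable lborel (\<lambda>z. (cmod (F z + G z))\<^sup>2 * exp (- 2 * \<phi> z))"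
  proof (rule Bochner_Integration.integrable_bound)
    show "integrable lborel (\<lambda>z. 2 * ((cmod (F z))\<^sup>2 * exp (- 2 * \<phi> z)) + 2 * ((cmod (G z))\<^sup>2 * exp (- 2 * \<phi> z)))"
      using assms HPhi_integrable
      by (intro Bochner_Integration.integrable_add integrable_mult_right) auto
    have "(cmod (F z + G z))\<^sup>2 * exp (- 2 * \<phi> z)
        \<le> (2 * (cmod (F z))\<^sup>2 + 2 * (cmod (G z))\<^sup>2) * exp (- 2 * \<phi> z)" for z
    proof (rule mult_right_mono)
      have "(cmod (F z + G z))\<^sup>2 \<le> (cmod (F z) + cmod (G z))\<^sup>2"
        by (intro power_mono norm_triangle_ineq) auto
      moreover have "0 \<le> (cmod (F z) - cmod (G z))\<^sup>2"
        by simp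
      ultimately show "(cmod (F z + G z))\<^sup>2 \<le> 2 * (cmod (F z))\<^sup>2 + 2 * (cmod (G z))\<^sup>2"
        unfolding power2_diff power2_sum by linarith
    qed simp
    then show "AE z in lborel. norm ((cmod (F z + G z))\<^sup>2 * exp (- 2 * \<phi> z))
        \<le> norm (2 * ((cmod (F z))\<^sup>2 * exp (- 2 * \<phi> z)) + 2 * ((cmod (G z))\<^sup>2 * exp (- 2 * \<phi> z)))"
      by (auto simp: algebra_simps)
  qed measurable
  then show ?thesis
    using assms by (simp add: HPhi_def entire_add)
qed

lemma HPhi_diff: "F \<in> HPhi \<phi> \<Longrightarrow> G \<in> HPhi \<phi> \<Longrightarrow> (\<lambda>z. F z - G z) \<in> HPhi \<phi>"
  using HPhi_add[OF _ HPhi_cmult[of G "-1"]] by simp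

lemma HPhi_sum: "(\<And>a. a \<in> S \<Longrightarrow> F a \<in> HPhi \<phi>) \<Longrightarrow> (\<lambda>z. \<Sum>a\<in>S. F a z) \<in> HPhi \<phi>"
  by (induction S rule: infinite_finite_induct) (auto intro: HPhi_zero HPhi_add)

lemma hprod_add_left:
  assumes "F \<in> HPhi \<phi>" "G \<in> HPhi \<phi>" "K \<in> HPhi \<phi>"
  shows "hprod \<phi> (\<lambda>z. F z + G z) K = hprod \<phi> F K + hprod \<phi> G K"
  using Bochner_Integration.integral_add[OF integrable_product[OF assms(1,3)] integrable_product[OF assms(2,3)]]
  by (simp add: hprod_def algebra_simps)

lemma hprod_cmult_left: "hprod \<phi> (\<lambda>z. c * F z) K = c * hprod \<phi> F K"
  unfolding hprod_def by (simp add: mult.assoc)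

lemma hprod_zero_left: "hprod \<phi> (\<lambda>z. 0) K = 0"
  by (simp add: hprod_def)

lemma hprod_diff_left:
  assumes "F \<in> HPhi \<phi>" "G \<in> HPhi \<phi>" "K \<in> HPhi \<phi>"
  shows "hprod \<phi> (\<lambda>z. F z - G z) K = hprod \<phi> F K - hprod \<phi> G K"
  using hprod_add_left[OF assms(1) HPhi_cmult[OF assms(2), of "-1"] assms(3)]
    hprod_cmult_left[of "-1" G K] by simp

lemma hprod_sum_left:
  "(\<And>a. a \<in> S \<Longrightarrow> F a \<in> HPhi \<phi>) \<Longrightarrow> K \<in> HPhi \<phi> \<Longrightarrow>
    hprod \<phi> (\<lambda>z. \<Sum>a\<in>S. F a z) K = (\<Sum>a\<in>S. hprod \<phi> (F a) K)"
  by (induction S rule: infinite_finite_induct)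
     (auto simp: hprod_add_left HPhi_sum hprod_zero_left)

lemma hprod_add_right:
  assumes "F \<in> HPhi \<phi>" "G \<in> HPhi \<phi>" "K \<in> HPhi \<phi>"
  shows "hprod \<phi> K (\<lambda>z. F z + G z) = hprod \<phi> K F + hprod \<phi> K G"
  using arg_cong[OF hprod_add_left[OF assms], of cnj] by (simp add: hprod_cnj)

lemma hprod_cmult_right: "hprod \<phi> K (\<lambda>z. c * F z) = cnj c * hprod \<phi> K F"
  using arg_cong[OF hprod_cmult_left[of c F K], of cnj] by (simp add: hprod_cnj)

lemma hprod_diff_right:
  assumes "F \<in> HPhi \<phi>" "G \<in> HPhi \<phi>" "K \<in> HPhi \<phi>"
  shows "hprod \<phi> K (\<lambda>z. F z - G z) = hprod \<phi> K F - hprod \<phi> K G"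
  using arg_cong[OF hprod_diff_left[OF assms], of cnj] by (simp add: hprod_cnj)

lemma hprod_sum_right:
  assumes "\<And>a. a \<in> S \<Longrightarrow> F a \<in> HPhi \<phi>" "K \<in> HPhi \<phi>"
  shows "hprod \<phi> K (\<lambda>z. \<Sum>a\<in>S. F a z) = (\<Sum>a\<in>S. hprod \<phi> K (F a))"
  using arg_cong[OF hprod_sum_left[of S F K, OF assms], of cnj] by (simp add: hprod_cnj)

lemma hsq_diff:
  assumes "F \<in> HPhi \<phi>" "G \<in> HPhi \<phi>"
  shows "hsq \<phi> (\<lambda>z. F z - G z) = hsq \<phi> F + hsq \<phi> G - 2 * Re (hprod \<phi> F G)"
proof -
  have eq: "complex_of_real (hsq \<phi> (\<lambda>z. F z - G z)) =
      hprod \<phi> F F - hprod \<phi> F G - (hprod \<phi> G F - hprod \<phi> G G)"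
    using assms
    by (simp add: hprod_self[symmetric] hprod_diff_left hprod_diff_right HPhi_diff)
  show ?thesis
    using arg_cong[OF eq, of Re] by (simp add: hprod_self hprod_cnj[of \<phi> F G, symmetric])
qed

text \<open>The parallelogram identity with one of its two squares dropped. It stands in for the
  triangle inequality, with a factor 2 instead of square roots.\<close>

lemma hsq_add_le:
  assumes "F \<in> HPhi \<phi>" "G \<in> HPhi \<phi>"
  shows "hsq \<phi> (\<lambda>z. F z + G z) \<le> 2 * hsq \<phi> F + 2 * hsq \<phi> G"
proof -
  have "hsq \<phi> (\<lambda>z. F z - (-1) * G z) + hsq \<phi> (\<lambda>z. F z - G z) = 2 * hsq \<phi> F + 2 * hsq \<phi> G"
    using hsq_diff[OF assms] hsq_diff[OF assms(1) HPhi_cmult[OF assms(2), of "-1"]]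
      hprod_cmult_right[of F "-1" G] by (simp add: hsq_def)
  then show ?thesis
    using hsq_nonneg[of \<phi> "\<lambda>z. F z - G z"] by simp
qed

text \<open>Cauchy-Schwarz in the form with a free weight s, obtained from the nonnegativity of one
  square. The weight is later matched to the required accuracy.\<close>

lemma hprod_le:
  assumes "F \<in> HPhi \<phi>" "G \<in> HPhi \<phi>" "0 < s"
  shows "2 * cmod (hprod \<phi> F G) \<le> s * hsq \<phi> F + hsq \<phi> G / s"
proof -
  \<comment> \<open>The phase that turns the inner product into its modulus. It is 0 when the inner
    product vanishes, hence only \<open>cmod u \<le> 1\<close> below.\<close>
  define u where "u = cnj (hprod \<phi> F G) / complex_of_real (cmod (hprod \<phi> F G))"
  have "u * hprod \<phi> F G = complex_of_real ((cmod (hprod \<phi> F G))\<^sup>2) / complex_of_real (cmod (hprod \<phi> F G))"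
    unfolding complex_norm_square by (simp add: u_def mult.commute)
  then have u: "u * hprod \<phi> F G = cmod (hprod \<phi> F G)"
    by (simp add: power2_eq_square)
  have u1: "cmod u \<le> 1"
    by (simp add: u_def norm_divide)
  have "0 \<le> hsq \<phi> (\<lambda>z. (s * u) * F z - G z)"
    by (rule hsq_nonneg)
  also have "\<dots> = hsq \<phi> (\<lambda>z. (s * u) * F z) + hsq \<phi> G - 2 * Re (s * (u * hprod \<phi> F G))"
    using hsq_diff[OF HPhi_cmult[OF assms(1), of "s*u"] assms(2)]
    by (simp add: hprod_cmult_left mult.assoc)
  also have "hsq \<phi> (\<lambda>z. (s * u) * F z) = (s * cmod u)\<^sup>2 * hsq \<phi> F"
    unfolding hsq_def by (simp add: norm_mult power_mult_distrib mult.assoc)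
  also have "Re (s * (u * hprod \<phi> F G)) = s * cmod (hprod \<phi> F G)"
    by (simp add: u)
  finally have "2 * s * cmod (hprod \<phi> F G) \<le> (s * cmod u)\<^sup>2 * hsq \<phi> F + hsq \<phi> G"
    by simp
  also have "(s * cmod u)\<^sup>2 * hsq \<phi> F \<le> s\<^sup>2 * hsq \<phi> F"
    using u1 assms(3) by (intro mult_right_mono power_mono hsq_nonneg) (auto intro: mult_left_le)
  finally have "2 * cmod (hprod \<phi> F G) * s \<le> (s * hsq \<phi> F + hsq \<phi> G / s) * s"
    using assms(3) by (simp add: power2_eq_square algebra_simps)
  then show ?thesis
    using assms(3) by simp
qed

text \<open>By continuity a single nonzero value would give a ball, of positive measure, on which F
  does not vanish.\<close>

lemma hsq_eq_0:
  assumes "F \<in> HPhi \<phi>" "hsq \<phi> F = 0"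
  shows "F z = 0"
proof (rule ccontr)
  assume "F z \<noteq> 0"
  have "AE z in lborel. (cmod (F z))\<^sup>2 * exp (- 2 * \<phi> z) = 0"
    using assms integral_nonneg_eq_0_iff_AE[OF HPhi_integrable[OF assms(1)]] by (auto simp: hsq_def)
  then have ae: "AE z in lborel. z \<notin> {z. F z \<noteq> 0}"
    by simp
  have op: "open {z. F z \<noteq> 0}"
    using entire_continuous[OF HPhi_entire[OF assms(1)], of UNIV]
    by (intro open_Collect_neq) auto
  then obtain e where "e > 0" and e: "ball z e \<subseteq> {z. F z \<noteq> 0}"
    using \<open>F z \<noteq> 0\<close> by (auto simp: open_contains_ball)
  have "emeasure lborel {z. F z \<noteq> 0} = 0"
    using ae op by (subst (asm) AE_iff_measurable[OF _ refl]) auto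
  then have "emeasure lborel (ball z e) = 0"
    using emeasure_mono[OF e, of lborel] op by simp
  then show False
    using content_ball_pos[OF \<open>e > 0\<close>, of z] by (simp add: measure_def)
qed

text \<open>Membership of K in \<open>HPhi \<phi>\<close> is part of the definition: otherwise a K
  whose differences are not square integrable would satisfy the approximation condition through the
  default value 0 of the integral.\<close>

definition closed_span :: "('i \<Rightarrow> complex^'n \<Rightarrow> complex) \<Rightarrow> (complex^'n \<Rightarrow> complex) set" where
  "closed_span e = {K \<in> HPhi \<phi>. \<forall>\<epsilon>>0. \<exists>S c. finite S \<and> hsq \<phi> (\<lambda>z. K z - (\<Sum>a\<in>S. c a * e a z)) < \<epsilon>}"

lemma closed_span_limit:
  assumes K: "K \<in> HPhi \<phi>" and e: "\<And>a. e a \<in> HPhi \<phi>"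
    and mem: "\<And>m. L m \<in> closed_span e"
    and lim: "(\<lambda>m. hsq \<phi> (\<lambda>z. K z - L m z)) \<longlonglongrightarrow> 0"
  shows "K \<in> closed_span e"
  unfolding closed_span_def
proof (intro CollectI conjI allI impI K)
  fix \<epsilon> :: real assume "\<epsilon> > 0"
  \<comment> \<open>A quarter each, because \<open>hsq_add_le\<close> doubles both errors.\<close>
  then obtain m where m: "hsq \<phi> (\<lambda>z. K z - L m z) < \<epsilon> / 4"
    using order_tendstoD(2)[OF lim, of "\<epsilon>/4"] by (auto simp: eventually_sequentially)
  have L: "L m \<in> HPhi \<phi>"
    using mem by (auto simp: closed_span_def)
  have "0 < \<epsilon> / 4"
    using \<open>\<epsilon> > 0\<close> by simp
  then obtain S c where S: "finite S"
    "hsq \<phi> (\<lambda>z. L m z - (\<Sum>a\<in>S. c a * e a z)) < \<epsilon> / 4"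
    using mem[of m] unfolding closed_span_def by blast
  have "(\<lambda>z. \<Sum>a\<in>S. c a * e a z) \<in> HPhi \<phi>"
    by (intro HPhi_sum HPhi_cmult e)
  from hsq_add_le[OF HPhi_diff[OF K L] HPhi_diff[OF L this]] m S(2)
  have "hsq \<phi> (\<lambda>z. K z - (\<Sum>a\<in>S. c a * e a z)) < \<epsilon>"
    by simp
  with S(1) show "\<exists>S c. finite S \<and> hsq \<phi> (\<lambda>z. K z - (\<Sum>a\<in>S. c a * e a z)) < \<epsilon>"
    by blast
qed

lemma hsq_orthonormal_diff:
  assumes e: "\<And>a. e a \<in> HPhi \<phi>"
    and orth: "\<And>a b. hprod \<phi> (e a) (e b) = (if a = b then 1 else 0)"
    and F: "F \<in> HPhi \<phi>" and fin: "finite S"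
  shows "hsq \<phi> (\<lambda>z. F z - (\<Sum>a\<in>S. hprod \<phi> F (e a) * e a z))
    = hsq \<phi> F - (\<Sum>a\<in>S. (cmod (hprod \<phi> F (e a)))\<^sup>2)"
proof -
  define G where "G z = (\<Sum>a\<in>S. hprod \<phi> F (e a) * e a z)" for z
  have G: "G \<in> HPhi \<phi>"
    unfolding G_def by (intro HPhi_sum HPhi_cmult e)
  have FG: "hprod \<phi> F G = (\<Sum>a\<in>S. (cmod (hprod \<phi> F (e a)))\<^sup>2)"
  proof -
    have sq: "cnj x * x = complex_of_real ((cmod x)\<^sup>2)" for x
      by (simp only: complex_norm_square mult.commute)
    have "hprod \<phi> F G = (\<Sum>a\<in>S. hprod \<phi> F (\<lambda>z. hprod \<phi> F (e a) * e a z))"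
      unfolding G_def by (intro hprod_sum_right HPhi_cmult e F)
    then show ?thesis
      by (simp only: hprod_cmult_right sq of_real_sum)
  qed
  have Ge: "hprod \<phi> G (e b) = hprod \<phi> F (e b)" if "b \<in> S" for b
  proof -
    have "hprod \<phi> G (e b) = (\<Sum>a\<in>S. hprod \<phi> F (e a) * (if a = b then 1 else 0))"
      unfolding G_def by (subst hprod_sum_left) (auto intro: HPhi_cmult e simp: hprod_cmult_left orth)
    also have "\<dots> = hprod \<phi> F (e b)"
      using that fin by (simp add: if_distrib cong: if_cong)
    finally show ?thesis .
  qed
  have "hprod \<phi> K G = (\<Sum>a\<in>S. hprod \<phi> K (\<lambda>z. hprod \<phi> F (e a) * e a z))" if "K \<in> HPhi \<phi>" for K
    unfolding G_def by (intro hprod_sum_right HPhi_cmult e that)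
  from this[OF G]
  have "complex_of_real (hsq \<phi> G) = (\<Sum>a\<in>S. hprod \<phi> G (\<lambda>z. hprod \<phi> F (e a) * e a z))"
    by (simp only: hprod_self)
  also have "\<dots> = complex_of_real (\<Sum>a\<in>S. (cmod (hprod \<phi> F (e a)))\<^sup>2)"
    unfolding hprod_cmult_right of_real_sum
    by (intro sum.cong refl) (simp only: Ge complex_norm_square mult.commute)
  finally have "hsq \<phi> G = (\<Sum>a\<in>S. (cmod (hprod \<phi> F (e a)))\<^sup>2)"
    by (simp only: of_real_eq_iff)
  then show ?thesis
    using hsq_diff[OF F G] by (simp add: FG G_def)
qed

lemma hsq_orthonormal_sum:
  assumes e: "\<And>a. e a \<in> HPhi \<phi>"
    and orth: "\<And>a b. hprod \<phi> (e a) (e b) = (if a = b then 1 else 0)"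
    and fin: "finite S"
  shows "hsq \<phi> (\<lambda>z. \<Sum>a\<in>S. c a * e a z) = (\<Sum>a\<in>S. (cmod (c a))\<^sup>2)"
proof -
  define G where "G z = (\<Sum>a\<in>S. c a * e a z)" for z
  have G: "G \<in> HPhi \<phi>"
    unfolding G_def by (intro HPhi_sum HPhi_cmult e)
  have Ge: "hprod \<phi> G (e b) = c b" if "b \<in> S" for b
  proof -
    have "hprod \<phi> G (e b) = (\<Sum>a\<in>S. c a * (if a = b then 1 else 0))"
      unfolding G_def by (subst hprod_sum_left) (auto intro: HPhi_cmult e simp: hprod_cmult_left orth)
    also have "\<dots> = c b"
      using that fin by (simp add: if_distrib cong: if_cong)
    finally show ?thesis .
  qed
  \<comment> \<open>The combination G is its own Fourier sum over S, so the Pythagorean identity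
    applied to G has remainder 0.\<close>
  have "(\<lambda>z. G z - (\<Sum>a\<in>S. hprod \<phi> G (e a) * e a z)) = (\<lambda>z. 0)"
    by (subst G_def) (simp add: Ge)
  then have "0 = hsq \<phi> G - (\<Sum>a\<in>S. (cmod (hprod \<phi> G (e a)))\<^sup>2)"
    using hsq_orthonormal_diff[OF e orth G fin] by (simp add: hsq_def)
  then show ?thesis
    by (simp add: Ge G_def[symmetric] cong: sum.cong)
qed

text \<open>Weak convergence against the vectors \<open>K\<close> that represent point evaluations gives pointwise
  convergence of the Fourier expansion; Fatou's lemma upgrades it to norm convergence, so that no
  completeness of \<open>HPhi \<phi>\<close> is needed.\<close>

lemma orthonormal_expansion_pointwise:
  fixes e :: "'i \<Rightarrow> complex^'n \<Rightarrow> complex"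
  assumes e: "\<And>a. e a \<in> HPhi \<phi>"
    and orth: "\<And>a b. hprod \<phi> (e a) (e b) = (if a = b then 1 else 0)"
    and F: "F \<in> HPhi \<phi>" and K: "K \<in> closed_span e"
    and rep: "\<And>F. F \<in> HPhi \<phi> \<Longrightarrow> F w = \<gamma> * hprod \<phi> F K"
    and S: "\<And>m. finite (S m)" "\<And>T. finite T \<Longrightarrow> \<exists>m0. \<forall>m\<ge>m0. T \<subseteq> S m"
  shows "(\<lambda>m. \<Sum>a\<in>S m. hprod \<phi> F (e a) * e a w) \<longlonglongrightarrow> F w"
proof (rule LIMSEQ_I)
  fix r :: real assume "0 < r"
  \<comment> \<open>Chosen so that (cmod \<gamma> + 1) * s * (hsq \<phi> F + 1) = r; the added ones
    keep the denominator positive.\<close>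
  define s where "s = r / ((cmod \<gamma> + 1) * (hsq \<phi> F + 1))"
  have pos: "0 < (cmod \<gamma> + 1) * (hsq \<phi> F + 1)"
    using hsq_nonneg[of \<phi> F] by (simp add: add_nonneg_pos)
  then have "0 < s"
    using \<open>0 < r\<close> by (simp add: s_def)
  have K': "K \<in> HPhi \<phi>"
    using K by (simp add: closed_span_def)
  have "0 < s\<^sup>2"
    using \<open>0 < s\<close> by simp
  then obtain T d where T: "finite T" "hsq \<phi> (\<lambda>z. K z - (\<Sum>a\<in>T. d a * e a z)) < s\<^sup>2"
    using K unfolding closed_span_def by blast
  define g where "g z = (\<Sum>a\<in>T. d a * e a z)" for z
  have g: "g \<in> HPhi \<phi>"
    unfolding g_def by (intro HPhi_sum HPhi_cmult e)
  from S(2)[OF T(1)] obtain m0 where m0: "\<And>m. m \<ge> m0 \<Longrightarrow> T \<subseteq> S m"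
    by blast
  have "norm ((\<Sum>a\<in>S m. hprod \<phi> F (e a) * e a w) - F w) < r" if "m \<ge> m0" for m
  proof -
    define R where "R z = F z - (\<Sum>a\<in>S m. hprod \<phi> F (e a) * e a z)" for z
    have R: "R \<in> HPhi \<phi>"
      unfolding R_def by (intro HPhi_diff F HPhi_sum HPhi_cmult e)
    have "hsq \<phi> R = hsq \<phi> F - (\<Sum>a\<in>S m. (cmod (hprod \<phi> F (e a)))\<^sup>2)"
      unfolding R_def by (rule hsq_orthonormal_diff[OF e orth F S(1)])
    then have hR: "hsq \<phi> R \<le> hsq \<phi> F"
      using sum_nonneg[of "S m" "\<lambda>a. (cmod (hprod \<phi> F (e a)))\<^sup>2"] by simp
    have Re: "hprod \<phi> R (e b) = 0" if "b \<in> S m" for b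
    proof -
      have "hprod \<phi> R (e b) = hprod \<phi> F (e b) - (\<Sum>a\<in>S m. hprod \<phi> F (e a) * (if a = b then 1 else 0))"
        unfolding R_def
        by (subst hprod_diff_left, rule F, intro HPhi_sum HPhi_cmult e, rule e, subst hprod_sum_left)
           (auto intro: HPhi_cmult e simp: hprod_cmult_left orth)
      also have "\<dots> = 0"
        using that S(1) by (simp add: if_distrib cong: if_cong)
      finally show ?thesis .
    qed
    have "hprod \<phi> R g = (\<Sum>a\<in>T. hprod \<phi> R (\<lambda>z. d a * e a z))"
      unfolding g_def by (intro hprod_sum_right HPhi_cmult e R)
    also have "\<dots> = 0"
      using m0[OF that] by (intro sum.neutral) (auto simp: hprod_cmult_right Re)
    \<comment> \<open>The remainder R is orthogonal to all vectors with index in \<open>S m\<close>,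
      hence to g, so K may be replaced by its small error K - g.\<close>
    finally have "hprod \<phi> R K = hprod \<phi> R (\<lambda>z. K z - g z)"
      using hprod_diff_right[OF K' g R] by simp
    then have "2 * cmod (hprod \<phi> R K) \<le> s * hsq \<phi> R + hsq \<phi> (\<lambda>z. K z - g z) / s"
      using hprod_le[OF R HPhi_diff[OF K' g] \<open>0 < s\<close>] by simp
    also have "\<dots> \<le> s * hsq \<phi> F + s\<^sup>2 / s"
      using \<open>0 < s\<close> hR T(2) by (intro add_mono mult_left_mono divide_right_mono) (auto simp: g_def)
    also have "\<dots> = s * (hsq \<phi> F + 1)"
      using \<open>0 < s\<close> by (simp add: power2_eq_square algebra_simps)
    finally have "2 * cmod (hprod \<phi> R K) \<le> s * (hsq \<phi> F + 1)" .
    then have le: "(cmod \<gamma> + 1) * (2 * cmod (hprod \<phi> R K)) \<le> (cmod \<gamma> + 1) * (s * (hsq \<phi> F + 1))"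
      by (intro mult_left_mono) auto
    have req: "(cmod \<gamma> + 1) * (s * (hsq \<phi> F + 1)) = r"
      using pos by (simp add: s_def field_simps)
    have "cmod (R w) = cmod \<gamma> * cmod (hprod \<phi> R K)"
      by (subst rep[OF R]) (simp add: norm_mult)
    also have "\<dots> \<le> (cmod \<gamma> + 1) * cmod (hprod \<phi> R K)"
      by (intro mult_right_mono) auto
    finally have "cmod (R w) < r"
      using le req \<open>0 < r\<close> by simp
    then show ?thesis
      by (simp add: R_def norm_minus_commute)
  qed
  then show "\<exists>m0. \<forall>m\<ge>m0. norm ((\<Sum>a\<in>S m. hprod \<phi> F (e a) * e a w) - F w) < r"
    by blast
qed

lemma orthonormal_complete:
  fixes e :: "'i::countable \<Rightarrow> complex^'n \<Rightarrow> complex"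
  assumes e: "\<And>a. e a \<in> HPhi \<phi>"
    and orth: "\<And>a b. hprod \<phi> (e a) (e b) = (if a = b then 1 else 0)"
    and K: "\<And>w. \<exists>K\<in>closed_span e. \<exists>\<gamma>. \<forall>F\<in>HPhi \<phi>. F w = \<gamma> * hprod \<phi> F K"
  shows "complete_orthonormal_system \<phi> e"
  unfolding complete_orthonormal_system_def
proof (intro conjI allI ballI impI e orth)
  fix F and \<epsilon> :: real assume F: "F \<in> HPhi \<phi>" and "\<epsilon> > 0"
  \<comment> \<open>An increasing exhaustion of the countable index type by finite sets.\<close>
  define S where "S m = {a::'i. to_nat a < m}" for m
  have finS: "finite (S m)" for m
    using finite_vimageI[of "{..<m}" "to_nat :: 'i \<Rightarrow> nat"] by (simp add: S_def vimage_def)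
  have monoS: "S m \<subseteq> S m'" if "m \<le> m'" for m m'
    using that by (auto simp: S_def)
  have exh: "\<exists>m0. \<forall>m\<ge>m0. T \<subseteq> S m" if "finite T" for T
  proof -
    have "finite (to_nat ` T)"
      using that by simp
    then obtain m0 where "\<forall>x\<in>to_nat ` T. x < m0"
      using finite_nat_set_iff_bounded by blast
    then show ?thesis
      by (intro exI[of _ m0]) (auto simp: S_def)
  qed
  define c where "c a = hprod \<phi> F (e a)" for a
  define P where "P m z = (\<Sum>a\<in>S m. c a * e a z)" for m z
  define s where "s m = (\<Sum>a\<in>S m. (cmod (c a))\<^sup>2)" for m
  have P: "P m \<in> HPhi \<phi>" for m
    unfolding P_def by (intro HPhi_sum HPhi_cmult e)
  have ptw: "(\<lambda>m. P m w) \<longlonglongrightarrow> F w" for w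
  proof -
    obtain K \<gamma> where "K \<in> closed_span e" "\<And>F. F \<in> HPhi \<phi> \<Longrightarrow> F w = \<gamma> * hprod \<phi> F K"
      using K[of w] by blast
    from orthonormal_expansion_pointwise[OF e orth F this finS exh]
    show ?thesis
      by (simp add: P_def c_def)
  qed
  have "incseq s"
    unfolding s_def incseq_def using finS monoS by (auto intro!: sum_mono2)
  moreover have sle: "s m \<le> hsq \<phi> F" for m
    using hsq_orthonormal_diff[OF e orth F finS, of m] hsq_nonneg
      [of \<phi> "\<lambda>z. F z - (\<Sum>a\<in>S m. hprod \<phi> F (e a) * e a z)"]
    by (simp add: s_def c_def)
  ultimately obtain L where L: "s \<longlonglongrightarrow> L" "\<And>m. s m \<le> L"
    using incseq_convergent by blast
  have "0 < \<epsilon>\<^sup>2"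
    using \<open>\<epsilon> > 0\<close> by simp
  \<comment> \<open>From N on, the tail of the Bessel sum is below \<epsilon>^2; this tail will be
    the squared distance of the partial sums.\<close>
  then obtain N where "\<forall>n\<ge>N. L - \<epsilon>\<^sup>2 < s n"
    using order_tendstoD(1)[OF L(1), of "L - \<epsilon>\<^sup>2"] by (auto simp: eventually_sequentially)
  then have N: "L - s N < \<epsilon>\<^sup>2"
    by (simp add: algebra_simps)
  define W where "W z = exp (- 2 * \<phi> z)" for z
  have [measurable]: "W \<in> borel_measurable borel"
    unfolding W_def by measurable
  have [measurable]: "F \<in> borel_measurable borel" "P m \<in> borel_measurable borel" for m
    using F P by (auto intro: entire_measurable HPhi_entire)
  have nn: "(\<integral>\<^sup>+z. ennreal ((cmod (G z))\<^sup>2 * W z) \<partial>lborel) = ennreal (hsq \<phi> G)" if "G \<in> HPhi \<phi>" for G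
    using HPhi_integrable[OF that] unfolding hsq_def W_def
    by (intro nn_integral_eq_integral) auto
  have PP: "hsq \<phi> (\<lambda>z. P m z - P N z) \<le> L - s N" if "m \<ge> N" for m
  proof -
    have "P m z - P N z = (\<Sum>a\<in>S m - S N. c a * e a z)" for z
      unfolding P_def using finS monoS[OF that] by (simp add: sum_diff)
    then have "hsq \<phi> (\<lambda>z. P m z - P N z) = (\<Sum>a\<in>S m - S N. (cmod (c a))\<^sup>2)"
      using hsq_orthonormal_sum[OF e orth, of "S m - S N" c] finS by simp
    also have "\<dots> = s m - s N"
      unfolding s_def using finS monoS[OF that] by (simp add: sum_diff)
    finally show ?thesis
      using L(2)[of m] by simp
  qed
  \<comment> \<open>With N fixed, F - P N is the pointwise limit of P m - P N, whose squared norms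
    are at most L - s N for m \<ge> N; Fatou carries this bound over to the limit.\<close>
  have "ennreal (hsq \<phi> (\<lambda>z. F z - P N z)) = (\<integral>\<^sup>+z. ennreal ((cmod (F z - P N z))\<^sup>2 * W z) \<partial>lborel)"
    using nn[OF HPhi_diff[OF F P]] by simp
  also have "\<dots> = (\<integral>\<^sup>+z. liminf (\<lambda>m. ennreal ((cmod (P m z - P N z))\<^sup>2 * W z)) \<partial>lborel)"
  proof (rule nn_integral_cong)
    fix z
    have "(\<lambda>m. ennreal ((cmod (P m z - P N z))\<^sup>2 * W z)) \<longlonglongrightarrow> ennreal ((cmod (F z - P N z))\<^sup>2 * W z)"
      by (intro tendsto_intros ptw)
    then show "ennreal ((cmod (F z - P N z))\<^sup>2 * W z) = liminf (\<lambda>m. ennreal ((cmod (P m z - P N z))\<^sup>2 * W z))"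
      by (simp add: lim_imp_Liminf)
  qed
  also have "\<dots> \<le> liminf (\<lambda>m. \<integral>\<^sup>+z. ennreal ((cmod (P m z - P N z))\<^sup>2 * W z) \<partial>lborel)"
    by (rule nn_integral_liminf) measurable
  also have "\<dots> = liminf (\<lambda>m. ennreal (hsq \<phi> (\<lambda>z. P m z - P N z)))"
    by (simp add: nn[OF HPhi_diff[OF P P]])
  also have "\<dots> \<le> limsup (\<lambda>m. ennreal (hsq \<phi> (\<lambda>z. P m z - P N z)))"
    by (rule Liminf_le_Limsup) simp
  also have "\<dots> \<le> ennreal (L - s N)"
    using PP by (intro Limsup_bounded eventually_sequentiallyI[of N] ennreal_leI)
  finally have "hsq \<phi> (\<lambda>z. F z - P N z) \<le> L - s N"
    using L(2)[of N] by (simp add: ennreal_le_iff)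
  then have "sqrt (hsq \<phi> (\<lambda>z. F z - P N z)) < sqrt (\<epsilon>\<^sup>2)"
    using N by (intro real_sqrt_less_mono) simp
  then have "hnorm \<phi> (\<lambda>z. F z - (\<Sum>a\<in>S N. c a * e a z)) < \<epsilon>"
    using \<open>\<epsilon> > 0\<close> by (simp add: hnorm_eq P_def)
  then show "\<exists>S c. finite S \<and> hnorm \<phi> (\<lambda>z. F z - (\<Sum>a\<in>S. c a * e a z)) < \<epsilon>"
    using finS by blast
qed

end

section \<open>Integration by parts and the adjoint\<close>

text \<open>This form and \<open>quad\<close> are written as double sums so that differentiation and
  closure rules apply term by term.\<close>

definition herm :: "complex^'n::finite^'n \<Rightarrow> complex^'n \<Rightarrow> complex" where
  "herm P z = (\<Sum>i\<in>UNIV. \<Sum>j\<in>UNIV. z $ i * (P $ i $ j * cnj (z $ j)))"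

definition quad :: "complex^'n::finite^'n \<Rightarrow> complex^'n \<Rightarrow> complex" where
  "quad S z = (\<Sum>i\<in>UNIV. \<Sum>j\<in>UNIV. z $ i * (S $ i $ j * z $ j))"

lemma bilin_herm: "bilin z (P *v cnj_vec z) = herm P z"
  by (simp add: bilin_def matrix_vector_mult_def cnj_vec_def herm_def sum_distrib_left)

lemma bilin_quad: "bilin z (S *v z) = quad S z"
  by (simp add: bilin_def matrix_vector_mult_def quad_def sum_distrib_left)

lemma psi0_eq: "psi0 Q = (\<lambda>z. exp (- quad Q z))"
  by (simp add: psi0_def bilin_quad fun_eq_iff)

lemma continuous_herm: "continuous_on A (herm P)"
  unfolding herm_def by (intro continuous_intros)

lemma quad_cpoly: "cpoly (quad S)"
  unfolding quad_def by (intro cpoly_intros)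

lemma quad_diff: "quad (S - T) z = quad S z - quad T z"
  by (simp add: quad_def sum_subtractf algebra_simps)

lemma herm_scale: "herm P (c *s z) = c * cnj c * herm P z"
  by (simp add: herm_def sum_distrib_left mult_ac)

lemma pderiv_at_quad:
  assumes "\<And>i j. S $ i $ j = S $ j $ i"
  shows "pderiv_at k (quad S) z = 2 * (\<Sum>j\<in>UNIV. S $ k $ j * z $ j)"
proof -
  have ent: "entire (\<lambda>z. z $ i * (S $ i $ j * z $ j))" for i j
    by (intro entire_mult entire_const entire_coord)
  have "pderiv_at k (\<lambda>z. z $ i * (S $ i $ j * z $ j)) z
      = (if j = k then z $ i * S $ i $ j else 0) + (if i = k then S $ i $ j * z $ j else 0)" for i j
    by (subst pderiv_at_mult)
       (auto intro!: entire_mult entire_const entire_coord simp: pderiv_at_cmult entire_coord pderiv_at_coord)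
  then have "pderiv_at k (quad S) z =
      (\<Sum>i\<in>UNIV. \<Sum>j\<in>UNIV. (if j = k then z $ i * S $ i $ j else 0) + (if i = k then S $ i $ j * z $ j else 0))"
    unfolding quad_def by (simp add: pderiv_at_sum entire_sum ent)
  also have "\<dots> = (\<Sum>i\<in>UNIV. z $ i * S $ i $ k) + (\<Sum>j\<in>UNIV. S $ k $ j * z $ j)"
  proof -
    have "(\<Sum>i\<in>UNIV. \<Sum>j\<in>UNIV. if i = k then S $ i $ j * z $ j else 0) = (\<Sum>j\<in>UNIV. S $ k $ j * z $ j)"
      by (subst sum.swap) simp
    then show ?thesis
      by (simp add: sum.distrib)
  qed
  also have "\<dots> = 2 * (\<Sum>j\<in>UNIV. S $ k $ j * z $ j)"
    by (simp add: assms[of _ k] mult.commute)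
  finally show ?thesis .
qed

text \<open>Isolates what the analysis uses, independently of U, X and the eigenvalues. Equation
  \<open>MP\<close> pins M down as cnj W times the inverse of P without naming an inverse. The laws
  are entrywise because they are applied inside finite sums. The strict gap \<open>kap < 1\<close>
  yields square integrability of the Gaussian \<open>psi0 (W - S)\<close> and leaves room for the
  steps towards the evaluation kernels.\<close>

locale hermite =
  fixes P S W M :: "complex^'n::finite^'n" and rho kap m0 :: real
  assumes P_herm: "cnj (P $ i $ j) = P $ j $ i"
    and S_sym: "S $ i $ j = S $ j $ i"
    and W_sym: "W $ i $ j = W $ j $ i"
    and MP: "(\<Sum>k\<in>UNIV. M $ i $ k * P $ k $ j) = cnj (W $ i $ j)"
    and MW: "(\<Sum>k\<in>UNIV. M $ i $ k * W $ k $ j) = cnj (P $ i $ j) - (if i = j then of_real (rho\<^sup>2) else 0)"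
    and rho_pos: "0 < rho"
    and m0_pos: "0 < m0"
    and coercive: "m0 * (norm z)\<^sup>2 \<le> Re (herm P z)"
    and kap: "0 \<le> kap" "kap < 1"
    and W_bound: "cmod (quad W z) \<le> kap * Re (herm P z)"
begin

definition phi :: "complex^'n \<Rightarrow> real" where
  "phi z = Re (herm P z) + Re (quad S z)"

abbreviation Q where "Q \<equiv> W - S"

lemma continuous_phi: "continuous_on UNIV phi"
  unfolding phi_def[abs_def]
  by (intro continuous_intros continuous_herm entire_continuous[OF cpoly_entire[OF quad_cpoly]])

sublocale weight phi
  by unfold_locales (rule continuous_phi)

text \<open>The Wirtinger derivative of \<open>phi\<close> with respect to z_k.\<close>

definition gradient :: "'n \<Rightarrow> complex^'n \<Rightarrow> complex" where
  "gradient k z = (\<Sum>j\<in>UNIV. P $ k $ j * cnj (z $ j)) + (\<Sum>j\<in>UNIV. S $ k $ j * z $ j)"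

lemma herm_directional:
  "((\<lambda>s. herm P (x + s *\<^sub>R (c *s axis k 1))) has_vector_derivative
     complex_of_real (2 * Re (c * (\<Sum>j\<in>UNIV. P $ k $ j * cnj ((x + s *\<^sub>R (c *s axis k 1)) $ j))))) (at s)"
proof -
  let ?v = "c *s axis k 1 :: complex^'n"
  define y where "y = x + s *\<^sub>R ?v"
  have v: "?v $ i = (if i = k then c else 0)" for i
    by (simp add: axis_def)
  have c1: "((\<lambda>s. (x + s *\<^sub>R ?v) $ i) has_vector_derivative ?v $ i) (at s)" for i
    by (rule bounded_linear.has_vector_derivative[OF bounded_linear_vec_nth])
       (auto intro!: derivative_eq_intros)
  have c2: "((\<lambda>s. cnj ((x + s *\<^sub>R ?v) $ i)) has_vector_derivative cnj (?v $ i)) (at s)" for i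
    by (rule bounded_linear.has_vector_derivative[OF bounded_linear_cnj c1])
  have "((\<lambda>s. herm P (x + s *\<^sub>R ?v)) has_vector_derivative
     (\<Sum>i\<in>UNIV. \<Sum>j\<in>UNIV. y $ i * (P $ i $ j * cnj (?v $ j)) + ?v $ i * (P $ i $ j * cnj (y $ j)))) (at s)"
    unfolding herm_def y_def
    by (intro has_vector_derivative_sum has_vector_derivative_mult c1
        has_vector_derivative_mult_right c2)
  also have "(\<Sum>i\<in>UNIV. \<Sum>j\<in>UNIV. y $ i * (P $ i $ j * cnj (?v $ j)) + ?v $ i * (P $ i $ j * cnj (y $ j)))
     = (\<Sum>i\<in>UNIV. y $ i * (P $ i $ k * cnj c)) + (\<Sum>j\<in>UNIV. c * (P $ k $ j * cnj (y $ j)))"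
  proof -
    have "(\<Sum>i\<in>UNIV. \<Sum>j\<in>UNIV. y $ i * (P $ i $ j * cnj (?v $ j))) = (\<Sum>i\<in>UNIV. y $ i * (P $ i $ k * cnj c))"
      unfolding v by (intro sum.cong refl) (simp add: if_distrib if_distribR cong: if_cong)
    moreover have "(\<Sum>i\<in>UNIV. \<Sum>j\<in>UNIV. ?v $ i * (P $ i $ j * cnj (y $ j))) = (\<Sum>j\<in>UNIV. c * (P $ k $ j * cnj (y $ j)))"
      unfolding v by (subst sum.swap, intro sum.cong refl) (simp add: if_distrib if_distribR cong: if_cong)
    ultimately show ?thesis
      by (simp add: sum.distrib)
  qed
  \<comment> \<open>Since P is Hermitian, the derivative falling on the unconjugated factor and the
    one falling on the conjugated factor are conjugate to each other.\<close>
  also have "(\<Sum>i\<in>UNIV. y $ i * (P $ i $ k * cnj c)) = cnj (c * (\<Sum>j\<in>UNIV. P $ k $ j * cnj (y $ j)))"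
    by (simp add: sum_distrib_left P_herm mult_ac)
  also have "\<dots> + (\<Sum>j\<in>UNIV. c * (P $ k $ j * cnj (y $ j))) =
      complex_of_real (2 * Re (c * (\<Sum>j\<in>UNIV. P $ k $ j * cnj (y $ j))))"
  proof -
    have "cnj q + q = complex_of_real (2 * Re q)" for q
      by (simp add: complex_eq_iff)
    then show ?thesis
      by (simp only: sum_distrib_left[symmetric])
  qed
  finally show ?thesis
    by (simp add: y_def)
qed

lemma phi_directional:
  "((\<lambda>s. phi (x + s *\<^sub>R (c *s axis k 1))) has_real_derivative
     2 * Re (c * gradient k (x + s *\<^sub>R (c *s axis k 1)))) (at s)"
proof -
  have "((\<lambda>s. quad S (x + s *\<^sub>R (c *s axis k 1))) has_vector_derivative
     c * (2 * (\<Sum>j\<in>UNIV. S $ k $ j * (x + s *\<^sub>R (c *s axis k 1)) $ j))) (at s)"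
    using pderiv_at_directional[OF cpoly_entire[OF quad_cpoly], of S x c k s]
    by (simp only: pderiv_at_quad[OF S_sym])
  from has_vector_derivative_add[OF bounded_linear.has_vector_derivative[OF bounded_linear_Re herm_directional]
      bounded_linear.has_vector_derivative[OF bounded_linear_Re this]]
  show ?thesis
    unfolding phi_def gradient_def has_real_derivative_iff_has_vector_derivative
    by (rule has_vector_derivative_eq_rhs) (simp add: algebra_simps)
qed

text \<open>The Wirtinger derivative in z_k of F * cnj G * exp (- 2 phi); the factor cnj G is
  antiholomorphic and is treated as a constant.\<close>

definition ibp :: "'n \<Rightarrow> (complex^'n \<Rightarrow> complex) \<Rightarrow> (complex^'n \<Rightarrow> complex) \<Rightarrow> complex^'n \<Rightarrow> complex" where
  "ibp k F G z = (pderiv_at k F z - 2 * gradient k z * F z) * cnj (G z) * of_real (exp (- 2 * phi z))"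

lemma adj_domD:
  assumes "F \<in> adj_dom phi"
  shows "F \<in> HPhi phi" "(\<lambda>z. z $ k * F z) \<in> HPhi phi" "pderiv_at k F \<in> HPhi phi"
  using assms by (auto simp: adj_dom_def)

lemma ibp_expand:
  "ibp k F G z = pderiv_at k F z * cnj (G z) * of_real (exp (- 2 * phi z))
     - (\<Sum>j\<in>UNIV. 2 * P $ k $ j * (F z * cnj (z $ j * G z) * of_real (exp (- 2 * phi z))))
     - (\<Sum>j\<in>UNIV. 2 * S $ k $ j * ((z $ j * F z) * cnj (G z) * of_real (exp (- 2 * phi z))))"
proof -
  have "(\<Sum>j\<in>UNIV. 2 * P $ k $ j * (F z * cnj (z $ j * G z) * of_real (exp (- 2 * phi z))))
      = 2 * (\<Sum>j\<in>UNIV. P $ k $ j * cnj (z $ j)) * F z * cnj (G z) * of_real (exp (- 2 * phi z))"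
    unfolding sum_distrib_left sum_distrib_right by (intro sum.cong refl) (simp add: mult_ac)
  moreover have "(\<Sum>j\<in>UNIV. 2 * S $ k $ j * ((z $ j * F z) * cnj (G z) * of_real (exp (- 2 * phi z))))
      = 2 * (\<Sum>j\<in>UNIV. S $ k $ j * z $ j) * F z * cnj (G z) * of_real (exp (- 2 * phi z))"
    unfolding sum_distrib_left sum_distrib_right by (intro sum.cong refl) (simp add: mult_ac)
  ultimately show ?thesis
    unfolding ibp_def gradient_def by (simp only:) (simp only: algebra_simps)
qed

lemma ibp_integrable:
  assumes F: "F \<in> adj_dom phi" and G: "G \<in> adj_dom phi"
  shows "integrable lborel (ibp k F G)"
  unfolding ibp_expand[abs_def]
  by (intro Bochner_Integration.integrable_diff Bochner_Integration.integrable_sum integrable_mult_right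
      integrable_product adj_domD[OF F] adj_domD[OF G])

lemma integral_ibp:
  assumes F: "F \<in> adj_dom phi" and G: "G \<in> adj_dom phi"
  shows "(\<integral>z. ibp k F G z \<partial>lborel) = hprod phi (pderiv_at k F) G
      - (\<Sum>j\<in>UNIV. 2 * P $ k $ j * hprod phi F (\<lambda>z. z $ j * G z))
      - (\<Sum>j\<in>UNIV. 2 * S $ k $ j * hprod phi (\<lambda>z. z $ j * F z) G)"
proof -
  note I = integrable_product adj_domD[OF F] adj_domD[OF G] integrable_mult_right
    Bochner_Integration.integrable_sum
  have 1: "integrable lborel (\<lambda>z. pderiv_at k F z * cnj (G z) * of_real (exp (- 2 * phi z)))"
    by (intro I)
  have 2: "integrable lborel (\<lambda>z. 2 * P $ k $ j * (F z * cnj (z $ j * G z) * of_real (exp (- 2 * phi z))))" for j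
    by (intro I)
  have 3: "integrable lborel (\<lambda>z. 2 * S $ k $ j * ((z $ j * F z) * cnj (G z) * of_real (exp (- 2 * phi z))))" for j
    by (intro I)
  show ?thesis
    unfolding ibp_expand hprod_def integral_mult_right_zero[symmetric]
    by (subst Bochner_Integration.integral_diff Bochner_Integration.integral_sum
        | intro Bochner_Integration.integrable_diff Bochner_Integration.integrable_sum 1 2 3 refl)+
qed

text \<open>The real derivative of the integrand h in direction c e_k is c times its z_k-derivative
  plus cnj c times its derivative in the conjugate variable, and the latter is
  \<open>cnj (ibp k G F)\<close>. Its integral vanishes for every c; c = 1 and c = \<i> together
  isolate the first part.\<close>

lemma integral_ibp_eq_0:
  assumes F: "F \<in> adj_dom phi" and G: "G \<in> adj_dom phi"
  shows "(\<integral>z. ibp k F G z \<partial>lborel) = 0"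
proof -
  note eF = adj_domD(1,3)[OF F, THEN HPhi_entire] and eG = adj_domD(1,3)[OF G, THEN HPhi_entire]
  define h where "h z = F z * cnj (G z) * of_real (exp (- 2 * phi z))" for z
  define h' where "h' c z = c * ibp k F G z + cnj c * cnj (ibp k G F z)" for c z
  have cont: "continuous_on UNIV (h' c)" for c
    unfolding h'_def ibp_def gradient_def
    by (intro continuous_intros entire_continuous eF eG continuous_phi)
  have int: "integrable lborel (\<lambda>z. c * ibp k F G z)" "integrable lborel (\<lambda>z. cnj c * cnj (ibp k G F z))" for c
    using ibp_integrable[OF F G] ibp_integrable[OF G F] by (auto simp: integrable_cnj)
  have "(\<integral>z. h' c z \<partial>lborel) = 0" for c
  proof (rule integral_directional_derivative_eq_0[of "h' c" h "c *s axis k 1"])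
    show "continuous_on UNIV (h' c)"
      by (rule cont)
    show "integrable lborel h"
      unfolding h_def by (intro integrable_product adj_domD[OF F] adj_domD[OF G])
    show "integrable lborel (h' c)"
      unfolding h'_def by (intro Bochner_Integration.integrable_add int)
    fix x s
    define y where "y = x + s *\<^sub>R (c *s axis k 1)"
    have F': "((\<lambda>s. F (x + s *\<^sub>R (c *s axis k 1))) has_vector_derivative c * pderiv_at k F y) (at s)"
      unfolding y_def by (rule pderiv_at_directional[OF eF(1)])
    have G': "((\<lambda>s. cnj (G (x + s *\<^sub>R (c *s axis k 1)))) has_vector_derivative cnj (c * pderiv_at k G y)) (at s)"
      unfolding y_def
      by (rule bounded_linear.has_vector_derivative[OF bounded_linear_cnj pderiv_at_directional[OF eG(1)]])
    have "((\<lambda>s. exp (- 2 * phi (x + s *\<^sub>R (c *s axis k 1)))) has_real_derivative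
        exp (- 2 * phi y) * (- 2 * (2 * Re (c * gradient k y)))) (at s)"
      unfolding y_def by (rule DERIV_fun_exp DERIV_cmult phi_directional)+
    then have E': "((\<lambda>s. complex_of_real (exp (- 2 * phi (x + s *\<^sub>R (c *s axis k 1))))) has_vector_derivative
        complex_of_real (exp (- 2 * phi y) * (- 2 * (2 * Re (c * gradient k y))))) (at s)"
      by (intro bounded_linear.has_vector_derivative[OF bounded_linear_of_real])
         (simp add: has_real_derivative_iff_has_vector_derivative)
    have Re2: "complex_of_real (2 * Re (c * gradient k y)) = c * gradient k y + cnj c * cnj (gradient k y)"
      by (simp add: complex_eq_iff)
    show "((\<lambda>s. h (x + s *\<^sub>R (c *s axis k 1))) has_vector_derivative h' c (x + s *\<^sub>R (c *s axis k 1))) (at s)"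
      unfolding h_def y_def[symmetric]
    proof (rule has_vector_derivative_eq_rhs[OF has_vector_derivative_mult[OF has_vector_derivative_mult[OF F' G'] E']])
      show "F (x + s *\<^sub>R (c *s axis k 1)) * cnj (G (x + s *\<^sub>R (c *s axis k 1))) *
          complex_of_real (exp (- 2 * phi y) * (- 2 * (2 * Re (c * gradient k y)))) +
          (F (x + s *\<^sub>R (c *s axis k 1)) * cnj (c * pderiv_at k G y) +
            c * pderiv_at k F y * cnj (G (x + s *\<^sub>R (c *s axis k 1)))) *
          complex_of_real (exp (- 2 * phi (x + s *\<^sub>R (c *s axis k 1)))) = h' c y"
        unfolding y_def[symmetric] of_real_mult[of "exp (- 2 * phi y)"] of_real_mult[of "-2"] Re2
        unfolding h'_def ibp_def
        by (simp add: algebra_simps)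
    qed
  qed
  then have eq: "c * (\<integral>z. ibp k F G z \<partial>lborel) + cnj c * (\<integral>z. cnj (ibp k G F z) \<partial>lborel) = 0" for c
    unfolding h'_def using Bochner_Integration.integral_add[OF int(1)[of c] int(2)[of c]]
    by (simp del: Bochner_Integration.integral_cnj)
  show ?thesis
    using eq[of 1] eq[of \<i>] by (simp add: complex_eq_iff)
qed

lemma hprod_pderiv:
  assumes F: "F \<in> adj_dom phi" and G: "G \<in> adj_dom phi"
  shows "hprod phi (pderiv_at k F) G =
      (\<Sum>j\<in>UNIV. 2 * P $ k $ j * hprod phi F (\<lambda>z. z $ j * G z))
      + (\<Sum>j\<in>UNIV. 2 * S $ k $ j * hprod phi (\<lambda>z. z $ j * F z) G)"
  using integral_ibp[OF F G, of k] integral_ibp_eq_0[OF F G, of k] by (simp add: algebra_simps)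

lemma hprod_pderiv_right:
  assumes F: "F \<in> adj_dom phi" and G: "G \<in> adj_dom phi"
  shows "hprod phi F (pderiv_at k G) =
      (\<Sum>j\<in>UNIV. 2 * cnj (P $ k $ j) * hprod phi (\<lambda>z. z $ j * F z) G)
      + (\<Sum>j\<in>UNIV. 2 * cnj (S $ k $ j) * hprod phi F (\<lambda>z. z $ j * G z))"
  using arg_cong[OF hprod_pderiv[OF G F, of k], of cnj] by (simp add: hprod_cnj)

definition Lstar :: "'n \<Rightarrow> (complex^'n \<Rightarrow> complex) \<Rightarrow> complex^'n \<Rightarrow> complex" where
  "Lstar i = first_order_op (\<chi> k. M $ i $ k)
     (\<chi> k. 2 * cnj (P $ i $ k) - 2 * (\<Sum>l\<in>UNIV. M $ i $ l * S $ l $ k)) 0"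

lemma Lam_expand: "Lam Q' i F = (\<lambda>z. pderiv_at i F z + (\<Sum>j\<in>UNIV. (2 * Q' $ i $ j) * (z $ j * F z)))"
  by (simp add: Lam_def fun_eq_iff sum_distrib_left sum_distrib_right mult_ac)

text \<open>\<open>Lam Q\<close> splits as (\<partial> - 2 S z) + 2 W z. The first part has adjoint
  2 cnj P z. By \<open>MP\<close>, W = cnj M cnj P, so the second part is cnj M applied to 2 cnj P
  z, with adjoint M (\<partial> - 2 S z). Both sides are compared through the numbers
  \<open>u j\<close> and \<open>v j\<close>.\<close>

lemma hprod_Lam:
  assumes F: "F \<in> adj_dom phi" and G: "G \<in> adj_dom phi"
  shows "hprod phi (Lam Q i F) G = hprod phi F (Lstar i G)"
proof -
  define u where "u j = hprod phi (\<lambda>z. z $ j * F z) G" for j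
  define v where "v j = hprod phi F (\<lambda>z. z $ j * G z)" for j
  have 1: "hprod phi (Lam Q i F) G = hprod phi (pderiv_at i F) G + (\<Sum>j\<in>UNIV. 2 * Q $ i $ j * u j)"
    unfolding Lam_expand u_def
    by (subst hprod_add_left | subst hprod_sum_left | subst hprod_cmult_left
        | intro adj_domD[OF F] adj_domD[OF G] HPhi_sum HPhi_cmult refl)+
  have 2: "hprod phi (Lam Q i F) G = (\<Sum>j\<in>UNIV. 2 * P $ i $ j * v j) + (\<Sum>j\<in>UNIV. 2 * W $ i $ j * u j)"
    unfolding 1 hprod_pderiv[OF F G] u_def[symmetric] v_def[symmetric]
    by (simp add: algebra_simps sum.distrib sum_subtractf)
  have Ls: "Lstar i G = (\<lambda>z. (\<Sum>k\<in>UNIV. M $ i $ k * pderiv_at k G z) +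
      (\<Sum>k\<in>UNIV. (2 * cnj (P $ i $ k) - 2 * (\<Sum>l\<in>UNIV. M $ i $ l * S $ l $ k)) * (z $ k * G z)))"
    by (simp add: Lstar_def first_order_op_def fun_eq_iff mult.assoc)
  have 3: "hprod phi F (Lstar i G) = (\<Sum>k\<in>UNIV. cnj (M $ i $ k) * hprod phi F (pderiv_at k G)) +
      (\<Sum>k\<in>UNIV. cnj (2 * cnj (P $ i $ k) - 2 * (\<Sum>l\<in>UNIV. M $ i $ l * S $ l $ k)) * v k)"
    unfolding Ls v_def
    by (subst hprod_add_right | subst hprod_sum_right | subst hprod_cmult_right
        | intro adj_domD[OF F] adj_domD[OF G] HPhi_sum HPhi_cmult refl arg_cong2[of _ _ _ _ "(+)"])+
  have W: "W $ i $ j = (\<Sum>k\<in>UNIV. cnj (M $ i $ k) * cnj (P $ k $ j))" for j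
    using arg_cong[OF MP[of i j], of cnj] by simp
  have "(\<Sum>k\<in>UNIV. cnj (M $ i $ k) * hprod phi F (pderiv_at k G)) =
      (\<Sum>k\<in>UNIV. \<Sum>j\<in>UNIV. 2 * cnj (M $ i $ k) * cnj (P $ k $ j) * u j) +
      (\<Sum>k\<in>UNIV. \<Sum>j\<in>UNIV. 2 * cnj (M $ i $ k) * cnj (S $ k $ j) * v j)"
    unfolding hprod_pderiv_right[OF F G] u_def[symmetric] v_def[symmetric]
    by (simp add: algebra_simps sum.distrib sum_distrib_left)
  also have "(\<Sum>k\<in>UNIV. \<Sum>j\<in>UNIV. 2 * cnj (M $ i $ k) * cnj (P $ k $ j) * u j) = (\<Sum>j\<in>UNIV. 2 * W $ i $ j * u j)"
    by (subst sum.swap) (simp add: W sum_distrib_left sum_distrib_right mult_ac)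
  also have "(\<Sum>k\<in>UNIV. \<Sum>j\<in>UNIV. 2 * cnj (M $ i $ k) * cnj (S $ k $ j) * v j)
      = (\<Sum>j\<in>UNIV. 2 * cnj (\<Sum>l\<in>UNIV. M $ i $ l * S $ l $ j) * v j)"
    by (subst sum.swap) (simp add: sum_distrib_left sum_distrib_right mult_ac)
  finally show ?thesis
    unfolding 2 3 by (simp add: algebra_simps sum_subtractf sum.distrib)
qed

end

section \<open>Hermite polynomials\<close>

context hermite
begin

text \<open>Since P is Hermitian, \<open>MW\<close> gives P = transpose (M W) + rho^2, so M P = M W
  (transpose M) + rho^2 M by symmetry of W. The left side is cnj W and the first summand on the
  right is symmetric, so rho^2 M is symmetric. This symmetry is what makes the raising operators
  commute.\<close>

lemma M_sym: "M $ i $ j = M $ j $ i"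
proof -
  have eq: "(\<Sum>k\<in>UNIV. M $ i $ k * P $ k $ j) =
      (\<Sum>k\<in>UNIV. \<Sum>l\<in>UNIV. M $ i $ k * M $ j $ l * W $ l $ k) + of_real (rho\<^sup>2) * M $ i $ j" for i j
  proof -
    have "P $ k $ j = (\<Sum>l\<in>UNIV. M $ j $ l * W $ l $ k) + (if j = k then of_real (rho\<^sup>2) else 0)" for k
      using MW[of j k] P_herm[of j k] by simp
    then have "M $ i $ k * P $ k $ j = (\<Sum>l\<in>UNIV. M $ i $ k * M $ j $ l * W $ l $ k)
        + (if j = k then of_real (rho\<^sup>2) * M $ i $ k else 0)" for k
      by (simp add: distrib_left sum_distrib_left mult.assoc)
    then show ?thesis
      by (simp add: sum.distrib)
  qed
  have "(\<Sum>k\<in>UNIV. \<Sum>l\<in>UNIV. M $ i $ k * M $ j $ l * W $ l $ k) =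
      (\<Sum>k\<in>UNIV. \<Sum>l\<in>UNIV. M $ j $ k * M $ i $ l * W $ l $ k)"
    by (subst sum.swap) (simp add: W_sym mult_ac)
  then have "of_real (rho\<^sup>2) * M $ i $ j = of_real (rho\<^sup>2) * M $ j $ i"
    using eq[of i j] eq[of j i] MP[of i j] MP[of j i] W_sym[of i j] by simp
  then show ?thesis
    using rho_pos by simp
qed

abbreviation ground :: "complex^'n \<Rightarrow> complex" where "ground \<equiv> psi0 Q"

lemma Q_sym: "Q $ i $ j = Q $ j $ i"
  using W_sym[of i j] S_sym[of i j] by simp

lemma entire_ground: "entire ground"
  using entire_exp[OF entire_cmult[OF cpoly_entire[OF quad_cpoly], of "-1"]] by (simp add: psi0_eq)

lemma pderiv_ground: "pderiv_at k ground z = - 2 * (\<Sum>j\<in>UNIV. Q $ k $ j * z $ j) * ground z"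
proof -
  have "pderiv_at k (\<lambda>z. exp ((- 1) * quad Q z)) z = (- 1) * (2 * (\<Sum>j\<in>UNIV. Q $ k $ j * z $ j)) * exp ((- 1) * quad Q z)"
    by (subst pderiv_at_exp, intro entire_cmult cpoly_entire[OF quad_cpoly],
        subst pderiv_at_cmult, intro cpoly_entire[OF quad_cpoly], subst pderiv_at_quad[OF Q_sym]) simp
  then show ?thesis
    unfolding psi0_eq by simp
qed

lemma pderiv_state:
  assumes "cpoly p"
  shows "pderiv_at k (\<lambda>z. p z * ground z) =
    (\<lambda>z. (pderiv_at k p z - 2 * (\<Sum>j\<in>UNIV. Q $ k $ j * z $ j) * p z) * ground z)"
  by (simp add: fun_eq_iff pderiv_at_mult cpoly_entire[OF assms] entire_ground pderiv_ground algebra_simps)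

section \<open>Gaussian majorants and square integrability\<close>

definition expo :: "complex^'n \<Rightarrow> complex^'n \<Rightarrow> complex" where
  "expo b z = quad W z + (\<Sum>j\<in>UNIV. b $ j * z $ j)"

lemma expo_cpoly: "cpoly (expo b)"
  unfolding expo_def[abs_def] by (intro cpoly_intros quad_cpoly)

text \<open>The S-part of the weight cancels against the S-part of Q, so integrability is decided by
  W against P alone.\<close>

lemma ground_weight: "(cmod (ground z))\<^sup>2 * exp (- 2 * phi z) = exp (- 2 * Re (quad W z) - 2 * Re (herm P z))"
proof -
  have "(cmod (ground z))\<^sup>2 = exp (- 2 * Re (quad Q z))"
    by (simp add: psi0_eq norm_exp_eq_Re exp_double[symmetric])
  then show ?thesis
    by (simp add: phi_def exp_add[symmetric] quad_diff algebra_simps)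
qed

lemma linear_form_bound:
  "cmod (\<Sum>j\<in>UNIV. b $ j * z $ j) \<le> (\<Sum>j\<in>UNIV. cmod (b $ j)) * norm (z :: complex^'n)"
proof -
  have "cmod (\<Sum>j\<in>UNIV. b $ j * z $ j) \<le> (\<Sum>j\<in>UNIV. cmod (b $ j) * norm z)"
    by (rule sum_norm_le) (simp add: norm_mult mult_left_mono Finite_Cartesian_Product.norm_nth_le)
  then show ?thesis
    by (simp add: sum_distrib_right)
qed

text \<open>Let H be the Hermitian form at z. Moving along t only lowers the W-term of
  \<open>ground\<close> to (1 - t) times its size, at most kap H, while the factor with s costs s
  kap H. The decay left over is (1 - kap (1 + s)) H for every t in [0, 1], so the admissible step s
  is the same at all t.\<close>

lemma gaussian_majorant:
  assumes t: "0 \<le> t" "t \<le> 1" and s: "0 \<le> s"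
    and b: "bn = (\<Sum>j\<in>UNIV. cmod (b $ j))" and k: "kap * (1 + s) < 1"
  shows "(cmod (exp (of_real t * expo b z) * ground z))\<^sup>2 * exp (2 * s * cmod (expo b z)) * exp (- 2 * phi z)
    \<le> exp (2 * (t + s) * bn * norm z - 2 * (1 - kap * (1 + s)) * m0 * (norm z)\<^sup>2)"
proof -
  define l where "l = (\<Sum>j\<in>UNIV. b $ j * z $ j)"
  define H where "H = Re (herm P z)"
  have l: "cmod l \<le> bn * norm z"
    unfolding l_def b by (rule linear_form_bound)
  have W: "cmod (quad W z) \<le> kap * H"
    unfolding H_def by (rule W_bound)
  have H: "m0 * (norm z)\<^sup>2 \<le> H"
    unfolding H_def by (rule coercive)
  have H0: "0 \<le> H"
    using H m0_pos by (meson order_trans mult_nonneg_nonneg less_imp_le zero_le_power2)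
  have "(cmod (exp (of_real t * expo b z) * ground z))\<^sup>2 * exp (2 * s * cmod (expo b z)) * exp (- 2 * phi z)
    = exp (2 * (t * Re (expo b z))) * exp (2 * s * cmod (expo b z)) * ((cmod (ground z))\<^sup>2 * exp (- 2 * phi z))"
    by (simp add: norm_mult power_mult_distrib norm_exp_eq_Re exp_double)
  also have "\<dots> = exp (2 * (t * Re (expo b z)) + 2 * s * cmod (expo b z) - 2 * Re (quad W z) - 2 * H)"
    unfolding ground_weight H_def by (simp add: exp_add[symmetric] algebra_simps)
  also have "\<dots> \<le> exp (2 * (t + s) * bn * norm z - 2 * (1 - kap * (1 + s)) * m0 * (norm z)\<^sup>2)"
  proof (subst exp_le_cancel_iff)
    have 1: "Re (expo b z) = Re (quad W z) + Re l"
      by (simp add: expo_def l_def)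
    have 2: "cmod (expo b z) \<le> kap * H + bn * norm z"
      using norm_triangle_ineq[of "quad W z" l] l W by (simp add: expo_def l_def)
    have 3: "t * Re l \<le> t * (bn * norm z)"
      using l complex_Re_le_cmod[of l] t by (intro mult_left_mono) auto
    have 4: "(1 - t) * (- Re (quad W z)) \<le> 1 * (kap * H)"
    proof -
      have "(1 - t) * (- Re (quad W z)) \<le> (1 - t) * (kap * H)"
        using W abs_Re_le_cmod[of "quad W z"] t by (intro mult_left_mono) auto
      also have "\<dots> \<le> 1 * (kap * H)"
        using t kap H0 by (intro mult_right_mono) auto
      finally show ?thesis .
    qed
    have 5: "s * cmod (expo b z) \<le> s * (kap * H + bn * norm z)"
      using 2 s by (rule mult_left_mono)
    have 6: "(1 - kap * (1 + s)) * (m0 * (norm z)\<^sup>2) \<le> (1 - kap * (1 + s)) * H"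
      using H k by (intro mult_left_mono) auto
    have 7: "t * Re (expo b z) - Re (quad W z) = t * Re l + (1 - t) * (- Re (quad W z))"
      unfolding 1 by (simp add: algebra_simps)
    have "t * Re (expo b z) + s * cmod (expo b z) - Re (quad W z) - H
        \<le> t * (bn * norm z) + kap * H + s * (kap * H + bn * norm z) - H"
      using 3 4 5 7 by linarith
    also have "\<dots> = (t + s) * bn * norm z - (1 - kap * (1 + s)) * H"
      by (simp add: algebra_simps)
    also have "\<dots> \<le> (t + s) * bn * norm z - (1 - kap * (1 + s)) * (m0 * (norm z)\<^sup>2)"
      using 6 by simp
    finally show "2 * (t * Re (expo b z)) + 2 * s * cmod (expo b z) - 2 * Re (quad W z) - 2 * H
        \<le> 2 * (t + s) * bn * norm z - 2 * (1 - kap * (1 + s)) * m0 * (norm z)\<^sup>2"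
      by (simp add: algebra_simps)
  qed
  finally show ?thesis .
qed

lemma state_majorant:
  assumes p: "cpoly p" and s: "0 \<le> s" "kap * (1 + s) < 1"
  obtains C a e where "0 < e" "\<And>t z. 0 \<le> t \<Longrightarrow> t \<le> 1 \<Longrightarrow>
    (cmod (p z * exp (of_real t * expo b z) * ground z))\<^sup>2 * exp (2 * s * cmod (expo b z)) * exp (- 2 * phi z)
      \<le> C * exp (a * norm z - e * (norm z)\<^sup>2)"
proof -
  obtain C a where C: "0 \<le> C" "0 \<le> a" "\<And>z. cmod (p z) \<le> C * exp (a * norm z)"
    using cpoly_bound[OF p] by blast
  define bn where "bn = (\<Sum>j\<in>UNIV. cmod (b $ j))"
  have bn: "0 \<le> bn"
    unfolding bn_def by (intro sum_nonneg) auto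
  define e where "e = 2 * (1 - kap * (1 + s)) * m0"
  show ?thesis
  proof (rule that)
    show "0 < e"
      using s m0_pos by (simp add: e_def)
    fix t :: real and z assume t: "0 \<le> t" "t \<le> 1"
    have "(cmod (p z * exp (of_real t * expo b z) * ground z))\<^sup>2 * exp (2 * s * cmod (expo b z)) * exp (- 2 * phi z)
      = (cmod (p z))\<^sup>2 * ((cmod (exp (of_real t * expo b z) * ground z))\<^sup>2 * exp (2 * s * cmod (expo b z)) * exp (- 2 * phi z))"
      by (simp add: norm_mult power_mult_distrib)
    also have "\<dots> \<le> (C * exp (a * norm z))\<^sup>2 * exp (2 * (t + s) * bn * norm z - 2 * (1 - kap * (1 + s)) * m0 * (norm z)\<^sup>2)"
      using C by (intro mult_mono power_mono gaussian_majorant t s bn_def) auto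
    also have "\<dots> = C\<^sup>2 * exp (2 * a * norm z + 2 * (t + s) * bn * norm z - e * (norm z)\<^sup>2)"
      by (simp add: power_mult_distrib exp_double[symmetric] e_def exp_add[symmetric] algebra_simps)
    also have "\<dots> \<le> C\<^sup>2 * exp ((2 * a + 2 * (1 + s) * bn) * norm z - e * (norm z)\<^sup>2)"
    proof -
      have "(t + s) * (bn * norm z) \<le> (1 + s) * (bn * norm z)"
        using t bn by (intro mult_right_mono) auto
      then show ?thesis
        by (intro mult_left_mono) (auto simp: algebra_simps)
    qed
    finally show "(cmod (p z * exp (of_real t * expo b z) * ground z))\<^sup>2 * exp (2 * s * cmod (expo b z)) * exp (- 2 * phi z)
      \<le> C\<^sup>2 * exp ((2 * a + 2 * (1 + s) * bn) * norm z - e * (norm z)\<^sup>2)" .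
  qed
qed

lemma exp_state_HPhi:
  assumes p: "cpoly p" and t: "0 \<le> t" "t \<le> 1"
  shows "(\<lambda>z. p z * exp (of_real t * expo b z) * ground z) \<in> HPhi phi"
proof -
  have ent: "entire (\<lambda>z. p z * exp (of_real t * expo b z) * ground z)"
    by (intro entire_mult entire_exp entire_cmult cpoly_entire expo_cpoly p entire_ground)
  have [measurable]: "(\<lambda>z. p z * exp (of_real t * expo b z) * ground z) \<in> borel_measurable borel"
    by (rule entire_measurable[OF ent])
  obtain C a e where b: "0 < e"
    "\<And>t z. 0 \<le> t \<Longrightarrow> t \<le> 1 \<Longrightarrow>
    (cmod (p z * exp (of_real t * expo b z) * ground z))\<^sup>2 * exp (2 * 0 * cmod (expo b z)) * exp (- 2 * phi z)
      \<le> C * exp (a * norm z - e * (norm z)\<^sup>2)"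
    by (rule state_majorant[OF p, of 0 b]) (simp, use kap in simp, rule that, assumption, blast)
  have "integrable lborel (\<lambda>z. (cmod (p z * exp (of_real t * expo b z) * ground z))\<^sup>2 * exp (- 2 * phi z))"
    by (rule integrable_gaussian_bound[OF b(1), of _ C a]) (measurable, use b(2)[OF t] in simp)
  with ent show ?thesis
    by (simp add: HPhi_def)
qed

lemma state_HPhi:
  assumes "cpoly p"
  shows "(\<lambda>z. p z * ground z) \<in> HPhi phi"
  using exp_state_HPhi[OF assms, of 0] by simp

lemma state_adj_dom:
  assumes "cpoly p"
  shows "(\<lambda>z. p z * ground z) \<in> adj_dom phi"
proof -
  have "(\<lambda>z. z $ k * (p z * ground z)) \<in> HPhi phi" for k
    using state_HPhi[of "\<lambda>z. z $ k * p z"] assms by (simp add: cpoly_intros mult.assoc)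
  moreover have "pderiv_at k (\<lambda>z. p z * ground z) \<in> HPhi phi" for k
    unfolding pderiv_state[OF assms] by (intro state_HPhi cpoly_intros cpoly_pderiv assms)
  ultimately show ?thesis
    using state_HPhi[OF assms] by (simp add: adj_dom_def)
qed

lemma Lam_state:
  assumes "cpoly p"
  shows "Lam Q i (\<lambda>z. p z * ground z) = (\<lambda>z. pderiv_at i p z * ground z)"
  unfolding Lam_def pderiv_state[OF assms] by (simp add: fun_eq_iff algebra_simps)

section \<open>Raising operators on polynomials\<close>

definition raise :: "'n \<Rightarrow> (complex^'n \<Rightarrow> complex) \<Rightarrow> complex^'n \<Rightarrow> complex" where
  "raise i p z = 2 * of_real (rho\<^sup>2) * z $ i * p z + (\<Sum>k\<in>UNIV. M $ i $ k * pderiv_at k p z)"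

lemma raise_cpoly: "cpoly p \<Longrightarrow> cpoly (raise i p)"
  unfolding raise_def[abs_def] by (intro cpoly_intros cpoly_pderiv)

lemma Lstar_state:
  assumes "cpoly p"
  shows "Lstar i (\<lambda>z. p z * ground z) = (\<lambda>z. raise i p z * ground z)"
proof
  fix z
  define q where "q j = z $ j * p z * ground z" for j
  have 1: "(\<Sum>k\<in>UNIV. M $ i $ k * ((pderiv_at k p z - 2 * (\<Sum>j\<in>UNIV. Q $ k $ j * z $ j) * p z) * ground z))
     = (\<Sum>k\<in>UNIV. M $ i $ k * pderiv_at k p z) * ground z
       - (\<Sum>k\<in>UNIV. \<Sum>j\<in>UNIV. 2 * (M $ i $ k * Q $ k $ j) * q j)"
    by (simp add: q_def sum_distrib_left sum_distrib_right sum_subtractf[symmetric] algebra_simps)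
  \<comment> \<open>M Q = M W - M S by the definition of Q. Against the multiplication part of
    \<open>Lstar\<close> the terms in cnj P and M S cancel and only the diagonal rho^2
    survives.\<close>
  have MQ: "(\<Sum>k\<in>UNIV. M $ i $ k * Q $ k $ j)
      = cnj (P $ i $ j) - (if i = j then of_real (rho\<^sup>2) else 0) - (\<Sum>l\<in>UNIV. M $ i $ l * S $ l $ j)" for j
    using MW[of i j] by (simp add: algebra_simps sum_subtractf)
  have 2: "(\<Sum>k\<in>UNIV. \<Sum>j\<in>UNIV. 2 * (M $ i $ k * Q $ k $ j) * q j) =
     (\<Sum>j\<in>UNIV. 2 * (cnj (P $ i $ j) - (if i = j then of_real (rho\<^sup>2) else 0) - (\<Sum>l\<in>UNIV. M $ i $ l * S $ l $ j)) * q j)"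
    unfolding MQ[symmetric] by (subst sum.swap) (simp add: sum_distrib_left sum_distrib_right)
  have 3: "\<dots> = (\<Sum>j\<in>UNIV. (2 * cnj (P $ i $ j) - 2 * (\<Sum>l\<in>UNIV. M $ i $ l * S $ l $ j)) * q j)
      - (\<Sum>j\<in>UNIV. if i = j then 2 * of_real (rho\<^sup>2) * q j else 0)"
    unfolding sum_subtractf[symmetric] by (intro sum.cong refl) (simp add: algebra_simps)
  have 4: "(\<Sum>j\<in>UNIV. if i = j then 2 * of_real (rho\<^sup>2) * q j else 0) = 2 * of_real (rho\<^sup>2) * q i"
    by simp
  show "Lstar i (\<lambda>z. p z * ground z) z = raise i p z * ground z"
    unfolding Lstar_def first_order_op_def pderiv_state[OF assms] vec_lambda_beta 1 2 3 4 raise_def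
    by (simp add: q_def algebra_simps)
qed

text \<open>The canonical commutation relation: only the factor z_i fails to commute with the
  derivative.\<close>

lemma pderiv_raise:
  assumes "cpoly p"
  shows "pderiv_at j (raise i p) z = raise i (pderiv_at j p) z + (if i = j then 2 * of_real (rho\<^sup>2) * p z else 0)"
proof -
  have ent: "entire p" "\<And>k. entire (pderiv_at k p)" "\<And>c i. entire (\<lambda>z. c * z $ i)"
    by (auto intro!: cpoly_entire cpoly_pderiv assms cpoly_intros)
  have 1: "pderiv_at j (\<lambda>z. 2 * of_real (rho\<^sup>2) * z $ i * p z) z
      = 2 * of_real (rho\<^sup>2) * z $ i * pderiv_at j p z + (if i = j then 2 * of_real (rho\<^sup>2) * p z else 0)"
    by (subst pderiv_at_mult[OF ent(3) ent(1)])
       (simp add: pderiv_at_cmult[OF entire_coord] pderiv_at_coord)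
  have 2: "pderiv_at j (\<lambda>z. \<Sum>k\<in>UNIV. M $ i $ k * pderiv_at k p z) z = (\<Sum>k\<in>UNIV. M $ i $ k * pderiv_at k (pderiv_at j p) z)"
    by (subst pderiv_at_sum)
       (auto intro!: entire_cmult ent simp: pderiv_at_cmult[OF ent(2)] cpoly_pderiv_commute[OF assms, of j])
  have "pderiv_at j (raise i p) z = pderiv_at j (\<lambda>z. 2 * of_real (rho\<^sup>2) * z $ i * p z) z
      + pderiv_at j (\<lambda>z. \<Sum>k\<in>UNIV. M $ i $ k * pderiv_at k p z) z"
    unfolding raise_def[abs_def]
    by (intro pderiv_at_add entire_mult[OF ent(3) ent(1)] entire_sum entire_cmult ent)
  then show ?thesis
    unfolding 1 2 by (simp add: raise_def)
qed

lemma raise_add: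
  "cpoly p \<Longrightarrow> cpoly q \<Longrightarrow> raise i (\<lambda>z. p z + q z) = (\<lambda>z. raise i p z + raise i q z)"
  by (simp add: fun_eq_iff raise_def pderiv_at_add cpoly_entire algebra_simps sum.distrib)

lemma raise_cmult:
  "cpoly p \<Longrightarrow> raise i (\<lambda>z. c * p z) = (\<lambda>z. c * raise i p z)"
  by (simp add: fun_eq_iff raise_def pderiv_at_cmult cpoly_entire algebra_simps sum_distrib_left)

lemma raise_zero: "raise i (\<lambda>z. 0) = (\<lambda>z. 0)"
  by (simp add: fun_eq_iff raise_def pderiv_at_const)

text \<open>Expanding both orders, everything is symmetric in i and j except the term 2 rho^2 M_ij p
  produced by differentiating the coordinate factor; \<open>M_sym\<close> removes the
  discrepancy.\<close>

lemma raise_commute: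
  assumes "cpoly p"
  shows "raise i (raise j p) = raise j (raise i p)"
proof
  fix z
  have "raise i (raise j p) z = 2 * of_real (rho\<^sup>2) * z $ i * raise j p z
      + (\<Sum>k\<in>UNIV. M $ i $ k * raise j (pderiv_at k p) z) + 2 * of_real (rho\<^sup>2) * M $ i $ j * p z" for i j
  proof -
    have "(\<Sum>k\<in>UNIV. M $ i $ k * (if j = k then 2 * of_real (rho\<^sup>2) * p z else 0)) = 2 * of_real (rho\<^sup>2) * M $ i $ j * p z"
      by (simp add: if_distrib cong: if_cong)
    then show ?thesis
      unfolding raise_def[of i "raise j p"] pderiv_raise[OF assms]
      by (simp add: distrib_left sum.distrib)
  qed
  note expand = this
  have "(\<Sum>k\<in>UNIV. M $ i $ k * raise j (pderiv_at k p) z) =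
      2 * of_real (rho\<^sup>2) * z $ j * (\<Sum>k\<in>UNIV. M $ i $ k * pderiv_at k p z)
      + (\<Sum>k\<in>UNIV. \<Sum>l\<in>UNIV. M $ i $ k * M $ j $ l * pderiv_at l (pderiv_at k p) z)" for i j
    by (simp add: raise_def distrib_left sum.distrib sum_distrib_left mult_ac)
  note expand2 = this
  have "(\<Sum>k\<in>UNIV. \<Sum>l\<in>UNIV. M $ i $ k * M $ j $ l * pderiv_at l (pderiv_at k p) z) =
      (\<Sum>k\<in>UNIV. \<Sum>l\<in>UNIV. M $ j $ k * M $ i $ l * pderiv_at l (pderiv_at k p) z)"
    by (subst sum.swap, intro sum.cong refl, subst cpoly_pderiv_commute[OF assms]) (simp add: mult_ac)
  then show "raise i (raise j p) z = raise j (raise i p) z"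
    unfolding expand expand2 M_sym[of i j] by (simp add: raise_def algebra_simps)
qed

lemma funpow_raise_cpoly: "cpoly p \<Longrightarrow> cpoly ((raise i ^^ n) p)"
  by (induction n) (auto intro: raise_cpoly)

lemma raise_funpow_commute: "cpoly p \<Longrightarrow> raise i ((raise j ^^ n) p) = (raise j ^^ n) (raise i p)"
  by (induction n) (auto simp: raise_commute[of _ i j] funpow_raise_cpoly)

lemma funpow_raise_cmult: "cpoly p \<Longrightarrow> (raise i ^^ n) (\<lambda>z. c * p z) = (\<lambda>z. c * (raise i ^^ n) p z)"
  by (induction n) (auto simp: raise_cmult funpow_raise_cpoly)

lemma pderiv_funpow_raise:
  assumes "cpoly p"
  shows "pderiv_at j ((raise i ^^ n) p) =
    (\<lambda>z. (raise i ^^ n) (pderiv_at j p) z +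
      (if i = j then 2 * of_real (rho\<^sup>2) * of_nat n * (raise i ^^ (n - 1)) p z else 0))"
proof (induction n)
  case 0
  show ?case by auto
next
  case (Suc n)
  define r where "r = (raise i ^^ (n - 1)) p"
  have r: "cpoly r"
    unfolding r_def by (rule funpow_raise_cpoly[OF assms])
  \<comment> \<open>For n = 0 the truncated n - 1 leaves r = p, but both sides vanish through the
    factor \<open>of_nat n\<close>.\<close>
  have rr: "2 * of_real (rho\<^sup>2) * of_nat n * raise i r z = 2 * of_real (rho\<^sup>2) * of_nat n * (raise i ^^ n) p z" for z
    by (cases n) (auto simp: r_def)
  have step: "raise i (pderiv_at j ((raise i ^^ n) p)) z = (raise i ^^ Suc n) (pderiv_at j p) z +
      (if i = j then 2 * of_real (rho\<^sup>2) * of_nat n * (raise i ^^ n) p z else 0)" for z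
  proof (cases "i = j")
    case True
    have "raise i (\<lambda>z. (raise i ^^ n) (pderiv_at j p) z + 2 * of_real (rho\<^sup>2) * of_nat n * r z) z
      = (raise i ^^ Suc n) (pderiv_at j p) z + 2 * of_real (rho\<^sup>2) * of_nat n * raise i r z"
      by (subst raise_add) (auto intro: funpow_raise_cpoly cpoly_pderiv assms cpoly_cmult r simp: raise_cmult r)
    then show ?thesis
      using True rr[of z] unfolding Suc.IH by (simp add: r_def)
  next
    case False
    then show ?thesis
      unfolding Suc.IH by simp
  qed
  have "pderiv_at j ((raise i ^^ Suc n) p) z =
    raise i (pderiv_at j ((raise i ^^ n) p)) z + (if i = j then 2 * of_real (rho\<^sup>2) * (raise i ^^ n) p z else 0)" for z
    using pderiv_raise[OF funpow_raise_cpoly[OF assms], of j i n i z] by simp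
  then show ?case
    unfolding step by (auto simp: fun_eq_iff algebra_simps)
qed

text \<open>The polynomial factor of \<open>psi_tilde\<close>. The list of indices is a parameter so
  that proofs can induct over it; the sorted list of all indices is put in only at the end.\<close>

definition hpoly :: "'n list \<Rightarrow> ('n \<Rightarrow> nat) \<Rightarrow> complex^'n \<Rightarrow> complex" where
  "hpoly xs \<alpha> = foldr (\<lambda>i p. (raise i ^^ \<alpha> i) p) xs (\<lambda>z. 1)"

lemma hpoly_simps:
  "hpoly [] \<alpha> = (\<lambda>z. 1)" "hpoly (x # xs) \<alpha> = (raise x ^^ \<alpha> x) (hpoly xs \<alpha>)"
  by (simp_all add: hpoly_def)

lemma hpoly_cpoly: "cpoly (hpoly xs \<alpha>)"
  by (induction xs) (auto simp: hpoly_simps intro: cpoly.const funpow_raise_cpoly)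

lemma hpoly_upd_notin: "i \<notin> set xs \<Longrightarrow> hpoly xs (\<alpha>(i := n)) = hpoly xs \<alpha>"
  by (induction xs) (auto simp: hpoly_simps)

text \<open>The operators commute, so an additional factor can be moved inward until it meets the
  power with its own index.\<close>

lemma raise_hpoly:
  "distinct xs \<Longrightarrow> i \<in> set xs \<Longrightarrow> raise i (hpoly xs \<alpha>) = hpoly xs (\<alpha>(i := Suc (\<alpha> i)))"
proof (induction xs)
  case (Cons y ys)
  show ?case
  proof (cases "i = y")
    case True
    with Cons.prems show ?thesis
      by (simp add: hpoly_simps hpoly_upd_notin fun_upd_same del: fun_upd_apply)
  next
    case False
    with Cons show ?thesis
      by (simp add: hpoly_simps raise_funpow_commute hpoly_cpoly)
  qed
qed simp

lemma pderiv_hpoly_notin: "i \<notin> set xs \<Longrightarrow> pderiv_at i (hpoly xs \<alpha>) = (\<lambda>z. 0)"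
proof (induction xs)
  case Nil
  show ?case by (simp add: hpoly_simps fun_eq_iff pderiv_at_const)
next
  case (Cons y ys)
  have "(raise y ^^ n) (\<lambda>z. 0) = (\<lambda>z. 0)" for n
    by (induction n) (auto simp: raise_zero)
  with Cons show ?case
    by (auto simp: hpoly_simps pderiv_funpow_raise hpoly_cpoly)
qed

text \<open>Differentiation lowers one exponent, because it commutes with the other raising
  operators and annihilates the constant 1. The truncated subtraction at exponent 0 is harmless, as
  the coefficient is then 0.\<close>

lemma pderiv_hpoly:
  "distinct xs \<Longrightarrow> i \<in> set xs \<Longrightarrow>
    pderiv_at i (hpoly xs \<alpha>) = (\<lambda>z. 2 * of_real (rho\<^sup>2) * of_nat (\<alpha> i) * hpoly xs (\<alpha>(i := \<alpha> i - 1)) z)"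
proof (induction xs)
  case (Cons y ys)
  have zero: "(raise y ^^ n) (\<lambda>z. 0) = (\<lambda>z. 0)" for n
    by (induction n) (auto simp: raise_zero)
  show ?case
  proof (cases "i = y")
    case True
    with Cons.prems show ?thesis
      by (simp add: hpoly_simps hpoly_upd_notin pderiv_funpow_raise hpoly_cpoly pderiv_hpoly_notin zero
          fun_upd_same del: fun_upd_apply)
  next
    case False
    with Cons show ?thesis
      by (simp add: hpoly_simps pderiv_funpow_raise hpoly_cpoly funpow_raise_cmult)
  qed
qed simp

end

section \<open>Orthonormality and span\<close>

context hermite
begin

section \<open>Identification of the adjoint operator\<close>

lemma ground_nonzero: "ground z \<noteq> 0"
  by (simp add: psi0_eq)

text \<open>The operator \<open>first_order_op a b c\<close> conjugated by multiplication with
  \<open>ground\<close>, so that it acts on polynomials.\<close>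

definition symbol :: "complex^'n \<Rightarrow> complex^'n \<Rightarrow> complex \<Rightarrow> (complex^'n \<Rightarrow> complex) \<Rightarrow> complex^'n \<Rightarrow> complex" where
  "symbol a b c p z = (\<Sum>k\<in>UNIV. a $ k * (pderiv_at k p z - 2 * (\<Sum>j\<in>UNIV. Q $ k $ j * z $ j) * p z))
     + (\<Sum>k\<in>UNIV. b $ k * z $ k * p z) + c * p z"

lemma symbol_cpoly: "cpoly p \<Longrightarrow> cpoly (symbol a b c p)"
  unfolding symbol_def[abs_def] by (intro cpoly_intros cpoly_pderiv)

lemma first_order_op_state:
  assumes "cpoly p"
  shows "first_order_op a b c (\<lambda>z. p z * ground z) = (\<lambda>z. symbol a b c p z * ground z)"
  by (simp add: fun_eq_iff first_order_op_def pderiv_state[OF assms] symbol_def algebra_simps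
      sum_distrib_left sum_distrib_right)

text \<open>The commutator with multiplication by z_j is the constant a_j, which makes the
  coefficients of the derivatives readable from the action.\<close>

lemma symbol_mult_coord:
  assumes "cpoly p"
  shows "symbol a b c (\<lambda>z. z $ j * p z) z = z $ j * symbol a b c p z + a $ j * p z"
proof -
  have "pderiv_at k (\<lambda>z. z $ j * p z) z = z $ j * pderiv_at k p z + (if j = k then p z else 0)" for k
    by (simp add: pderiv_at_mult entire_coord cpoly_entire[OF assms] pderiv_at_coord)
  then have "symbol a b c (\<lambda>z. z $ j * p z) z =
     (\<Sum>k\<in>UNIV. z $ j * (a $ k * (pderiv_at k p z - 2 * (\<Sum>j\<in>UNIV. Q $ k $ j * z $ j) * p z))
        + (if j = k then a $ k * p z else 0))
     + (\<Sum>k\<in>UNIV. z $ j * (b $ k * z $ k * p z)) + z $ j * (c * p z)"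
    unfolding symbol_def by (intro arg_cong2[of _ _ _ _ "(+)"] sum.cong refl) (simp_all add: algebra_simps)
  also have "\<dots> = z $ j * symbol a b c p z + a $ j * p z"
    unfolding symbol_def by (simp add: sum.distrib sum_distrib_left distrib_left)
  finally show ?thesis .
qed

lemma symbol_eqD:
  assumes eq: "\<And>p z. cpoly p \<Longrightarrow> symbol a b c p z = symbol a' b' c' p z"
  shows "a = a' \<and> b = b' \<and> c = c'"
proof (intro conjI)
  have one: "cpoly (\<lambda>z::complex^'n. 1)"
    by (rule cpoly.const)
  \<comment> \<open>The factor 1 is kept so that \<open>symbol_mult_coord\<close> applies; at z = 0
    it then returns a_j.\<close>
  have coord: "cpoly (\<lambda>z::complex^'n. z $ j * 1)" for j
    by (intro cpoly_intros)
  have "a $ j = a' $ j" for j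
    using eq[OF coord, of j 0] unfolding symbol_mult_coord[OF one] by simp
  then show a: "a = a'"
    by (simp add: vec_eq_iff)
  have lin: "(\<Sum>k\<in>UNIV. b $ k * z $ k) + c = (\<Sum>k\<in>UNIV. b' $ k * z $ k) + c'" for z
    using eq[OF one, of z] by (simp add: symbol_def a)
  show c: "c = c'"
    using lin[of 0] by simp
  have "(\<Sum>k\<in>UNIV. b $ k * axis j 1 $ k) = b $ j" for b :: "complex^'n" and j
    by (simp add: axis_def if_distrib cong: if_cong)
  then have "b $ j = b' $ j" for j
    using lin[of "axis j 1"] c by simp
  then show "b = b'"
    by (simp add: vec_eq_iff)
qed

text \<open>For two candidates and a polynomial state G, the difference of the two images is again a
  polynomial state F and hence an admissible test function. Testing against it gives norm 0, so the
  candidates agree on all polynomial states, and \<open>symbol_eqD\<close> recovers equal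
  coefficients.\<close>

lemma adjoint_op_Lam: "adjoint_op phi (Lam Q i) = Lstar i"
  unfolding adjoint_op_def
proof (rule the_equality)
  show "(\<exists>a b c. Lstar i = first_order_op a b c) \<and>
      (\<forall>F\<in>adj_dom phi. \<forall>G\<in>adj_dom phi. hprod phi (Lam Q i F) G = hprod phi F (Lstar i G))"
    unfolding Lstar_def using hprod_Lam[of _ _ i, unfolded Lstar_def] by blast
next
  fix T assume T: "(\<exists>a b c. T = first_order_op a b c) \<and>
      (\<forall>F\<in>adj_dom phi. \<forall>G\<in>adj_dom phi. hprod phi (Lam Q i F) G = hprod phi F (T G))"
  then obtain a b c where Tabc: "T = first_order_op a b c"
    by blast
  obtain a' b' c' where Labc: "Lstar i = first_order_op a' b' c'"
    unfolding Lstar_def by blast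
  have "symbol a b c p z = symbol a' b' c' p z" if p: "cpoly p" for p z
  proof -
    define G where "G z = p z * ground z" for z
    define r where "r z = symbol a b c p z - symbol a' b' c' p z" for z
    define F where "F z = r z * ground z" for z
    have r: "cpoly r"
      unfolding r_def[abs_def] by (intro cpoly_diff symbol_cpoly p)
    have G: "G \<in> adj_dom phi" and F: "F \<in> adj_dom phi"
      unfolding G_def[abs_def] F_def[abs_def] by (intro state_adj_dom p r)+
    have TG: "T G = (\<lambda>z. symbol a b c p z * ground z)"
      and LG: "Lstar i G = (\<lambda>z. symbol a' b' c' p z * ground z)"
      unfolding Tabc Labc G_def[abs_def] by (intro first_order_op_state p)+
    have TGH: "T G \<in> HPhi phi" "Lstar i G \<in> HPhi phi"
      unfolding TG LG by (intro state_HPhi symbol_cpoly p)+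
    have F': "(\<lambda>z. T G z - Lstar i G z) = F"
      by (simp add: TG LG F_def r_def fun_eq_iff algebra_simps)
    have "hprod phi F (T G) = hprod phi F (Lstar i G)"
    proof -
      have "hprod phi (Lam Q i F) G = hprod phi F (T G)"
        using T F G by blast
      then show ?thesis
        using hprod_Lam[OF F G, of i] by simp
    qed
    then have "hprod phi F F = 0"
      using hprod_diff_right[OF TGH, of F] adj_domD(1)[OF F] unfolding F' by simp
    then have "F z = 0"
      using hsq_eq_0[OF adj_domD(1)[OF F]] by (simp add: hprod_self)
    then show ?thesis
      by (simp add: F_def r_def ground_nonzero)
  qed
  then have "a = a' \<and> b = b' \<and> c = c'"
    by (rule symbol_eqD)
  then show "T = Lstar i"
    by (simp add: Tabc Labc)
qed

lemma foldr_adjoint_op: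
  "foldr (\<lambda>i F. (adjoint_op phi (Lam Q i) ^^ \<alpha> i) F) xs ground = (\<lambda>z. hpoly xs \<alpha> z * ground z)"
proof (induction xs)
  case Nil
  show ?case by (simp add: hpoly_simps)
next
  case (Cons x xs)
  have "(Lstar x ^^ n) (\<lambda>z. p z * ground z) = (\<lambda>z. (raise x ^^ n) p z * ground z)" if "cpoly p" for n p
    by (induction n) (auto simp: Lstar_state funpow_raise_cpoly that)
  with Cons show ?case
    by (simp add: hpoly_simps adjoint_op_Lam hpoly_cpoly)
qed

lemma hpoly_zero: "hpoly xs (\<lambda>_. 0) = (\<lambda>z. 1)"
  by (induction xs) (auto simp: hpoly_simps)

context
  fixes xs :: "'n list"
  assumes xs: "distinct xs" "set xs = UNIV"
begin

definition state :: "('n \<Rightarrow> nat) \<Rightarrow> complex^'n \<Rightarrow> complex" where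
  "state \<alpha> z = hpoly xs \<alpha> z * ground z"

lemma state_eq: "state \<alpha> = (\<lambda>z. hpoly xs \<alpha> z * ground z)"
  by (simp add: state_def fun_eq_iff)

text \<open>A raising operator on the left moves over as \<open>Lam\<close> on the right, where it
  acts as a derivative and lowers the exponent.\<close>

lemma hprod_state_Suc:
  "hprod phi (state (\<alpha>(i := Suc (\<alpha> i)))) (state \<beta>) =
     2 * of_real (rho\<^sup>2) * of_nat (\<beta> i) * hprod phi (state \<alpha>) (state (\<beta>(i := \<beta> i - 1)))"
proof -
  note sd = state_adj_dom[OF hpoly_cpoly[of xs], folded state_eq]
  have "state (\<alpha>(i := Suc (\<alpha> i))) = Lstar i (state \<alpha>)"
    unfolding state_eq using raise_hpoly[OF xs(1), of i \<alpha>] xs(2) by (simp add: Lstar_state hpoly_cpoly)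
  then have "hprod phi (state (\<alpha>(i := Suc (\<alpha> i)))) (state \<beta>) = cnj (hprod phi (Lam Q i (state \<beta>)) (state \<alpha>))"
    by (simp add: hprod_Lam[OF sd sd] hprod_cnj)
  also have "Lam Q i (state \<beta>) = (\<lambda>z. (2 * of_real (rho\<^sup>2) * of_nat (\<beta> i)) * state (\<beta>(i := \<beta> i - 1)) z)"
    unfolding state_eq using pderiv_hpoly[OF xs(1), of i \<beta>] xs(2)
    by (simp add: Lam_state hpoly_cpoly fun_eq_iff)
  also have "cnj (hprod phi \<dots> (state \<alpha>)) = 2 * of_real (rho\<^sup>2) * of_nat (\<beta> i) * hprod phi (state \<alpha>) (state (\<beta>(i := \<beta> i - 1)))"
    unfolding hprod_cmult_left by (simp add: hprod_cnj)
  finally show ?thesis .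
qed

lemma hprod_state:
  "hprod phi (state \<alpha>) (state \<beta>) =
     (if \<alpha> = \<beta> then of_real ((2 * rho\<^sup>2) ^ (\<Sum>i\<in>UNIV. \<alpha> i) * (\<Prod>i\<in>UNIV. fact (\<alpha> i)) * hsq phi ground) else 0)"
proof (induction "\<Sum>i\<in>UNIV. \<alpha> i" arbitrary: \<alpha> \<beta>)
  case 0
  then have \<alpha>: "\<alpha> = (\<lambda>_. 0)"
    by (simp add: fun_eq_iff)
  show ?case
  proof (cases "\<beta> = \<alpha>")
    case True
    have "state \<alpha> = ground"
      by (simp add: state_eq \<alpha> hpoly_zero)
    then show ?thesis
      using True by (simp add: hprod_self \<alpha>)
  next
    case False
    then obtain i where i: "\<beta> i \<noteq> 0"
      by (auto simp: \<alpha> fun_eq_iff)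
    \<comment> \<open>With \<alpha> = 0 there is nothing to lower on the left, so the roles are
      exchanged: a unit of \<beta> is moved onto \<alpha>, where the coefficient \<alpha> i is
      0.\<close>
    define \<beta>' where "\<beta>' = \<beta>(i := \<beta> i - 1)"
    have "\<beta> = \<beta>'(i := Suc (\<beta>' i))"
      using i by (auto simp: \<beta>'_def)
    then have "hprod phi (state \<beta>) (state \<alpha>) = 0"
      using hprod_state_Suc[of \<beta>' i \<alpha>] by (simp add: \<alpha>)
    then have "hprod phi (state \<alpha>) (state \<beta>) = 0"
      using hprod_cnj[of phi "state \<beta>" "state \<alpha>"] by simp
    then show ?thesis
      using False by auto
  qed
next
  case (Suc n)
  have "\<exists>i. \<alpha> i \<noteq> 0"
  proof (rule ccontr)
    assume "\<nexists>i. \<alpha> i \<noteq> 0"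
    then show False
      using Suc.hyps(2) by simp
  qed
  then obtain i where i: "\<alpha> i \<noteq> 0"
    by blast
  define \<alpha>' where "\<alpha>' = \<alpha>(i := \<alpha> i - 1)"
  define \<beta>' where "\<beta>' = \<beta>(i := \<beta> i - 1)"
  have \<alpha>: "\<alpha> = \<alpha>'(i := Suc (\<alpha>' i))"
    using i by (auto simp: \<alpha>'_def)
  have "(\<Sum>j\<in>UNIV. \<alpha> j) = \<alpha> i + (\<Sum>j\<in>UNIV - {i}. \<alpha> j)" for \<alpha> :: "'n \<Rightarrow> nat"
    by (simp add: sum.remove)
  from this[of \<alpha>] this[of \<alpha>'] have sum: "(\<Sum>j\<in>UNIV. \<alpha> j) = Suc (\<Sum>j\<in>UNIV. \<alpha>' j)"
    using i by (simp add: \<alpha>'_def)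
  have "(\<Prod>j\<in>UNIV. fact (\<alpha> j)) = fact (\<alpha> i) * (\<Prod>j\<in>UNIV - {i}. fact (\<alpha> j) :: real)" for \<alpha> :: "'n \<Rightarrow> nat"
    by (simp add: prod.remove)
  from this[of \<alpha>] this[of \<alpha>'] have prod: "(\<Prod>j\<in>UNIV. fact (\<alpha> j)) = real (\<alpha> i) * (\<Prod>j\<in>UNIV. fact (\<alpha>' j))"
    using i by (simp add: \<alpha>'_def fact_reduce)
  have "hprod phi (state \<alpha>) (state \<beta>) = 2 * of_real (rho\<^sup>2) * of_nat (\<beta> i) * hprod phi (state \<alpha>') (state \<beta>')"
    by (subst \<alpha>, subst hprod_state_Suc) (simp add: \<beta>'_def)
  also have "hprod phi (state \<alpha>') (state \<beta>') =
     (if \<alpha>' = \<beta>' then of_real ((2 * rho\<^sup>2) ^ (\<Sum>i\<in>UNIV. \<alpha>' i) * (\<Prod>i\<in>UNIV. fact (\<alpha>' i)) * hsq phi ground) else 0)"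
    using Suc.hyps sum by simp
  finally have eq: "hprod phi (state \<alpha>) (state \<beta>) = 2 * of_real (rho\<^sup>2) * of_nat (\<beta> i) *
     (if \<alpha>' = \<beta>' then of_real ((2 * rho\<^sup>2) ^ (\<Sum>i\<in>UNIV. \<alpha>' i) * (\<Prod>i\<in>UNIV. fact (\<alpha>' i)) * hsq phi ground) else 0)" .
  show ?case
  proof (cases "\<alpha> = \<beta>")
    case True
    then have "\<alpha>' = \<beta>'"
      by (simp add: \<alpha>'_def \<beta>'_def)
    with eq have "hprod phi (state \<alpha>) (state \<beta>) = of_real (2 * rho\<^sup>2 * real (\<alpha> i) *
        ((2 * rho\<^sup>2) ^ (\<Sum>i\<in>UNIV. \<alpha>' i) * (\<Prod>i\<in>UNIV. fact (\<alpha>' i)) * hsq phi ground))"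
      using True by simp
    also have "2 * rho\<^sup>2 * real (\<alpha> i) *
        ((2 * rho\<^sup>2) ^ (\<Sum>i\<in>UNIV. \<alpha>' i) * (\<Prod>i\<in>UNIV. fact (\<alpha>' i)) * hsq phi ground)
        = (2 * rho\<^sup>2) ^ (\<Sum>i\<in>UNIV. \<alpha> i) * (\<Prod>i\<in>UNIV. fact (\<alpha> i)) * hsq phi ground"
      unfolding sum prod by simp
    finally show ?thesis
      using True by simp
  next
    case False
    \<comment> \<open>Decrementing is injective on positive exponents; the remaining case \<beta> i
      = 0 is covered by the vanishing coefficient.\<close>
    have "\<alpha>' \<noteq> \<beta>'" if "\<beta> i \<noteq> 0"
    proof
      assume "\<alpha>' = \<beta>'"
      then have "\<alpha>'(i := Suc (\<alpha>' i)) = \<beta>'(i := Suc (\<beta>' i))"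
        by simp
      moreover have "\<beta>'(i := Suc (\<beta>' i)) = \<beta>"
        using that by (auto simp: \<beta>'_def)
      ultimately show False
        using False \<alpha> by simp
    qed
    with eq False show ?thesis
      by auto
  qed
qed

lemma hsq_ground_pos: "0 < hsq phi ground"
proof -
  have "ground \<in> HPhi phi"
    using state_HPhi[OF cpoly.const[of 1]] by simp
  then have "hsq phi ground \<noteq> 0"
    using hsq_eq_0[of ground 0] ground_nonzero by blast
  then show ?thesis
    using hsq_nonneg[of phi ground] by simp
qed

definition state_norm :: "('n \<Rightarrow> nat) \<Rightarrow> real" where
  "state_norm \<alpha> = sqrt ((2 * rho\<^sup>2) ^ (\<Sum>i\<in>UNIV. \<alpha> i) * (\<Prod>i\<in>UNIV. fact (\<alpha> i))) * hnorm phi ground"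

definition nstate :: "('n \<Rightarrow> nat) \<Rightarrow> complex^'n \<Rightarrow> complex" where
  "nstate \<alpha> z = state \<alpha> z / complex_of_real (state_norm \<alpha>)"

lemma state_norm_pos: "0 < state_norm \<alpha>"
  unfolding state_norm_def hnorm_eq
  using rho_pos hsq_ground_pos by (intro mult_pos_pos real_sqrt_gt_zero prod_pos zero_less_power) auto

lemma state_norm_square: "(state_norm \<alpha>)\<^sup>2 = (2 * rho\<^sup>2) ^ (\<Sum>i\<in>UNIV. \<alpha> i) * (\<Prod>i\<in>UNIV. fact (\<alpha> i)) * hsq phi ground"
  unfolding state_norm_def hnorm_eq power_mult_distrib
  using hsq_ground_pos by (simp add: prod_nonneg less_imp_le)

lemma nstate_eq: "nstate \<alpha> = (\<lambda>z. complex_of_real (inverse (state_norm \<alpha>)) * state \<alpha> z)"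
  by (simp add: nstate_def fun_eq_iff divide_inverse mult.commute)

lemma nstate_HPhi: "nstate \<alpha> \<in> HPhi phi"
  unfolding nstate_eq state_eq by (intro HPhi_cmult state_HPhi hpoly_cpoly)

lemma nstate_orthonormal: "hprod phi (nstate \<alpha>) (nstate \<beta>) = (if \<alpha> = \<beta> then 1 else 0)"
proof (cases "\<alpha> = \<beta>")
  case True
  have "hprod phi (nstate \<alpha>) (nstate \<alpha>) = complex_of_real (inverse (state_norm \<alpha>) * (inverse (state_norm \<alpha>) * (state_norm \<alpha>)\<^sup>2))"
    unfolding nstate_eq hprod_cmult_left hprod_cmult_right hprod_state state_norm_square by simp
  also have "inverse (state_norm \<alpha>) * (inverse (state_norm \<alpha>) * (state_norm \<alpha>)\<^sup>2) = 1"
    using state_norm_pos[of \<alpha>] by (simp add: power2_eq_square field_simps)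
  finally show ?thesis
    using True by simp
next
  case False
  then show ?thesis
    unfolding nstate_eq hprod_cmult_left hprod_cmult_right hprod_state by simp
qed

section \<open>Span of the Hermite polynomials\<close>

definition in_span :: "(complex^'n \<Rightarrow> complex) \<Rightarrow> bool" where
  "in_span p \<longleftrightarrow> (\<exists>A c. finite A \<and> (\<forall>z. p z = (\<Sum>a\<in>A. c a * hpoly xs a z)))"

lemma in_span_hpoly: "in_span (hpoly xs \<alpha>)"
  unfolding in_span_def by (intro exI[of _ "{\<alpha>}"] exI[of _ "\<lambda>_. 1"]) simp

lemma in_span_cmult: "in_span p \<Longrightarrow> in_span (\<lambda>z. c * p z)"
  unfolding in_span_def
  by (elim exE conjE, rename_tac A d, rule_tac x = A in exI, rule_tac x = "\<lambda>a. c * d a" in exI)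
     (simp add: sum_distrib_left mult.assoc)

lemma in_span_add:
  assumes "in_span p" "in_span q"
  shows "in_span (\<lambda>z. p z + q z)"
proof -
  obtain A c where A: "finite A" "\<And>z. p z = (\<Sum>a\<in>A. c a * hpoly xs a z)"
    using assms(1) unfolding in_span_def by blast
  obtain B d where B: "finite B" "\<And>z. q z = (\<Sum>a\<in>B. d a * hpoly xs a z)"
    using assms(2) unfolding in_span_def by blast
  have "p z = (\<Sum>a\<in>A \<union> B. (if a \<in> A then c a else 0) * hpoly xs a z)"
    "q z = (\<Sum>a\<in>A \<union> B. (if a \<in> B then d a else 0) * hpoly xs a z)" for z
    unfolding A(2) B(2) using A(1) B(1) by (intro sum.mono_neutral_cong_left; simp)+
  then have "p z + q z = (\<Sum>a\<in>A \<union> B. ((if a \<in> A then c a else 0) + (if a \<in> B then d a else 0)) * hpoly xs a z)" for z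
    by (simp add: sum.distrib distrib_right)
  then show ?thesis
    unfolding in_span_def using A(1) B(1)
    by (intro exI[of _ "A \<union> B"] exI[of _ "\<lambda>a. (if a \<in> A then c a else 0) + (if a \<in> B then d a else 0)"]) simp
qed

lemma in_span_sum: "finite A \<Longrightarrow> (\<And>a. a \<in> A \<Longrightarrow> in_span (f a)) \<Longrightarrow> in_span (\<lambda>z. \<Sum>a\<in>A. f a z)"
proof (induction A rule: finite_induct)
  case empty
  show ?case using in_span_cmult[OF in_span_hpoly, of 0] by simp
next
  case (insert a A)
  then show ?case by (simp add: in_span_add)
qed

text \<open>The definition of \<open>raise\<close> is solved for the coordinate factor, dividing by
  2 rho^2: the raised polynomial and all first derivatives are multiples of Hermite
  polynomials.\<close>

lemma in_span_coord_hpoly: "in_span (\<lambda>z. z $ i * hpoly xs \<alpha> z)"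
proof -
  have "raise i (hpoly xs \<alpha>) z = 2 * of_real (rho\<^sup>2) * (z $ i * hpoly xs \<alpha> z) +
     (\<Sum>k\<in>UNIV. M $ i $ k * (2 * of_real (rho\<^sup>2) * of_nat (\<alpha> k) * hpoly xs (\<alpha>(k := \<alpha> k - 1)) z))" for z
    using xs by (simp add: raise_def pderiv_hpoly)
  then have eq: "z $ i * hpoly xs \<alpha> z = inverse (2 * of_real (rho\<^sup>2)) * (hpoly xs (\<alpha>(i := Suc (\<alpha> i))) z
     + (-1) * (\<Sum>k\<in>UNIV. M $ i $ k * (2 * of_real (rho\<^sup>2) * of_nat (\<alpha> k) * hpoly xs (\<alpha>(k := \<alpha> k - 1)) z)))" for z
    using raise_hpoly[OF xs(1), of i \<alpha>] xs(2) rho_pos by simp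
  show ?thesis
    unfolding eq by (intro in_span_cmult in_span_add in_span_sum in_span_hpoly finite)
qed

lemma in_span_coord:
  assumes "in_span p"
  shows "in_span (\<lambda>z. z $ i * p z)"
proof -
  obtain A c where A: "finite A" "\<And>z. p z = (\<Sum>a\<in>A. c a * hpoly xs a z)"
    using assms unfolding in_span_def by blast
  have "z $ i * p z = (\<Sum>a\<in>A. c a * (z $ i * hpoly xs a z))" for z
    unfolding A by (simp add: sum_distrib_left mult_ac)
  moreover have "in_span (\<lambda>z. \<Sum>a\<in>A. c a * (z $ i * hpoly xs a z))"
    by (intro in_span_sum in_span_cmult in_span_coord_hpoly A(1))
  ultimately show ?thesis
    by (simp only:)
qed

text \<open>The induction shows that multiplication by p preserves the span, which makes the product
  case a composition. Applying this to the constant 1, the Hermite polynomial of exponent 0, gives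
  the claim.\<close>

lemma in_span_cpoly:
  assumes "cpoly p"
  shows "in_span p"
proof -
  have "in_span (\<lambda>z. p z * q z)" if "in_span q" for q
    using assms that
  proof (induction arbitrary: q rule: cpoly.induct)
    case (const c)
    then show ?case by (rule in_span_cmult)
  next
    case (coord i)
    then show ?case by (rule in_span_coord)
  next
    case (add p p')
    then show ?case by (simp add: distrib_right in_span_add)
  next
    case (mult p p')
    then show ?case by (simp add: mult.assoc)
  qed
  from this[OF in_span_hpoly[of "\<lambda>_. 0"]] show ?thesis
    by (simp add: hpoly_zero)
qed

lemma state_closed_span:
  assumes "cpoly p"
  shows "(\<lambda>z. p z * ground z) \<in> closed_span nstate"
proof -
  obtain A c where A: "finite A" "\<And>z. p z = (\<Sum>a\<in>A. c a * hpoly xs a z)"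
    using in_span_cpoly[OF assms] unfolding in_span_def by blast
  have "c a * of_real (state_norm a) * nstate a z = c a * hpoly xs a z * ground z" for a z
    using state_norm_pos[of a] by (simp add: nstate_def state_def)
  then have "p z * ground z - (\<Sum>a\<in>A. c a * of_real (state_norm a) * nstate a z) = 0" for z
    by (simp only: A(2) sum_distrib_right diff_self)
  then have "hsq phi (\<lambda>z. p z * ground z - (\<Sum>a\<in>A. c a * of_real (state_norm a) * nstate a z)) = 0"
    by (simp add: hsq_def)
  then have "\<exists>S d. finite S \<and> hsq phi (\<lambda>z. p z * ground z - (\<Sum>a\<in>S. d a * nstate a z)) < \<epsilon>" if "0 < \<epsilon>" for \<epsilon>
    using A(1) that by (intro exI[of _ A] exI[of _ "\<lambda>a. c a * of_real (state_norm a)"]) simp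
  then show ?thesis
    using state_HPhi[OF assms] by (simp add: closed_span_def)
qed

end

end

section \<open>Completeness\<close>

lemma norm_vector_scalar_mult: "norm (c *s (x::complex^'n::finite)) = cmod c * norm x"
  by (simp add: norm_vec_def norm_mult L2_set_right_distrib)

lemma continuous_on_vector_scalar_mult [continuous_intros]:
  fixes f :: "'a::topological_space \<Rightarrow> complex" and g :: "'a \<Rightarrow> complex^'n::finite"
  assumes "continuous_on A f" "continuous_on A g"
  shows "continuous_on A (\<lambda>x. f x *s g x)"
  unfolding vector_scalar_mult_def using assms
  by (intro continuous_on_vec_lambda continuous_on_mult continuous_on_component)

section \<open>Mean values over rotations and the exponential series\<close>

lemma circle_mean_value:
  assumes "f holomorphic_on UNIV"
  shows "(LINT t:{0..1}|lborel. f (exp (2 * of_real pi * \<i> * of_real t))) = f 0"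
proof -
  define g where "g t = f (exp (2 * of_real pi * \<i> * of_real t))" for t :: real
  have cont: "continuous_on {0..1} g"
    unfolding g_def
    by (rule continuous_on_compose2[OF holomorphic_on_imp_continuous_on[OF assms]])
       (auto intro!: continuous_intros)
  have "((\<lambda>u. f u / (u - 0)) has_contour_integral 2 * of_real pi * \<i> * f 0) (circlepath 0 1)"
    by (rule Cauchy_integral_circlepath_simple) (auto intro: holomorphic_on_subset[OF assms])
  then have "((\<lambda>t. f (circlepath 0 1 t) / circlepath 0 1 t * vector_derivative (circlepath 0 1) (at t within {0..1}))
      has_integral 2 * of_real pi * \<i> * f 0) {0..1}"
    by (simp add: has_contour_integral_def)
  then have "((\<lambda>t. (2 * of_real pi * \<i>) * g t) has_integral (2 * of_real pi * \<i>) * f 0) {0..1}"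
  proof (rule has_integral_eq[rotated])
    fix t :: real assume t: "t \<in> {0..1}"
    define w where "w = exp (2 * of_real pi * \<i> * of_real t)"
    have cp: "circlepath 0 1 t = w"
      by (simp add: circlepath w_def mult_ac)
    have vd: "vector_derivative (circlepath 0 1) (at t within {0..1}) = 2 * of_real pi * \<i> * w"
      using t by (simp add: vector_derivative_circlepath01 w_def)
    show "f (circlepath 0 1 t) / circlepath 0 1 t * vector_derivative (circlepath 0 1) (at t within {0..1})
        = (2 * of_real pi * \<i>) * g t"
      unfolding cp vd g_def w_def[symmetric] by (simp add: w_def)
  qed
  from has_integral_mult_right[OF this, of "inverse (2 * of_real pi * \<i>)"]
  have "((\<lambda>t. inverse (2 * of_real pi * \<i>) * ((2 * of_real pi * \<i>) * g t)) has_integral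
      inverse (2 * of_real pi * \<i>) * ((2 * of_real pi * \<i>) * f 0)) {0..1}" .
  moreover have "inverse (2 * of_real pi * \<i>) * ((2 * of_real pi * \<i>) * x) = x" for x :: complex
    by (simp add: field_simps)
  ultimately have "(g has_integral f 0) {0..1}"
    by (simp only:)
  then have "integral {0..1} g = f 0"
    by (rule integral_unique)
  moreover have "set_integrable lborel {0..1} g"
    unfolding set_integrable_def by (rule borel_integrable_compact[OF _ cont]) simp
  ultimately show ?thesis
    unfolding g_def[symmetric] by (simp add: set_borel_integral_eq_integral)
qed

text \<open>Multiplying all coordinates by a common phase preserves Lebesgue measure and g.
  Averaging over the phase replaces E u by E 0, the mean value property on the complex line through
  0 and u.\<close>

lemma integral_rotation_invariant_mean:
  fixes E :: "complex^'n::finite \<Rightarrow> complex"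
  assumes E: "entire E" and g: "\<And>c u. cmod c = 1 \<Longrightarrow> g (c *s u) = g u"
    and int: "integrable lborel (\<lambda>u. E u * g u)"
  shows "(\<integral>u. E u * g u \<partial>lborel) = E 0 * (\<integral>u. g u \<partial>lborel)"
proof -
  define T :: "real \<Rightarrow> complex^'n \<Rightarrow> complex^'n" where "T t x = exp (2 * of_real pi * \<i> * of_real t) *s x" for t x
  have lin: "linear (T t)" for t
    unfolding T_def by (rule linearI) (auto simp: vec_eq_iff algebra_simps scaleR_conv_of_real)
  have inv: "T t (T (- t) x) = x" for t x
    by (simp add: T_def vec_eq_iff exp_minus)
  have nrm: "cmod (exp (2 * of_real pi * \<i> * of_real t)) = 1" for t
    by (simp add: norm_exp_eq_Re)
  have iso: "norm (T t x) = norm x" for t x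
    unfolding T_def norm_vector_scalar_mult nrm by simp
  have cont: "continuous_on UNIV (\<lambda>(t, x). T t x)"
    unfolding T_def split_def by (intro continuous_intros)
  have "(\<integral>u. E u * g u \<partial>lborel) = (\<integral>u. (LINT t:{0..1}|lborel. E (T t u) * g (T t u)) \<partial>lborel)"
    by (rule integral_average[OF cont lborel_distr_isometry[OF lin inv iso] int, symmetric])
  also have "\<dots> = (\<integral>u. E 0 * g u \<partial>lborel)"
  proof (rule Bochner_Integration.integral_cong)
    fix u
    have "(LINT t:{0..1}|lborel. E (T t u)) = E 0"
      using circle_mean_value[OF entire_line_holomorphic[OF E, of 0 u UNIV]] by (simp add: T_def)
    then show "(LINT t:{0..1}|lborel. E (T t u) * g (T t u)) = E 0 * g u"
      by (simp add: T_def g[OF nrm])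
  qed simp
  finally show ?thesis
    by simp
qed

text \<open>The exponential and each partial sum have modulus at most \<open>exp (cmod w)\<close>.
  The bound is uniform in m, as dominated convergence requires.\<close>

lemma exp_remainder_bound: "cmod (exp w - (\<Sum>n<m. w ^ n / fact n)) \<le> 2 * exp (cmod w)"
proof -
  have "cmod (\<Sum>n<m. w ^ n / fact n) \<le> (\<Sum>n<m. cmod w ^ n / fact n)"
    by (rule sum_norm_le) (simp add: norm_divide norm_power)
  also have "\<dots> \<le> (\<Sum>n. cmod w ^ n / fact n)"
    using summable_exp[of "cmod w"] by (intro sum_le_suminf) (auto simp: field_simps)
  also have "\<dots> = exp (cmod w)"
    by (simp add: exp_def field_simps)
  finally have "cmod (\<Sum>n<m. w ^ n / fact n) \<le> exp (cmod w)" .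
  then show ?thesis
    using norm_triangle_ineq4[of "exp w" "\<Sum>n<m. w ^ n / fact n"] norm_exp[of w] by linarith
qed

lemma exp_remainder_tendsto: "(\<lambda>m. exp w - (\<Sum>n<m. w ^ n / fact n)) \<longlonglongrightarrow> (0::complex)"
proof -
  have "(\<lambda>n. w ^ n / fact n) sums exp w"
    using exp_converges[of w] by (simp add: scaleR_conv_of_real field_simps)
  then have "(\<lambda>m. exp w - (\<Sum>n<m. w ^ n / fact n)) \<longlonglongrightarrow> exp w - exp w"
    unfolding sums_def by (intro tendsto_intros)
  then show ?thesis by simp
qed

context hermite
begin

text \<open>The factor exp (s q), with q = \<open>expo b\<close>, is approximated by its Taylor
  polynomials, which are absorbed into p; this is why \<open>mem\<close> ranges over all
  polynomials. The squared remainder is at most 4 exp (2 s |q|), and \<open>state_majorant\<close>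
  dominates that as long as kap (1 + s) < 1.\<close>

lemma exp_state_step:
  assumes e: "\<And>a. e a \<in> HPhi phi" and t: "0 \<le> t" and s: "0 \<le> s" "t + s \<le> 1" "kap * (1 + s) < 1"
    and mem: "\<And>p. cpoly p \<Longrightarrow> (\<lambda>z. p z * exp (of_real t * expo b z) * ground z) \<in> closed_span e"
    and p: "cpoly p"
  shows "(\<lambda>z. p z * exp (of_real (t + s) * expo b z) * ground z) \<in> closed_span e"
proof -
  define T where "T m z = (\<Sum>n<m. (of_real s * expo b z) ^ n / fact n)" for m z
  define B where "B z = p z * exp (of_real t * expo b z) * ground z" for z
  define K where "K z = p z * exp (of_real (t + s) * expo b z) * ground z" for z
  define L where "L m z = (p z * T m z) * exp (of_real t * expo b z) * ground z" for m z
  have cT: "cpoly (T m)" for m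
    unfolding T_def[abs_def] by (intro cpoly_intros expo_cpoly)
  have L: "L m \<in> closed_span e" for m
    unfolding L_def[abs_def] by (intro mem cpoly.mult p cT)
  have K: "K \<in> HPhi phi"
    unfolding K_def[abs_def] using t s by (intro exp_state_HPhi p) auto
  have LH: "L m \<in> HPhi phi" for m
    using L by (simp add: closed_span_def)
  have KL: "K z - L m z = B z * (exp (of_real s * expo b z) - T m z)" for m z
    unfolding K_def L_def B_def by (simp add: distrib_right exp_add algebra_simps)
  obtain C a r where r: "0 < r" and maj: "\<And>t z. 0 \<le> t \<Longrightarrow> t \<le> 1 \<Longrightarrow>
    (cmod (p z * exp (of_real t * expo b z) * ground z))\<^sup>2 * exp (2 * s * cmod (expo b z)) * exp (- 2 * phi z)
      \<le> C * exp (a * norm z - r * (norm z)\<^sup>2)"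
    by (rule state_majorant[OF p s(1) s(3), of b]) blast
  have maj': "(cmod (K z - L m z))\<^sup>2 * exp (- 2 * phi z) \<le> 4 * C * exp (a * norm z - r * (norm z)\<^sup>2)" for m z
  proof -
    have "(cmod (exp (of_real s * expo b z) - T m z))\<^sup>2 \<le> (2 * exp (cmod (of_real s * expo b z)))\<^sup>2"
      unfolding T_def by (intro power_mono exp_remainder_bound) auto
    also have "\<dots> = 4 * exp (2 * s * cmod (expo b z))"
      using s(1) by (simp add: power_mult_distrib norm_mult exp_double[symmetric] mult.assoc)
    finally have le: "(cmod (exp (of_real s * expo b z) - T m z))\<^sup>2 \<le> 4 * exp (2 * s * cmod (expo b z))" .
    have "(cmod (K z - L m z))\<^sup>2 * exp (- 2 * phi z)
        = (cmod (B z))\<^sup>2 * (cmod (exp (of_real s * expo b z) - T m z))\<^sup>2 * exp (- 2 * phi z)"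
      unfolding KL by (simp add: norm_mult power_mult_distrib)
    also have "\<dots> \<le> (cmod (B z))\<^sup>2 * (4 * exp (2 * s * cmod (expo b z))) * exp (- 2 * phi z)"
      using le by (intro mult_right_mono mult_left_mono) auto
    also have "\<dots> = 4 * ((cmod (B z))\<^sup>2 * exp (2 * s * cmod (expo b z)) * exp (- 2 * phi z))"
      by simp
    also have "\<dots> \<le> 4 * (C * exp (a * norm z - r * (norm z)\<^sup>2))"
      using maj[of t z] t s unfolding B_def by (intro mult_left_mono) auto
    finally show ?thesis
      by simp
  qed
  have [measurable]: "K \<in> borel_measurable borel" "L m \<in> borel_measurable borel" for m
    using K LH by (auto intro: entire_measurable HPhi_entire)
  have "(\<lambda>m. \<integral>z. (cmod (K z - L m z))\<^sup>2 * exp (- 2 * phi z) \<partial>lborel) \<longlonglongrightarrow> (\<integral>z. 0 \<partial>(lborel :: (complex^'n) measure))"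
  proof (rule integral_dominated_convergence[where w = "\<lambda>z. 4 * C * exp (a * norm z - r * (norm z)\<^sup>2)"])
    show "integrable lborel (\<lambda>z::complex^'n. 4 * C * exp (a * norm z - r * (norm z)\<^sup>2))"
      by (rule integrable_gaussian_bound[OF r, of _ "\<bar>4 * C\<bar>" a]) (auto simp: abs_mult)
    show "AE z in lborel. (\<lambda>m. (cmod (K z - L m z))\<^sup>2 * exp (- 2 * phi z)) \<longlonglongrightarrow> 0"
    proof (rule AE_I2)
      fix z
      have "(\<lambda>m. (cmod (B z * (exp (of_real s * expo b z) - T m z)))\<^sup>2 * exp (- 2 * phi z))
          \<longlonglongrightarrow> (cmod (B z * 0))\<^sup>2 * exp (- 2 * phi z)"
        unfolding T_def by (intro tendsto_intros exp_remainder_tendsto)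
      then show "(\<lambda>m. (cmod (K z - L m z))\<^sup>2 * exp (- 2 * phi z)) \<longlonglongrightarrow> 0"
        by (simp add: KL)
    qed
    show "AE z in lborel. norm ((cmod (K z - L m z))\<^sup>2 * exp (- 2 * phi z))
        \<le> 4 * C * exp (a * norm z - r * (norm z)\<^sup>2)" for m
      using maj' by simp
  qed measurable
  then have "(\<lambda>m. hsq phi (\<lambda>z. K z - L m z)) \<longlonglongrightarrow> 0"
    by (simp add: hsq_def)
  from closed_span_limit[OF K e L this] show ?thesis
    by (simp add: K_def[abs_def])
qed

text \<open>The power series of \<open>exp (expo b z)\<close> multiplied by \<open>ground\<close> need not converge in
  \<open>HPhi phi\<close>; short steps \<open>t \<mapsto> t + 1 / m\<close> in the exponent do converge.\<close>

lemma exp_state_closed_span: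
  assumes e: "\<And>a. e a \<in> HPhi phi"
    and mem: "\<And>p. cpoly p \<Longrightarrow> (\<lambda>z. p z * ground z) \<in> closed_span e"
  shows "(\<lambda>z. exp (expo b z) * ground z) \<in> closed_span e"
proof -
  \<comment> \<open>The step length 1 / (m + 1) must satisfy the smallness condition of
    \<open>exp_state_step\<close>; since kap < 1, a large m does, and m + 1 such steps end exactly
    at t = 1.\<close>
  have "((\<lambda>m. kap * (1 + inverse (real (Suc m)))) \<longlonglongrightarrow> kap * (1 + 0))"
    by (intro tendsto_intros LIMSEQ_inverse_real_of_nat)
  then have "eventually (\<lambda>m. kap * (1 + inverse (real (Suc m))) < 1) sequentially"
    using kap(2) by (intro order_tendstoD) simp_all
  then obtain m where m: "kap * (1 + inverse (real (Suc m))) < 1"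
    by (auto simp: eventually_sequentially)
  define s where "s = inverse (real (Suc m))"
  \<comment> \<open>The induction carries all polynomials p, because each step consumes the
    statement for p times Taylor polynomials.\<close>
  have "\<forall>p. cpoly p \<longrightarrow> (\<lambda>z. p z * exp (of_real (real k * s) * expo b z) * ground z) \<in> closed_span e"
    if "k \<le> Suc m" for k
    using that
  proof (induction k)
    case 0
    then show ?case using mem by simp
  next
    case (Suc k)
    have "real (Suc k) * s \<le> real (Suc m) * s"
      using Suc.prems by (intro mult_right_mono) (auto simp: s_def)
    then have "real k * s + s \<le> 1"
      by (simp add: s_def algebra_simps del: of_nat_Suc) (simp add: field_simps)
    then have "(\<lambda>z. p z * exp (of_real (real k * s + s) * expo b z) * ground z) \<in> closed_span e" if "cpoly p" for p
      using Suc m that by (intro exp_state_step e) (auto simp: s_def)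
    then show ?case
      by (simp add: algebra_simps)
  qed
  from this[OF order_refl] cpoly.const[of 1]
  have "(\<lambda>z. 1 * exp (of_real (real (Suc m) * s) * expo b z) * ground z) \<in> closed_span e"
    by blast
  moreover have "real (Suc m) * s = 1"
    by (simp add: s_def del: of_nat_Suc)
  ultimately show ?thesis
    by (simp only: of_real_1 mult_1)
qed

section \<open>Kernels of point evaluation\<close>

definition polar :: "complex^'n \<Rightarrow> complex^'n \<Rightarrow> complex" where
  "polar z w = (\<Sum>i\<in>UNIV. \<Sum>j\<in>UNIV. z $ i * (P $ i $ j * cnj (w $ j)))"

lemma polar_simps:
  "polar (z + z') w = polar z w + polar z' w" "polar z (w + w') = polar z w + polar z w'"
  "herm P z = polar z z" "cnj (polar z w) = polar w z"
proof -
  show "polar (z + z') w = polar z w + polar z' w" "polar z (w + w') = polar z w + polar z w'"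
    by (simp_all add: polar_def algebra_simps sum.distrib)
  show "herm P z = polar z z"
    by (simp add: polar_def herm_def)
  show "cnj (polar z w) = polar w z"
    unfolding polar_def by (subst sum.swap) (simp add: P_herm mult_ac)
qed

definition kernel_coeff :: "complex^'n \<Rightarrow> complex^'n" where
  "kernel_coeff w = (\<chi> i. 2 * (\<Sum>j\<in>UNIV. P $ i $ j * cnj (w $ j)))"

lemma kernel_eq: "exp (expo (kernel_coeff w) z) * ground z = exp (quad S z + 2 * polar z w)"
proof -
  have "(\<Sum>j\<in>UNIV. kernel_coeff w $ j * z $ j) = 2 * polar z w"
    by (simp add: kernel_coeff_def polar_def sum_distrib_left sum_distrib_right mult_ac)
  then show ?thesis
    by (simp add: expo_def psi0_eq quad_diff exp_add[symmetric] add.commute)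
qed

lemma herm_real: "complex_of_real (Re (herm P z)) = herm P z"
  using polar_simps(4)[of z z] by (simp add: polar_simps(3) complex_eq_iff)

lemma gaussian_mass_pos: "0 < (\<integral>u. exp (- 2 * Re (herm P u)) \<partial>(lborel :: (complex^'n) measure))"
proof -
  have cont: "continuous_on UNIV (\<lambda>u. exp (- 2 * Re (herm P u)))"
    by (intro continuous_intros continuous_herm)
  have [measurable]: "(\<lambda>u. exp (- 2 * Re (herm P u))) \<in> borel_measurable borel"
    by (rule borel_measurable_continuous_onI[OF cont])
  have int: "integrable lborel (\<lambda>u::complex^'n. exp (- 2 * Re (herm P u)))"
  proof (rule integrable_gaussian_bound[of "2 * m0" _ 1 0])
    show "norm (exp (- 2 * Re (herm P u))) \<le> 1 * exp (0 * norm u - 2 * m0 * (norm u)\<^sup>2)" for u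
      using coercive[of u] by simp
  qed (use m0_pos in simp, measurable)
  have "(\<integral>u. exp (- 2 * Re (herm P u)) \<partial>(lborel :: (complex^'n) measure)) \<noteq> 0"
  proof
    assume "(\<integral>u. exp (- 2 * Re (herm P u)) \<partial>(lborel :: (complex^'n) measure)) = 0"
    then have "AE u in (lborel :: (complex^'n) measure). exp (- 2 * Re (herm P u)) = 0"
      using integral_nonneg_eq_0_iff_AE[OF int] by simp
    then have "AE u in (lborel :: (complex^'n) measure). False"
      by simp
    then show False
      using AE_iff_null[of "lborel :: (complex^'n) measure" "\<lambda>_. False"] by (simp add: null_sets_def)
  qed
  moreover have "0 \<le> (\<integral>u. exp (- 2 * Re (herm P u)) \<partial>(lborel :: (complex^'n) measure))"
    by (rule integral_nonneg_AE) simp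
  ultimately show ?thesis
    by linarith
qed

text \<open>The conjugated \<open>quad S\<close> in the kernel cancels against the weight. After the
  shift z = w + u the integrand is an entire function E of u times the rotation invariant exp (- 2
  \<open>herm P u\<close>), so the integral is E 0 times the Gaussian mass.\<close>

lemma hprod_kernel:
  assumes F: "F \<in> HPhi phi" and K: "(\<lambda>z. exp (expo (kernel_coeff w) z) * ground z) \<in> HPhi phi"
  shows "hprod phi F (\<lambda>z. exp (expo (kernel_coeff w) z) * ground z) =
    exp (- quad S w) * F w * of_real (\<integral>u. exp (- 2 * Re (herm P u)) \<partial>(lborel :: (complex^'n) measure))"
proof -
  define I where "I z = F z * cnj (exp (expo (kernel_coeff w) z) * ground z) * of_real (exp (- 2 * phi z))" for z
  define E where "E u = F (w + u) * exp (- quad S (w + u) - 2 * polar u w)" for u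
  define g where "g u = complex_of_real (exp (- 2 * Re (herm P u)))" for u
  have cpq: "cpoly (\<lambda>u. 2 * polar u w)"
    unfolding polar_def by (intro cpoly_intros)
  have entE: "entire E"
  proof -
    have "entire (\<lambda>u. (- 1) * quad S (w + u) - 2 * polar u w)"
      by (intro entire_diff entire_cmult entire_shift cpoly_entire[OF quad_cpoly] cpoly_entire[OF cpq])
    from entire_mult[OF entire_shift[OF HPhi_entire[OF F]] entire_exp[OF this]] show ?thesis
      by (simp add: E_def[abs_def])
  qed
  have Iw: "I (u + w) = E u * g u" for u
  proof -
    have "complex_of_real (exp (- 2 * phi z)) = exp (- 2 * herm P z - quad S z - cnj (quad S z))" for z
    proof -
      have "complex_of_real (- 2 * phi z) = - 2 * herm P z - quad S z - cnj (quad S z)"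
        by (simp add: phi_def herm_real complex_eq_iff)
      then show ?thesis
        by (metis exp_of_real)
    qed
    note weight = this
    have "cnj (exp (quad S z + 2 * polar z w)) = exp (cnj (quad S z) + 2 * polar w z)" for z
      by (simp add: exp_cnj polar_simps(4))
    then have "I z = F z * (exp (cnj (quad S z) + 2 * polar w z) * exp (- 2 * herm P z - quad S z - cnj (quad S z)))" for z
      unfolding I_def kernel_eq weight by (simp only: mult.assoc)
    then have "I z = F z * exp (- quad S z + (2 * polar w z - 2 * herm P z))" for z
      unfolding exp_add[symmetric] by (simp add: algebra_simps)
    \<comment> \<open>Completing the square at w: the antiholomorphic term \<open>polar w u\<close>
      cancels, and the surviving \<open>polar u w\<close> is holomorphic in u.\<close>
    moreover have "- quad S (w + u) + (2 * polar w (w + u) - 2 * herm P (w + u))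
        = - quad S (w + u) - 2 * polar u w + (- 2 * herm P u)"
      by (simp add: polar_simps(1-3))
    ultimately have "I (w + u) = F (w + u) * exp (- quad S (w + u) - 2 * polar u w + (- 2 * herm P u))"
      by (simp only:)
    also have "exp (- quad S (w + u) - 2 * polar u w + (- 2 * herm P u)) = exp (- quad S (w + u) - 2 * polar u w) * g u"
      unfolding exp_add g_def exp_of_real[symmetric] by (simp add: herm_real)
    finally show ?thesis
      by (simp add: E_def add.commute)
  qed
  have int: "integrable lborel I"
    unfolding I_def by (rule integrable_product[OF F K])
  have [measurable]: "I \<in> borel_measurable borel"
    using int by auto
  have int2: "integrable lborel (\<lambda>u. E u * g u)"
    using integrable_distr_eq[of "\<lambda>x. x + w" lborel borel I] int
    by (simp add: lborel_distr_add Iw)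
  have "(\<integral>z. I z \<partial>lborel) = (\<integral>u. E u * g u \<partial>lborel)"
    using integral_distr[of "\<lambda>x. x + w" lborel borel I] by (simp add: lborel_distr_add Iw)
  also have "\<dots> = E 0 * (\<integral>u. g u \<partial>lborel)"
  proof (rule integral_rotation_invariant_mean[OF entE _ int2])
    show "g (c *s u) = g u" if "cmod c = 1" for c u
    proof -
      have "c * cnj c = 1"
        using that complex_norm_square[of c] by simp
      then show ?thesis
        by (simp add: g_def herm_scale)
    qed
  qed
  also have "E 0 = F w * exp (- quad S w)"
    by (simp add: E_def polar_def)
  finally show ?thesis
    unfolding hprod_def I_def g_def by (simp add: integral_complex_of_real mult.commute del: of_real_exp)
qed

lemma orthonormal_states_complete:
  fixes e :: "'i::countable \<Rightarrow> complex^'n \<Rightarrow> complex"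
  assumes e: "\<And>a. e a \<in> HPhi phi"
    and orth: "\<And>a b. hprod phi (e a) (e b) = (if a = b then 1 else 0)"
    and mem: "\<And>p. cpoly p \<Longrightarrow> (\<lambda>z. p z * ground z) \<in> closed_span e"
  shows "complete_orthonormal_system phi e"
proof (rule orthonormal_complete[OF e orth])
  fix w
  define c where "c = (\<integral>u. exp (- 2 * Re (herm P u)) \<partial>(lborel :: (complex^'n) measure))"
  define K where "K z = exp (expo (kernel_coeff w) z) * ground z" for z
  have K: "K \<in> closed_span e"
    unfolding K_def[abs_def] by (rule exp_state_closed_span[OF e mem])
  then have "K \<in> HPhi phi"
    by (simp add: closed_span_def)
  then have "hprod phi F K = exp (- quad S w) * F w * of_real c" if "F \<in> HPhi phi" for F
    using hprod_kernel[OF that, of w] unfolding K_def[abs_def] c_def by blast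
  moreover have "c \<noteq> 0"
    unfolding c_def using gaussian_mass_pos by (rule less_imp_neq[symmetric])
  ultimately have "F w = exp (quad S w) / of_real c * hprod phi F K" if "F \<in> HPhi phi" for F
    using that by (simp add: exp_minus field_simps)
  with K show "\<exists>K\<in>closed_span e. \<exists>\<gamma>. \<forall>F\<in>HPhi phi. F w = \<gamma> * hprod phi F K"
    by blast
qed

end

section \<open>Matrices\<close>

lemma diag_mat_mult_left: "(diag_mat d ** N) $ i $ j = complex_of_real (d i) * N $ i $ j"
proof -
  have "(\<Sum>k\<in>UNIV. (if i = k then complex_of_real (d i) else 0) * N $ k $ j)
      = (\<Sum>k\<in>UNIV. if i = k then complex_of_real (d i) * N $ k $ j else 0)"
    by (intro sum.cong) auto
  then show ?thesis
    by (simp add: diag_mat_def matrix_matrix_mult_def)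
qed

lemma diag_mat_mult_right: "(N ** diag_mat d) $ i $ j = N $ i $ j * complex_of_real (d j)"
proof -
  have "(\<Sum>k\<in>UNIV. N $ i $ k * (if k = j then complex_of_real (d k) else 0))
      = (\<Sum>k\<in>UNIV. if k = j then N $ i $ k * complex_of_real (d k) else 0)"
    by (intro sum.cong) auto
  then show ?thesis
    by (simp add: diag_mat_def matrix_matrix_mult_def)
qed

lemma diag_mat_mult_vec: "(diag_mat d *v v) $ i = complex_of_real (d i) * v $ i"
proof -
  have "(\<Sum>k\<in>UNIV. (if i = k then complex_of_real (d i) else 0) * v $ k)
      = (\<Sum>k\<in>UNIV. if i = k then complex_of_real (d i) * v $ k else 0)"
    by (intro sum.cong) auto
  then show ?thesis
    by (simp add: diag_mat_def matrix_vector_mult_def)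
qed

lemma diag_mat_mult: "diag_mat a ** diag_mat b = diag_mat (\<lambda>i. a i * b i)"
  by (simp add: vec_eq_iff diag_mat_mult_left) (simp add: diag_mat_def)

lemma transpose_diag_mat: "transpose (diag_mat a) = diag_mat a"
  by (auto simp: diag_mat_def transpose_def vec_eq_iff)

lemma cnj_mat_diag_mat: "cnj_mat (diag_mat a) = diag_mat a"
  by (simp add: diag_mat_def cnj_mat_def vec_eq_iff)

lemma diag_mat_1: "diag_mat (\<lambda>i. 1) = mat 1"
  by (simp add: diag_mat_def mat_def vec_eq_iff)

lemma cnj_mat_mult: "cnj_mat (M ** N) = cnj_mat M ** cnj_mat N"
  by (simp add: cnj_mat_def matrix_matrix_mult_def vec_eq_iff)

lemma cnj_mat_mat_1: "cnj_mat (mat 1) = mat 1"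
  by (simp add: cnj_mat_def mat_def vec_eq_iff)

lemma cnj_mat_transpose: "cnj_mat (transpose M) = adj_mat M"
  by (simp add: cnj_mat_def adj_mat_def transpose_def vec_eq_iff)

lemma cnj_mat_adj_mat: "cnj_mat (adj_mat M) = transpose M"
  by (simp add: cnj_mat_def adj_mat_def transpose_def vec_eq_iff)

lemma unitary_mat_cnj:
  assumes "unitary_mat M"
  shows "transpose M ** cnj_mat M = mat 1" "cnj_mat M ** transpose M = mat 1"
proof -
  have "cnj_mat (adj_mat M ** M) = mat 1" "cnj_mat (M ** adj_mat M) = mat 1"
    using assms by (simp_all add: unitary_mat_def cnj_mat_mat_1)
  then show "transpose M ** cnj_mat M = mat 1" "cnj_mat M ** transpose M = mat 1"
    by (simp_all only: cnj_mat_mult cnj_mat_adj_mat)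
qed

lemma bilin_mult_left: "bilin (M *v v) w = bilin v (transpose M *v w)"
proof -
  have "bilin (M *v v) w = (\<Sum>i\<in>UNIV. \<Sum>j\<in>UNIV. M $ i $ j * v $ j * w $ i)"
    by (simp add: bilin_def matrix_vector_mult_def sum_distrib_right)
  also have "\<dots> = (\<Sum>j\<in>UNIV. \<Sum>i\<in>UNIV. M $ i $ j * v $ j * w $ i)"
    by (rule sum.swap)
  also have "\<dots> = bilin v (transpose M *v w)"
    by (simp add: bilin_def matrix_vector_mult_def transpose_def sum_distrib_left mult_ac)
  finally show ?thesis .
qed

lemma cnj_vec_mult: "cnj_vec (M *v v) = cnj_mat M *v cnj_vec v"
  by (simp add: cnj_vec_def cnj_mat_def matrix_vector_mult_def vec_eq_iff)

lemma bilin_cnj_vec: "bilin v (cnj_vec v) = complex_of_real ((norm v)\<^sup>2)"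
proof -
  have "bilin v (cnj_vec v) = complex_of_real (\<Sum>i\<in>UNIV. (cmod (v $ i))\<^sup>2)"
    unfolding bilin_def cnj_vec_def of_real_sum complex_norm_square by simp
  then show ?thesis
    by (simp add: norm_vec_def L2_set_def sum_nonneg)
qed

lemma norm_mult_unitary:
  assumes "transpose M ** cnj_mat M = mat 1"
  shows "norm (M *v v) = norm v"
proof -
  have "complex_of_real ((norm (M *v v))\<^sup>2) = complex_of_real ((norm v)\<^sup>2)"
    by (simp only: bilin_cnj_vec[symmetric] cnj_vec_mult bilin_mult_left matrix_vector_mul_assoc assms
        matrix_vector_mul_lid)
  then have "(norm (M *v v))\<^sup>2 = (norm v)\<^sup>2"
    by (simp only: of_real_eq_iff)
  then show ?thesis
    by simp
qed

lemma cmod_bilin_le: "cmod (bilin v w) \<le> norm v * norm w"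
proof -
  have "cmod (bilin v w) \<le> (\<Sum>i\<in>UNIV. cmod (v $ i) * cmod (w $ i))"
    unfolding bilin_def by (rule sum_norm_le) (simp add: norm_mult)
  also have "\<dots> \<le> norm v * norm w"
    unfolding norm_vec_def using L2_set_mult_ineq[of "\<lambda>i. cmod (v $ i)" "\<lambda>i. cmod (w $ i)" UNIV] by simp
  finally show ?thesis .
qed

lemma norm_diag_mat_mult: "(norm (diag_mat d *v v))\<^sup>2 = (\<Sum>i\<in>UNIV. (d i)\<^sup>2 * (cmod (v $ i))\<^sup>2)"
  by (simp add: norm_vec_def L2_set_def sum_nonneg norm_mult power_mult_distrib diag_mat_mult_vec)

lemma transpose_matrix_inv:
  fixes M :: "complex^'n::finite^'n"
  assumes "invertible M" "transpose M = M"
  shows "transpose (matrix_inv M) = matrix_inv M"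
proof -
  have inv: "M ** matrix_inv M = mat 1" "matrix_inv M ** M = mat 1"
    using someI_ex[OF assms(1)[unfolded invertible_def]] by (auto simp: matrix_inv_def)
  have "transpose (matrix_inv M) ** M = mat 1"
    using arg_cong[OF inv(1), of transpose] by (simp add: matrix_transpose_mul assms(2) transpose_mat)
  then have "transpose (matrix_inv M) ** M ** matrix_inv M = matrix_inv M"
    by simp
  then show ?thesis
    by (simp add: matrix_mul_assoc[symmetric] inv(1))
qed

lemma Phi_zz_symmetric:
  assumes "transpose A = A" "transpose C = C" "pos_def_mat (imag_mat C)"
  shows "transpose (Phi_zz A B C) = Phi_zz A B C"
proof -
  have entry: "M $ i $ j = M $ j $ i" if "transpose M = M" for M :: "complex^'a^'a" and i j
    using arg_cong[OF that, of "\<lambda>M. M $ j $ i"] by (simp add: transpose_def)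
  have "transpose (imag_mat C) = imag_mat C"
    using entry[OF assms(2)] by (simp add: imag_mat_def transpose_def vec_eq_iff)
  then have "transpose (matrix_inv (imag_mat C)) = matrix_inv (imag_mat C)"
    by (intro transpose_matrix_inv pos_def_invertible assms)
  then have "transpose (B ** matrix_inv (imag_mat C) ** transpose B) = B ** matrix_inv (imag_mat C) ** transpose B"
    by (simp add: matrix_transpose_mul matrix_mul_assoc)
  from entry[OF this] entry[OF assms(1)] show ?thesis
    by (simp add: Phi_zz_def transpose_def vec_eq_iff)
qed

theorem theorem10:
  fixes A B C U X :: "complex^'n::{finite,linorder}^'n::{finite,linorder}"
    and lam :: "'n \<Rightarrow> real" and rho :: real
  assumes "transpose A = A"
    and "det B \<noteq> 0"
    and "transpose C = C"
    and "pos_def_mat (imag_mat C)"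
    and "\<forall>i. 0 < lam i"
    and "unitary_mat U"
    and "adj_mat U ** Phi_zzbar B C ** U = diag_mat (\<lambda>i. (lam i)\<^sup>2)"
    and "0 < rho" and "rho < Min (range lam)"
    and "unitary_mat X"
    and "transpose X ** diag_mat (\<lambda>i. mu lam rho i / lam i)
         = diag_mat (\<lambda>i. mu lam rho i / lam i) ** X"
  shows "complete_orthonormal_system (Phi A B C)
           (psi (Phi A B C) (Qmat A B C U X lam rho) rho)"
proof -
  define P where "P = Phi_zzbar B C"
  define S where "S = Phi_zz A B C"
  define m where "m = mu lam rho"
  define W where "W = U ** diag_mat m ** X ** diag_mat lam ** transpose U"
  \<comment> \<open>The bracket is the inverse of P, read off from its diagonalization by U.\<close>
  define M where "M = cnj_mat W ** (U ** diag_mat (\<lambda>i. inverse ((lam i)\<^sup>2)) ** adj_mat U)"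
  have lam: "0 < lam i" for i
    using assms(5) by simp
  have rho_lam: "rho < lam i" for i
    using assms(9) by (simp add: Min_gr_iff)
  have m_sq: "(m i)\<^sup>2 = (lam i)\<^sup>2 - rho\<^sup>2" and m_nonneg: "0 \<le> m i" for i
  proof -
    have "rho\<^sup>2 \<le> (lam i)\<^sup>2"
      using rho_lam[of i] assms(8) by (intro power_mono) auto
    then show "(m i)\<^sup>2 = (lam i)\<^sup>2 - rho\<^sup>2" "0 \<le> m i"
      by (simp_all add: m_def mu_def)
  qed
  have U: "adj_mat U ** U = mat 1" "U ** adj_mat U = mat 1"
    using assms(6) by (simp_all add: unitary_mat_def)
  note Uc = unitary_mat_cnj[OF assms(6)] and Xc = unitary_mat_cnj[OF assms(10)]
  have P: "P = U ** diag_mat (\<lambda>i. (lam i)\<^sup>2) ** adj_mat U"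
  proof -
    have "U ** (adj_mat U ** P ** U) ** adj_mat U = (U ** adj_mat U) ** P ** (U ** adj_mat U)"
      by (simp only: matrix_mul_assoc)
    then show ?thesis
      using assms(7) by (simp add: P_def U)
  qed
  have P_herm: "cnj (P $ i $ j) = P $ j $ i" for i j
    using arg_cong[OF Phi_zzbar_hermitian[OF assms(4), of B], of "\<lambda>N. N $ j $ i"]
    by (simp add: P_def adj_mat_def cnj_mat_def transpose_def)
  have S_sym: "S $ i $ j = S $ j $ i" for i j
    using arg_cong[OF Phi_zz_symmetric[OF assms(1,3,4), of B], of "\<lambda>N. N $ j $ i"]
    by (simp add: S_def transpose_def)
  have X_entry: "X $ j $ i * (m j / lam j) = (m i / lam i) * X $ i $ j" for i j
    using arg_cong[OF assms(11), of "\<lambda>N. N $ i $ j"]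
    by (simp add: m_def[symmetric] diag_mat_mult_left diag_mat_mult_right transpose_def)
  \<comment> \<open>The condition on X multiplied by diag lam from both sides; it is exactly the
    symmetry of the middle factor of W.\<close>
  have DXE: "diag_mat lam ** transpose X ** diag_mat m = diag_mat m ** X ** diag_mat lam"
  proof -
    have "lam i * X $ j $ i * m j = m i * X $ i $ j * lam j" for i j
    proof -
      have "lam i * X $ j $ i * m j = lam i * lam j * (X $ j $ i * (m j / lam j))"
        using lam[of j] by simp
      also have "\<dots> = m i * X $ i $ j * lam j"
        unfolding X_entry using lam[of i] by simp
      finally show ?thesis .
    qed
    then show ?thesis
      by (simp add: vec_eq_iff diag_mat_mult_left diag_mat_mult_right transpose_def)
  qed
  have "transpose W = U ** (diag_mat lam ** transpose X ** diag_mat m) ** transpose U"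
    by (simp add: W_def matrix_transpose_mul transpose_diag_mat matrix_mul_assoc)
  then have "transpose W = W"
    unfolding DXE by (simp add: W_def matrix_mul_assoc)
  from arg_cong[OF this, of "\<lambda>N. N $ _ $ _"]
  have W_sym: "W $ i $ j = W $ j $ i" for i j
    by (simp add: transpose_def)
  have "M ** P = cnj_mat W ** (U ** (diag_mat (\<lambda>i. inverse ((lam i)\<^sup>2)) ** (adj_mat U ** U) **
      diag_mat (\<lambda>i. (lam i)\<^sup>2)) ** adj_mat U)"
    unfolding M_def P by (simp only: matrix_mul_assoc)
  also have "\<dots> = cnj_mat W"
    using lam by (simp add: U diag_mat_mult diag_mat_1 less_imp_neq[symmetric])
  finally have MP: "M ** P = cnj_mat W" .
  \<comment> \<open>The condition on X moves X to the left of the diagonal as transpose X, where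
    unitarity cancels it against cnj X.\<close>
  have XdX: "cnj_mat X ** diag_mat (\<lambda>i. m i / lam i) ** X = diag_mat (\<lambda>i. m i / lam i)"
  proof -
    have "cnj_mat X ** (diag_mat (\<lambda>i. m i / lam i) ** X) = cnj_mat X ** transpose X ** diag_mat (\<lambda>i. m i / lam i)"
      unfolding m_def assms(11)[symmetric] by (rule matrix_mul_assoc)
    then show ?thesis
      by (simp add: Xc matrix_mul_assoc)
  qed
  have cW: "cnj_mat W = cnj_mat U ** diag_mat m ** cnj_mat X ** diag_mat lam ** adj_mat U"
    by (simp add: W_def cnj_mat_mult cnj_mat_diag_mat cnj_mat_transpose)
  \<comment> \<open>Inside the product U cancels twice, leaving diag (m / lam) between cnj X and X.
    After \<open>XdX\<close> the diagonal factors multiply to m^2 = lam^2 - rho^2.\<close>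
  have "M ** W = cnj_mat U ** diag_mat m ** (cnj_mat X ** (diag_mat lam ** (adj_mat U ** U) **
      diag_mat (\<lambda>i. inverse ((lam i)\<^sup>2)) ** (adj_mat U ** U) ** diag_mat m) ** X) ** diag_mat lam ** transpose U"
    unfolding M_def cW unfolding W_def by (simp only: matrix_mul_assoc)
  also have "diag_mat lam ** (adj_mat U ** U) ** diag_mat (\<lambda>i. inverse ((lam i)\<^sup>2)) ** (adj_mat U ** U) ** diag_mat m
      = diag_mat (\<lambda>i. m i / lam i)"
    using lam by (simp add: U diag_mat_mult power2_eq_square field_simps less_imp_neq[symmetric])
  also have "cnj_mat X ** diag_mat (\<lambda>i. m i / lam i) ** X = diag_mat (\<lambda>i. m i / lam i)"
    by (rule XdX)
  also have "cnj_mat U ** diag_mat m ** diag_mat (\<lambda>i. m i / lam i) ** diag_mat lam ** transpose U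
      = cnj_mat U ** (diag_mat m ** diag_mat (\<lambda>i. m i / lam i) ** diag_mat lam) ** transpose U"
    by (simp only: matrix_mul_assoc)
  also have "diag_mat m ** diag_mat (\<lambda>i. m i / lam i) ** diag_mat lam = diag_mat (\<lambda>i. (lam i)\<^sup>2 - rho\<^sup>2)"
    unfolding m_sq[symmetric] using lam
    by (simp add: diag_mat_mult power2_eq_square less_imp_neq[symmetric])
  also have "\<dots> = diag_mat (\<lambda>i. (lam i)\<^sup>2) - diag_mat (\<lambda>i. rho\<^sup>2)"
    by (simp add: diag_mat_def vec_eq_iff)
  also have "cnj_mat U ** (diag_mat (\<lambda>i. (lam i)\<^sup>2) - diag_mat (\<lambda>i. rho\<^sup>2)) ** transpose U
      = cnj_mat P - diag_mat (\<lambda>i. rho\<^sup>2)"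
  proof -
    have "cnj_mat U ** diag_mat (\<lambda>i. rho\<^sup>2) = diag_mat (\<lambda>i. rho\<^sup>2) ** cnj_mat U"
      by (simp add: vec_eq_iff diag_mat_mult_left diag_mat_mult_right)
    then have "cnj_mat U ** diag_mat (\<lambda>i. rho\<^sup>2) ** transpose U = diag_mat (\<lambda>i. rho\<^sup>2)"
      by (simp add: matrix_mul_assoc[symmetric] Uc)
    moreover have "cnj_mat U ** diag_mat (\<lambda>i. (lam i)\<^sup>2) ** transpose U = cnj_mat P"
      by (simp add: P cnj_mat_mult cnj_mat_diag_mat cnj_mat_adj_mat)
    moreover have "(K - L) ** N = K ** N - L ** N" "N ** (K - L) = N ** K - N ** L"
      for K L N :: "complex^'n::{finite,linorder}^'n::{finite,linorder}"
      by (simp_all add: matrix_matrix_mult_def vec_eq_iff sum_subtractf algebra_simps)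
    ultimately show ?thesis
      by simp
  qed
  finally have MW: "M ** W = cnj_mat P - diag_mat (\<lambda>i. rho\<^sup>2)" .
  \<comment> \<open>In the unitary coordinates y = transpose U z the form P is diagonal, with the
    squares of lam as weights.\<close>
  have herm: "Re (herm P z) = (norm (diag_mat lam *v (transpose U *v z)))\<^sup>2" for z
  proof -
    define y where "y = transpose U *v z"
    have y: "cnj_vec y = adj_mat U *v cnj_vec z"
      unfolding y_def cnj_vec_mult cnj_mat_transpose ..
    have "P *v cnj_vec z = U *v (diag_mat (\<lambda>i. (lam i)\<^sup>2) *v cnj_vec y)"
      unfolding P y by (simp only: matrix_vector_mul_assoc matrix_mul_assoc)
    then have "herm P z = bilin y (diag_mat (\<lambda>i. (lam i)\<^sup>2) *v cnj_vec y)"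
      unfolding bilin_herm[symmetric] by (simp only: y_def bilin_mult_left transpose_transpose)
    also have "diag_mat (\<lambda>i. (lam i)\<^sup>2) = transpose (diag_mat lam) ** cnj_mat (diag_mat lam)"
      by (simp add: transpose_diag_mat cnj_mat_diag_mat diag_mat_mult power2_eq_square)
    also have "bilin y (transpose (diag_mat lam) ** cnj_mat (diag_mat lam) *v cnj_vec y)
        = bilin (diag_mat lam *v y) (cnj_vec (diag_mat lam *v y))"
      by (simp only: bilin_mult_left cnj_vec_mult matrix_vector_mul_assoc)
    finally show ?thesis
      by (simp add: bilin_cnj_vec y_def)
  qed
  have norm_U: "norm (transpose U *v z) = norm z" for z
    by (rule norm_mult_unitary) (simp add: transpose_transpose cnj_mat_transpose U)
  define m0 where "m0 = (Min (range lam))\<^sup>2"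
  have Min_pos: "0 < Min (range lam)"
    using assms(8,9) by linarith
  have coercive: "m0 * (norm z)\<^sup>2 \<le> Re (herm P z)" for z
  proof -
    define y where "y = transpose U *v z"
    have "m0 * (norm z)\<^sup>2 = (\<Sum>i\<in>UNIV. m0 * (cmod (y $ i))\<^sup>2)"
      unfolding norm_U[of z, symmetric] y_def[symmetric]
      by (simp add: norm_vec_def L2_set_def sum_nonneg sum_distrib_left)
    also have "\<dots> \<le> (\<Sum>i\<in>UNIV. (lam i)\<^sup>2 * (cmod (y $ i))\<^sup>2)"
      unfolding m0_def using Min_pos lam
      by (intro sum_mono mult_right_mono power_mono) (auto simp: less_imp_le simp del: Min_gr_iff)
    finally show ?thesis
      unfolding herm norm_diag_mat_mult y_def .
  qed
  \<comment> \<open>Each ratio is sqrt (1 - (rho / lam i)^2), so the maximum over finitely many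
    indices is below 1 because rho > 0.\<close>
  define kap where "kap = Max (range (\<lambda>i. m i / lam i))"
  have kap_le: "m i \<le> kap * lam i" for i
  proof -
    have "m i / lam i \<le> kap"
      unfolding kap_def by (rule Max_ge) auto
    then show ?thesis
      using lam[of i] by (simp add: field_simps)
  qed
  have kap: "0 \<le> kap" "kap < 1"
  proof -
    have "kap \<in> range (\<lambda>i. m i / lam i)"
      unfolding kap_def by (rule Max_in) auto
    then obtain i where i: "kap = m i / lam i"
      by blast
    have "(m i)\<^sup>2 < (lam i)\<^sup>2"
      using m_sq[of i] assms(8) by simp
    then have "m i < lam i"
      using lam[of i] by (simp add: power_less_imp_less_base)
    then show "0 \<le> kap" "kap < 1"
      using lam[of i] m_nonneg[of i] by (simp_all add: i)
  qed
  \<comment> \<open>In the coordinates y the form W pairs diag m y with X (diag lam y).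
    Cauchy-Schwarz applies, X preserves the norm, and m \<le> kap lam turns the first norm into a
    multiple of the second.\<close>
  have W_bound: "cmod (quad W z) \<le> kap * Re (herm P z)" for z
  proof -
    define y where "y = transpose U *v z"
    have "quad W z = bilin z (U *v (diag_mat m *v (X *v (diag_mat lam *v y))))"
      unfolding bilin_quad[symmetric] W_def y_def by (simp only: matrix_vector_mul_assoc matrix_mul_assoc)
    also have "\<dots> = bilin (diag_mat m *v y) (X *v (diag_mat lam *v y))"
      by (simp only: y_def bilin_mult_left transpose_diag_mat transpose_transpose)
    finally have "cmod (quad W z) \<le> norm (diag_mat m *v y) * norm (X *v (diag_mat lam *v y))"
      using cmod_bilin_le by simp
    also have "norm (X *v (diag_mat lam *v y)) = norm (diag_mat lam *v y)"
      by (rule norm_mult_unitary[OF Xc(1)])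
    finally have 1: "cmod (quad W z) \<le> norm (diag_mat m *v y) * norm (diag_mat lam *v y)" .
    have "(norm (diag_mat m *v y))\<^sup>2 \<le> (\<Sum>i\<in>UNIV. (kap * lam i)\<^sup>2 * (cmod (y $ i))\<^sup>2)"
      unfolding norm_diag_mat_mult
      by (intro sum_mono mult_right_mono power_mono kap_le m_nonneg) auto
    also have "\<dots> = (kap * norm (diag_mat lam *v y))\<^sup>2"
      by (simp add: norm_diag_mat_mult power_mult_distrib sum_distrib_left mult.assoc)
    finally have "norm (diag_mat m *v y) \<le> kap * norm (diag_mat lam *v y)"
      by (rule power2_le_imp_le) (intro mult_nonneg_nonneg kap norm_ge_zero)
    then have "norm (diag_mat m *v y) * norm (diag_mat lam *v y) \<le> kap * norm (diag_mat lam *v y) * norm (diag_mat lam *v y)"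
      by (rule mult_right_mono) simp
    with 1 show ?thesis
      unfolding herm y_def[symmetric] by (simp add: power2_eq_square)
  qed
  interpret hermite P S W M rho kap m0
  proof
    show "(\<Sum>k\<in>UNIV. M $ i $ k * P $ k $ j) = cnj (W $ i $ j)" for i j
      using arg_cong[OF MP, of "\<lambda>N. N $ i $ j"] by (simp add: matrix_matrix_mult_def cnj_mat_def)
    show "(\<Sum>k\<in>UNIV. M $ i $ k * W $ k $ j) = cnj (P $ i $ j) - (if i = j then complex_of_real (rho\<^sup>2) else 0)" for i j
      using arg_cong[OF MW, of "\<lambda>N. N $ i $ j"] by (simp add: matrix_matrix_mult_def cnj_mat_def diag_mat_def)
    show "0 < m0"
      unfolding m0_def using Min_pos by (rule zero_less_power)
  qed (use P_herm S_sym W_sym assms(8) coercive kap W_bound in auto)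
  define xs :: "'n list" where "xs = sorted_list_of_set UNIV"
  have xs: "distinct xs" "set xs = UNIV"
    by (simp_all add: xs_def)
  have phi: "Phi A B C = phi"
    unfolding fun_eq_iff Phi_def phi_def bilin_herm bilin_quad P_def[symmetric] S_def[symmetric] by simp
  have Q: "Qmat A B C U X lam rho = W - S"
    by (simp add: Qmat_def W_def S_def m_def)
  have "psi phi (W - S) rho = nstate xs"
    by (simp add: fun_eq_iff psi_def psi_tilde_def xs_def[symmetric] foldr_adjoint_op
        nstate_def[OF xs] state_def[OF xs] state_norm_def[OF xs])
  then show ?thesis
    unfolding phi Q
    using orthonormal_states_complete[OF nstate_HPhi[OF xs] nstate_orthonormal[OF xs] state_closed_span[OF xs]]
    by simp
qed

end
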